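(* The limit spectrum $\lim_{\varepsilon\to 0}\sigma(T_\varepsilon)$ contains the spectrum $\sigma(T_0)$ (the cell spectrum) of the operator $T_0 : H^1_\#(Y)/\mathbb{R}\to H^1_\#(Y)/\mathbb{R}$ defined as follows: for $u\in H^1_\#(Y)/\mathbb{R}$, $T_0u$ is the unique element of $H^1_\#(Y)/\mathbb{R}$ such that $$\forall v\in H^1_\#(Y)/\mathbb{R},\quad \int_Y \nabla_y (T_0u)\cdot\nabla_y v\,dy=\int_\omega \nabla_y u\cdot\nabla_y v\,dy .$$
   Context: Geometry: let $d\ge 2$, let $\Omega\subset\mathbb{R}^d$ be a bounded Lipschitz domain, $Y=(0,1)^d$, and let $\omega\Subset Y$ be of class $\mathcal{C}^2$, with $\omega$ and $Y\setminus\overline{\omega}$ connected. For $\varepsilon>0$ let $\Xi_\varepsilon=\{\xi\in\mathbb{Z}^d:\ \varepsilon(\xi+Y)\Subset\Omega\}$ and $\omega_\varepsilon=\bigcup_{\xi\in\Xi_\varepsilon}\varepsilon(\xi+\omega)$. The space $H^1_0(\Omega)$ carries the inner product $\int_\Omega\nabla u\cdot\nabla v\,dx$. The operator $T_\varepsilon:H^1_0(\Omega)\to H^1_0(\Omega)$ is defined by: $\int_\Omega\nabla(T_\varepsilon u)\cdot\nabla v\,dx=\int_{\omega_\varepsilon}\nabla u\cdot\nabla v\,dx$ for all $v\in H^1_0(\Omega)$. It is bounded, self-adjoint, with spectrum in $[0,1]$. Limit spectrum: $\lim_{\varepsilon\to0}\sigma(T_\varepsilon)=\{\lambda\in[0,1]:\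 \exists\,\varepsilon_j\downarrow0,\ \lambda_{\varepsilon_j}\in\sigma(T_{\varepsilon_j}),\ \lambda_{\varepsilon_j}\to\lambda\}$. $H^1_\#(Y)$ is the completion of the smooth $Y$-periodic functions for the $H^1(Y)$-norm; $H^1_\#(Y)/\mathbb{R}$ (quotient by constants) carries the inner product $\int_Y\nabla_yu\cdot\nabla_yv\,dy$. *)

theory Defs
  imports "HOL-Analysis.Analysis"
begin

section \<open>Regularity of functions and domains\<close>

primrec Ck :: "nat \<Rightarrow> (real^'n \<Rightarrow> real) \<Rightarrow> bool" where
  "Ck 0 f \<longleftrightarrow> continuous_on UNIV f"
| "Ck (Suc k) f \<longleftrightarrow> (\<forall>x. f differentiable (at x)) \<and>
     (\<forall>i. Ck k (\<lambda>x. frechet_derivative f (at x) (axis i 1)))"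

definition smooth :: "(real^'n \<Rightarrow> real) \<Rightarrow> bool" where
  "smooth f \<longleftrightarrow> (\<forall>k. Ck k f)"

definition grad :: "(real^'n \<Rightarrow> real) \<Rightarrow> real^'n \<Rightarrow> real^'n" where
  "grad f x = (\<chi> i. frechet_derivative f (at x) (axis i 1))"

text \<open>Near each boundary point, the set lies strictly on one side of a graph over the hyperplane
  orthogonal to a unit vector \<open>e\<close>. The predicate \<open>P e g\<close> prescribes the regularity of the graph
  function \<open>g\<close>, of which only the values on that hyperplane matter.\<close>

definition locally_epigraph ::
  "(real^'n \<Rightarrow> (real^'n \<Rightarrow> real) \<Rightarrow> bool) \<Rightarrow> (real^'n) set \<Rightarrow> bool" where
  "locally_epigraph P D \<longleftrightarrow>
     (\<forall>x\<in>frontier D. \<exists>r>0. \<exists>e g. norm e = 1 \<and> P e g \<and>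
        D \<inter> ball x r = {y \<in> ball x r. g (y - (y \<bullet> e) *\<^sub>R e) < y \<bullet> e})"

definition lipschitz_domain :: "(real^'n) set \<Rightarrow> bool" where
  "lipschitz_domain D \<longleftrightarrow> open D \<and> connected D \<and> D \<noteq> {} \<and>
     locally_epigraph (\<lambda>e g. \<exists>L. L-lipschitz_on {y. y \<bullet> e = 0} g) D"

definition open_of_class_C2 :: "(real^'n) set \<Rightarrow> bool" where
  "open_of_class_C2 D \<longleftrightarrow> open D \<and>
     locally_epigraph (\<lambda>e g. Ck 2 (\<lambda>y. g (y - (y \<bullet> e) *\<^sub>R e))) D"

definition compactly_contained :: "(real^'n) set \<Rightarrow> (real^'n) set \<Rightarrow> bool"
    (infix "\<Subset>" 50) where
  "A \<Subset> B \<longleftrightarrow> compact (closure A) \<and> closure A \<subseteq> B"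


section \<open>Sobolev spaces\<close>

text \<open>Functions on an open set \<open>D\<close> are total functions of which only the values on \<open>D\<close> matter.
  The sets \<open>L2\<close>, \<open>H1\<close>, \<open>H10\<close>, \<open>H1per\<close> consist of representatives; the identification of functions
  that agree almost everywhere is made further down.\<close>

definition L2 :: "(real^'n) set \<Rightarrow> (real^'n \<Rightarrow> 'b::euclidean_space) set" where
  "L2 D = {u. u \<in> borel_measurable (lebesgue_on D) \<and>
              integrable (lebesgue_on D) (\<lambda>x. (norm (u x))\<^sup>2)}"

definition test_functions :: "(real^'n) set \<Rightarrow> (real^'n \<Rightarrow> real) set" where
  "test_functions D = {\<phi>. smooth \<phi> \<and> {x. \<phi> x \<noteq> 0} \<Subset> D}"

definition weak_gradient ::
  "(real^'n) set \<Rightarrow> (real^'n \<Rightarrow> real) \<Rightarrow> (real^'n \<Rightarrow> real^'n) \<Rightarrow> bool" where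
  "weak_gradient D u G \<longleftrightarrow> u \<in> L2 D \<and> G \<in> L2 D \<and>
     (\<forall>\<phi>\<in>test_functions D. \<forall>i.
        (LINT x|lebesgue_on D. u x * grad \<phi> x $ i) = - (LINT x|lebesgue_on D. G x $ i * \<phi> x))"

definition H1 :: "(real^'n) set \<Rightarrow> (real^'n \<Rightarrow> real) set" where
  "H1 D = {u. \<exists>G. weak_gradient D u G}"

text \<open>Weak gradients are unique up to null sets, so the choice does not affect integrals.\<close>

definition wgrad :: "(real^'n) set \<Rightarrow> (real^'n \<Rightarrow> real) \<Rightarrow> real^'n \<Rightarrow> real^'n" where
  "wgrad D u = (SOME G. weak_gradient D u G)"

definition H1_norm :: "(real^'n) set \<Rightarrow> (real^'n \<Rightarrow> real) \<Rightarrow> real" where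
  "H1_norm D u = sqrt ((LINT x|lebesgue_on D. (u x)\<^sup>2) +
                       (LINT x|lebesgue_on D. (norm (wgrad D u x))\<^sup>2))"

definition H1_closure ::
  "(real^'n) set \<Rightarrow> (real^'n \<Rightarrow> real) set \<Rightarrow> (real^'n \<Rightarrow> real) set" where
  "H1_closure D S = {u \<in> H1 D. \<forall>\<delta>>0. \<exists>\<phi>\<in>S. H1_norm D (\<lambda>x. u x - \<phi> x) < \<delta>}"

definition H10 :: "(real^'n) set \<Rightarrow> (real^'n \<Rightarrow> real) set" where
  "H10 \<Omega> = H1_closure \<Omega> (test_functions \<Omega>)"

definition unit_cell :: "(real^'n) set" where
  "unit_cell = {y. \<forall>i. 0 < y $ i \<and> y $ i < 1}"

definition lattice_points :: "(real^'n) set" where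
  "lattice_points = {\<xi>. \<forall>i. \<xi> $ i \<in> \<int>}"

definition smooth_periodic :: "(real^'n \<Rightarrow> real) set" where
  "smooth_periodic = {\<phi>. smooth \<phi> \<and> (\<forall>\<xi>\<in>lattice_points. \<forall>x. \<phi> (x + \<xi>) = \<phi> x)}"

text \<open>As the space \<open>H1\<close> on the cell is complete, the completion of the smooth periodic functions
  is realised as their closure in it.\<close>

definition H1per :: "(real^'n \<Rightarrow> real) set" where
  "H1per = H1_closure unit_cell smooth_periodic"


section \<open>The Hilbert spaces as sets of equivalence classes\<close>

definition H10_space :: "(real^'n) set \<Rightarrow> (real^'n \<Rightarrow> real) set set" where
  "H10_space \<Omega> = H10 \<Omega> // {(u, v). u \<in> H10 \<Omega> \<and> v \<in> H10 \<Omega> \<and>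
                                  (AE x in lebesgue_on \<Omega>. u x = v x)}"

definition H1per_mod_const :: "(real^'n \<Rightarrow> real) set set" where
  "H1per_mod_const = H1per // {(u, v). u \<in> H1per \<and> v \<in> H1per \<and>
                                 (\<exists>c. AE x in lebesgue_on unit_cell. u x = v x + c)}"

text \<open>All members of a class have the same weak gradients.\<close>

definition class_grad :: "(real^'n) set \<Rightarrow> (real^'n \<Rightarrow> real) set \<Rightarrow> real^'n \<Rightarrow> real^'n" where
  "class_grad D U = wgrad D (SOME u. u \<in> U)"

text \<open>The integral over \<open>A\<close>, a subset of \<open>D\<close>, of the scalar product of the gradients of two classes
  of functions on \<open>D\<close>. For \<open>A = D\<close> it is the inner product of both Hilbert spaces.\<close>

definition grad_form ::
  "(real^'n) set \<Rightarrow> (real^'n) set \<Rightarrow> (real^'n \<Rightarrow> real) set \<Rightarrow> (real^'n \<Rightarrow> real) set \<Rightarrow> real" where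
  "grad_form D A U V = (LINT x|lebesgue_on A. class_grad D U x \<bullet> class_grad D V x)"

definition grad_norm :: "(real^'n) set \<Rightarrow> (real^'n \<Rightarrow> real) set \<Rightarrow> real" where
  "grad_norm D U = sqrt (grad_form D D U U)"


section \<open>Spectrum\<close>

text \<open>The operator \<open>T - \<mu> I\<close> on equivalence classes. As \<open>T U\<close> is a full class, this set of
  differences is again a full class, also for \<open>\<mu> = 0\<close>.\<close>

definition op_minus_scalar ::
  "(('x \<Rightarrow> real) set \<Rightarrow> ('x \<Rightarrow> real) set) \<Rightarrow> real \<Rightarrow> ('x \<Rightarrow> real) set \<Rightarrow> ('x \<Rightarrow> real) set" where
  "op_minus_scalar T \<mu> U = {(\<lambda>x. w x - \<mu> * u x) | w u. w \<in> T U \<and> u \<in> U}"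

text \<open>The values \<open>\<mu>\<close> for which \<open>T - \<mu> I\<close> is not a bijection of the space \<open>H\<close> with norm \<open>nrm\<close> having
  a bounded inverse; the second conjunct is the boundedness of the inverse. The spaces are real, and
  so are the elements of the spectrum.\<close>

definition spectrum ::
  "('x \<Rightarrow> real) set set \<Rightarrow> (('x \<Rightarrow> real) set \<Rightarrow> real) \<Rightarrow>
   (('x \<Rightarrow> real) set \<Rightarrow> ('x \<Rightarrow> real) set) \<Rightarrow> real set" where
  "spectrum H nrm T = {\<mu>. \<not> (bij_betw (op_minus_scalar T \<mu>) H H \<and>
                             (\<exists>C. \<forall>U\<in>H. nrm U \<le> C * nrm (op_minus_scalar T \<mu> U)))}"


section \<open>The operators\<close>

definition rescale :: "real \<Rightarrow> real^'n \<Rightarrow> (real^'n) set \<Rightarrow> (real^'n) set" where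
  "rescale \<epsilon> \<xi> A = (\<lambda>y. \<epsilon> *\<^sub>R (\<xi> + y)) ` A"

definition cell_indices :: "(real^'n) set \<Rightarrow> real \<Rightarrow> (real^'n) set" where
  "cell_indices \<Omega> \<epsilon> = {\<xi> \<in> lattice_points. rescale \<epsilon> \<xi> unit_cell \<Subset> \<Omega>}"

definition inclusions :: "(real^'n) set \<Rightarrow> (real^'n) set \<Rightarrow> real \<Rightarrow> (real^'n) set" where
  "inclusions \<Omega> \<omega> \<epsilon> = (\<Union>\<xi>\<in>cell_indices \<Omega> \<epsilon>. rescale \<epsilon> \<xi> \<omega>)"

definition T_eps :: "(real^'n) set \<Rightarrow> (real^'n) set \<Rightarrow> real \<Rightarrow>
    (real^'n \<Rightarrow> real) set \<Rightarrow> (real^'n \<Rightarrow> real) set" where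
  "T_eps \<Omega> \<omega> \<epsilon> U = (THE W. W \<in> H10_space \<Omega> \<and>
     (\<forall>V\<in>H10_space \<Omega>. grad_form \<Omega> \<Omega> W V = grad_form \<Omega> (inclusions \<Omega> \<omega> \<epsilon>) U V))"

definition T_zero :: "(real^'n) set \<Rightarrow> (real^'n \<Rightarrow> real) set \<Rightarrow> (real^'n \<Rightarrow> real) set" where
  "T_zero \<omega> U = (THE W. W \<in> H1per_mod_const \<and>
     (\<forall>V\<in>H1per_mod_const. grad_form unit_cell unit_cell W V = grad_form unit_cell \<omega> U V))"

definition spectrum_eps :: "(real^'n) set \<Rightarrow> (real^'n) set \<Rightarrow> real \<Rightarrow> real set" where
  "spectrum_eps \<Omega> \<omega> \<epsilon> = spectrum (H10_space \<Omega>) (grad_norm \<Omega>) (T_eps \<Omega> \<omega> \<epsilon>)"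

definition cell_spectrum :: "(real^'n) set \<Rightarrow> real set" where
  "cell_spectrum \<omega> = spectrum H1per_mod_const (grad_norm unit_cell) (T_zero \<omega>)"

definition limit_spectrum :: "(real^'n) set \<Rightarrow> (real^'n) set \<Rightarrow> real set" where
  "limit_spectrum \<Omega> \<omega> = {\<mu> \<in> {0..1}. \<exists>(e :: nat \<Rightarrow> real) l.
     (\<forall>j. e j > 0) \<and> decseq e \<and> e \<longlonglongrightarrow> 0 \<and>
     (\<forall>j. l j \<in> spectrum_eps \<Omega> \<omega> (e j)) \<and> l \<longlonglongrightarrow> \<mu>}"

end

theory Submission
  imports Defs
begin

text \<open>Weyl sequences. A number \<open>\<mu>\<close> in the cell spectrum has approximate eigenfunctions, and they may be
  taken smooth: \<open>\<phi>\<close> is smooth and periodic, and the field \<open>F = (1\<^sub>\<omega> - \<mu>) \<nabla>\<phi>\<close> is \<open>R + G\<close> with \<open>R\<close> small in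
  \<open>L\<^sup>2\<close> and \<open>G\<close> periodic and divergence free. The function \<open>v x = s \<psi> x \<phi> (x / s)\<close>, with an amplitude \<open>\<psi>\<close>
  of compact support in \<open>\<Omega>\<close>, is then an approximate eigenfunction of \<open>T\<^sub>s\<close> for small \<open>s\<close>: up to terms of
  order \<open>s\<close>, testing with \<open>w\<close> gives \<open>\<integral> \<psi> R(x / s) \<cdot> \<nabla>w\<close>, which is small, plus
  \<open>\<integral> \<psi> G(x / s) \<cdot> \<nabla>w = - \<integral> w G(x / s) \<cdot> \<nabla>\<psi>\<close>. In the last integral \<open>G(x / s)\<close> may be replaced by its mean \<open>m\<close>.
  The mean need not vanish, but in dimension at least two \<open>\<psi>\<close> can oscillate rapidly in a direction
  orthogonal to \<open>m\<close>, which makes \<open>m \<cdot> \<nabla>\<psi>\<close> small in the dual norm compared with \<open>\<psi>\<close> in \<open>L\<^sup>2\<close>. A symmetric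
  operator with such an approximate eigenfunction has a spectral value near \<open>\<mu>\<close>.\<close>

section \<open>Symmetric operators on a Hilbert space\<close>

lemma quadratic_nonneg_discriminant:
  fixes a c d :: real
  assumes "\<And>t. a + 2 * t * d + t\<^sup>2 * c \<ge> 0"
  shows "d\<^sup>2 \<le> a * c"
proof (cases "c = 0")
  case True
  have "d = 0"
  proof (rule ccontr)
    assume "d \<noteq> 0"
    then have "a + 2 * (- (a + 1) / (2 * d)) * d = - 1" by (simp add: field_simps)
    then show False using assms[of "- (a + 1) / (2 * d)"] True by simp
  qed
  then show ?thesis using True by simp
next
  case False
  have "c > 0"
  proof (rule ccontr)
    assume "\<not> c > 0"
    then have c: "c < 0" using False by simp
    define t where "t = (\<bar>a\<bar> + 2 * \<bar>d\<bar> + 1) / (- c) + 1"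
    have t1: "t \<ge> 1" using c by (simp add: t_def field_simps)
    have "(t - 1) * (- c) = \<bar>a\<bar> + 2 * \<bar>d\<bar> + 1" using c by (simp add: t_def)
    then have "t * (- c) > \<bar>a\<bar> + 2 * \<bar>d\<bar>" using c by (simp add: algebra_simps)
    then have "t * (t * (- c)) > t * (\<bar>a\<bar> + 2 * \<bar>d\<bar>)" using t1 by (intro mult_strict_left_mono) auto
    moreover have "t * \<bar>a\<bar> \<ge> a" using t1 mult_right_mono[OF t1, of "\<bar>a\<bar>"] by simp
    moreover have "t * \<bar>d\<bar> \<ge> t * d" using t1 by (intro mult_left_mono) auto
    ultimately have "a + 2 * t * d + t\<^sup>2 * c < 0" by (simp add: algebra_simps power2_eq_square)
    then show False using assms[of t] by simp
  qed
  then show ?thesis using assms[of "- d / c"]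
    by (simp add: field_simps power2_eq_square)
qed

locale hilbert_carrier =
  fixes H :: "'c set" and lin :: "real \<Rightarrow> 'c \<Rightarrow> real \<Rightarrow> 'c \<Rightarrow> 'c" and ip :: "'c \<Rightarrow> 'c \<Rightarrow> real"
  assumes lin_closed: "U \<in> H \<Longrightarrow> V \<in> H \<Longrightarrow> lin a U b V \<in> H"
    and ip_lin: "U \<in> H \<Longrightarrow> V \<in> H \<Longrightarrow> W \<in> H \<Longrightarrow> ip (lin a U b V) W = a * ip U W + b * ip V W"
    and ip_sym: "U \<in> H \<Longrightarrow> V \<in> H \<Longrightarrow> ip U V = ip V U"
    and ip_nonneg: "U \<in> H \<Longrightarrow> ip U U \<ge> 0"
    and ip_definite: "U \<in> H \<Longrightarrow> V \<in> H \<Longrightarrow> ip (lin 1 U (- 1) V) (lin 1 U (- 1) V) = 0 \<Longrightarrow> U = V"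
    and complete: "(\<And>k. X k \<in> H) \<Longrightarrow>
      (\<And>e. e > 0 \<Longrightarrow> \<exists>N::nat. \<forall>m\<ge>N. \<forall>n\<ge>N. ip (lin 1 (X m) (- 1) (X n)) (lin 1 (X m) (- 1) (X n)) < e) \<Longrightarrow>
      \<exists>L\<in>H. (\<lambda>k. ip (lin 1 (X k) (- 1) L) (lin 1 (X k) (- 1) L)) \<longlonglongrightarrow> 0"
    and nonempty: "H \<noteq> {}"
begin

definition nrm :: "'c \<Rightarrow> real" where "nrm U = sqrt (ip U U)"

definition bilinear_form :: "('c \<Rightarrow> 'c \<Rightarrow> real) \<Rightarrow> bool" where
  "bilinear_form b \<longleftrightarrow>
     (\<forall>U\<in>H. \<forall>V\<in>H. \<forall>W\<in>H. \<forall>a c. b (lin a U c V) W = a * b U W + c * b V W) \<and>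
     (\<forall>U\<in>H. \<forall>V\<in>H. b U V = b V U)"

lemma bilinear_form_left:
  "bilinear_form b \<Longrightarrow> U \<in> H \<Longrightarrow> V \<in> H \<Longrightarrow> W \<in> H \<Longrightarrow> b (lin a U c V) W = a * b U W + c * b V W"
  by (auto simp: bilinear_form_def)

lemma bilinear_form_sym: "bilinear_form b \<Longrightarrow> U \<in> H \<Longrightarrow> V \<in> H \<Longrightarrow> b U V = b V U"
  by (auto simp: bilinear_form_def)

lemma bilinear_form_right:
  assumes "bilinear_form b" "U \<in> H" "V \<in> H" "W \<in> H"
  shows "b W (lin a U c V) = a * b W U + c * b W V"
  using bilinear_form_left[OF assms] bilinear_form_sym[OF assms(1)] assms lin_closed by metis

lemma bilinear_form_square:
  assumes b: "bilinear_form b" "U \<in> H" "V \<in> H"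
  shows "b (lin a U c V) (lin a U c V) = a\<^sup>2 * b U U + 2 * a * c * b U V + c\<^sup>2 * b V V"
  using b lin_closed bilinear_form_sym[OF b]
  by (simp add: bilinear_form_left bilinear_form_right power2_eq_square algebra_simps)

lemma ip_bilinear_form: "bilinear_form ip"
  using ip_lin ip_sym by (auto simp: bilinear_form_def)

lemma form_Cauchy_Schwarz:
  assumes b: "bilinear_form b" "U \<in> H" "V \<in> H" and nn: "\<And>U. U \<in> H \<Longrightarrow> b U U \<ge> 0"
  shows "(b U V)\<^sup>2 \<le> b U U * b V V"
proof (rule quadratic_nonneg_discriminant)
  fix t
  show "0 \<le> b U U + 2 * t * b U V + t\<^sup>2 * b V V"
    using nn[OF lin_closed[OF b(2,3), of 1 t]] bilinear_form_square[OF b, of 1 t] by simp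
qed

lemma nrm_nonneg: "U \<in> H \<Longrightarrow> nrm U \<ge> 0"
  by (simp add: nrm_def ip_nonneg)

lemma nrm_sq: "U \<in> H \<Longrightarrow> (nrm U)\<^sup>2 = ip U U"
  by (simp add: nrm_def ip_nonneg)

lemma ip_le_nrm: assumes "U \<in> H" "V \<in> H" shows "\<bar>ip U V\<bar> \<le> nrm U * nrm V"
proof -
  have "(ip U V)\<^sup>2 \<le> (nrm U * nrm V)\<^sup>2"
    using form_Cauchy_Schwarz[OF ip_bilinear_form assms ip_nonneg]
    by (simp add: power_mult_distrib nrm_sq assms)
  then show ?thesis
    using abs_le_square_iff[of "ip U V" "nrm U * nrm V"] nrm_nonneg assms
    by (simp add: abs_mult)
qed

lemma eqI_ip:
  assumes "U \<in> H" "W \<in> H" and eq: "\<And>V. V \<in> H \<Longrightarrow> ip U V = ip W V"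
  shows "U = W"
proof (rule ip_definite[OF assms(1,2)])
  show "ip (lin 1 U (- 1) W) (lin 1 U (- 1) W) = 0"
    using assms(1,2) by (simp add: ip_lin eq lin_closed)
qed

lemma nrm_lin_le:
  assumes "U \<in> H" "V \<in> H" shows "nrm (lin a U c V) \<le> \<bar>a\<bar> * nrm U + \<bar>c\<bar> * nrm V"
proof (rule power2_le_imp_le)
  have "2 * a * c * ip U V \<le> 2 * \<bar>a\<bar> * \<bar>c\<bar> * (nrm U * nrm V)"
  proof -
    have "2 * a * c * ip U V \<le> \<bar>2 * a * c * ip U V\<bar>" by simp
    also have "\<dots> = 2 * \<bar>a\<bar> * \<bar>c\<bar> * \<bar>ip U V\<bar>" by (simp add: abs_mult)
    also have "\<dots> \<le> 2 * \<bar>a\<bar> * \<bar>c\<bar> * (nrm U * nrm V)"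
      by (intro mult_left_mono ip_le_nrm assms) auto
    finally show ?thesis .
  qed
  then show "(nrm (lin a U c V))\<^sup>2 \<le> (\<bar>a\<bar> * nrm U + \<bar>c\<bar> * nrm V)\<^sup>2"
    using assms bilinear_form_square[OF ip_bilinear_form assms, of a c]
    by (simp add: nrm_sq lin_closed power2_sum power_mult_distrib mult_ac)
  show "0 \<le> \<bar>a\<bar> * nrm U + \<bar>c\<bar> * nrm V" using assms nrm_nonneg by simp
qed

lemma nrm_triangle_lin:
  assumes "U \<in> H" "V \<in> H"
  shows "nrm V \<le> nrm U + nrm (lin 1 U (- 1) V)" "nrm U \<le> nrm V + nrm (lin 1 U (- 1) V)"
proof -
  let ?D = "lin 1 U (- 1) V"
  have D: "?D \<in> H" by (intro lin_closed assms)
  have "V = lin 1 U (- 1) ?D" "U = lin 1 V 1 ?D"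
    using assms D by (auto intro!: eqI_ip simp: lin_closed ip_lin)
  then show "nrm V \<le> nrm U + nrm ?D" "nrm U \<le> nrm V + nrm ?D"
    using nrm_lin_le[OF assms(1) D, of 1 "- 1"] nrm_lin_le[OF assms(2) D, of 1 1] by simp_all
qed

lemma Riesz:
  assumes b: "bilinear_form b" and \<alpha>: "\<alpha> > 0" and coercive: "\<And>U. U \<in> H \<Longrightarrow> \<alpha> * ip U U \<le> b U U"
    and bounded: "\<And>U V. U \<in> H \<Longrightarrow> V \<in> H \<Longrightarrow> \<bar>b U V\<bar> \<le> M * (nrm U * nrm V)"
    and flin: "\<And>U V a c. U \<in> H \<Longrightarrow> V \<in> H \<Longrightarrow> f (lin a U c V) = a * f U + c * f V"
    and fbd: "\<And>U. U \<in> H \<Longrightarrow> \<bar>f U\<bar> \<le> K * nrm U"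
  shows "\<exists>W\<in>H. \<forall>V\<in>H. b W V = f V"
proof -
  define J where "J V = b V V - 2 * f V" for V
  have J_ge: "J V \<ge> - (K\<^sup>2 / \<alpha>)" if V: "V \<in> H" for V
  proof -
    have "J V \<ge> \<alpha> * (nrm V)\<^sup>2 - 2 * (K * nrm V)"
      using coercive[OF V] fbd[OF V] by (simp add: J_def nrm_sq V)
    moreover have "\<alpha> * (nrm V)\<^sup>2 - 2 * (K * nrm V) + K\<^sup>2 / \<alpha> = (\<alpha> * nrm V - K)\<^sup>2 / \<alpha>"
      using \<alpha> by (simp add: field_simps power2_eq_square)
    moreover have "(\<alpha> * nrm V - K)\<^sup>2 / \<alpha> \<ge> 0" using \<alpha> by simp
    ultimately show ?thesis by linarith
  qed
  define j where "j = Inf (J ` H)"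
  have bdd: "bdd_below (J ` H)" using J_ge by (auto intro!: bdd_belowI)
  have j_le: "j \<le> J V" if "V \<in> H" for V
    unfolding j_def using that bdd by (intro cInf_lower) auto
  have "\<exists>V\<in>H. J V < j + 1 / real (Suc k)" for k
    using cInf_lessD[of "J ` H" "j + 1 / real (Suc k)"] nonempty by (auto simp: j_def)
  then obtain X where X: "\<And>k. X k \<in> H" "\<And>k. J (X k) < j + 1 / real (Suc k)" by metis
  have par: "b (lin 1 U (- 1) V) (lin 1 U (- 1) V)
      = 2 * J U + 2 * J V - 4 * J (lin (1/2) U (1/2) V)" if "U \<in> H" "V \<in> H" for U V
    using that by (simp add: J_def bilinear_form_square[OF b] flin power2_eq_square field_simps)
  have "\<exists>L\<in>H. (\<lambda>k. ip (lin 1 (X k) (- 1) L) (lin 1 (X k) (- 1) L)) \<longlonglongrightarrow> 0"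
  proof (rule complete[OF X(1)])
    fix e :: real assume e: "e > 0"
    obtain N where N: "4 / (\<alpha> * e) < real N" using reals_Archimedean2 by blast
    show "\<exists>N::nat. \<forall>m\<ge>N. \<forall>n\<ge>N. ip (lin 1 (X m) (- 1) (X n)) (lin 1 (X m) (- 1) (X n)) < e"
    proof (intro exI allI impI)
      fix m n assume mn: "m \<ge> N" "n \<ge> N"
      have s: "1 / real (Suc k) < \<alpha> * e / 4" if "k \<ge> N" for k
      proof -
        have "4 / (\<alpha> * e) < real (Suc k)" using N that by simp
        then show ?thesis using \<alpha> e by (simp add: field_simps)
      qed
      let ?D = "lin 1 (X m) (- 1) (X n)"
      have "\<alpha> * ip ?D ?D \<le> b ?D ?D" by (intro coercive lin_closed X)
      also have "\<dots> \<le> 2 * J (X m) + 2 * J (X n) - 4 * j"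
        using par[OF X(1) X(1)] j_le[OF lin_closed[OF X(1) X(1)]] by simp
      also have "\<dots> < \<alpha> * e"
        using X(2)[of m] X(2)[of n] s[OF mn(1)] s[OF mn(2)] by simp
      finally show "ip ?D ?D < e" using \<alpha> by simp
    qed
  qed
  then obtain L where L: "L \<in> H" and lim: "(\<lambda>k. ip (lin 1 (X k) (- 1) L) (lin 1 (X k) (- 1) L)) \<longlonglongrightarrow> 0"
    by blast
  define d where "d k = nrm (lin 1 (X k) (- 1) L)" for k
  have d0: "d \<longlonglongrightarrow> 0" using tendsto_real_sqrt[OF lim] by (simp add: d_def[abs_def] nrm_def)
  have "\<bar>J (X k) - J L\<bar> \<le> 2 * (M * (nrm L * d k)) + M * (d k * d k) + 2 * (K * d k)" for k
  proof -
    let ?D = "lin 1 (X k) (- 1) L"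
    have D: "?D \<in> H" by (intro lin_closed X L)
    have "J (X k) - J L = 2 * b L ?D + b ?D ?D - 2 * f ?D"
      using X(1)[of k] L bilinear_form_sym[OF b X(1)[of k] L]
      by (simp add: J_def bilinear_form_square[OF b] bilinear_form_right[OF b] flin)
    then show ?thesis using bounded[OF L D] bounded[OF D D] fbd[OF D] unfolding d_def by linarith
  qed
  moreover have "(\<lambda>k. 2 * (M * (nrm L * d k)) + M * (d k * d k) + 2 * (K * d k)) \<longlonglongrightarrow> 0"
    using d0 by (auto intro!: tendsto_eq_intros)
  ultimately have "(\<lambda>k. J (X k) - J L) \<longlonglongrightarrow> 0"
    by (intro Lim_null_comparison[of "\<lambda>k. J (X k) - J L"]) auto
  then have JL: "(\<lambda>k. J (X k)) \<longlonglongrightarrow> J L" using LIM_zero_iff by blast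
  have "(\<lambda>k. j + 1 / real (Suc k)) \<longlonglongrightarrow> j + 0"
    by (intro tendsto_add tendsto_const lim_1_over_n LIMSEQ_Suc)
  then have "J L \<le> j" using X(2) LIMSEQ_le[OF JL, of "\<lambda>k. j + 1 / real (Suc k)" j] less_imp_le by auto
  have "b L V = f V" if V: "V \<in> H" for V
  proof -
    have "(b L V - f V)\<^sup>2 \<le> 0 * b V V"
    proof (rule quadratic_nonneg_discriminant)
      fix t
      have "J L \<le> J (lin 1 L t V)" using j_le[OF lin_closed[OF L V]] \<open>J L \<le> j\<close> by (rule order_trans[rotated])
      then show "0 \<le> 0 + 2 * t * (b L V - f V) + t\<^sup>2 * b V V"
        using L V by (simp add: J_def bilinear_form_square[OF b] flin algebra_simps)
    qed
    then show ?thesis by simp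
  qed
  then show ?thesis using L by blast
qed

definition symmetric_op :: "real \<Rightarrow> ('c \<Rightarrow> 'c) \<Rightarrow> bool" where
  "symmetric_op M T \<longleftrightarrow> M \<ge> 0 \<and> (\<forall>U\<in>H. T U \<in> H \<and> nrm (T U) \<le> M * nrm U) \<and>
     (\<forall>U\<in>H. \<forall>V\<in>H. ip (T U) V = ip U (T V))"

lemma symmetric_op_lin:
  assumes "symmetric_op M T" "U \<in> H" "V \<in> H"
  shows "T (lin a U c V) = lin a (T U) c (T V)"
  by (rule eqI_ip) (use assms lin_closed in \<open>auto simp: symmetric_op_def ip_lin\<close>)

lemma symmetric_op_shift:
  assumes T: "symmetric_op M T"
  shows "symmetric_op (M + \<bar>\<mu>\<bar>) (\<lambda>U. lin 1 (T U) (- \<mu>) U)"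
  unfolding symmetric_op_def
proof (intro conjI ballI)
  fix U assume U: "U \<in> H"
  then have TU: "T U \<in> H" "nrm (T U) \<le> M * nrm U" using T by (auto simp: symmetric_op_def)
  show "lin 1 (T U) (- \<mu>) U \<in> H" using U TU by (simp add: lin_closed)
  show "nrm (lin 1 (T U) (- \<mu>) U) \<le> (M + \<bar>\<mu>\<bar>) * nrm U"
    using nrm_lin_le[OF TU(1) U, of 1 "- \<mu>"] TU(2) by (simp add: algebra_simps)
  fix V assume V: "V \<in> H"
  then have TV: "T V \<in> H" using T by (auto simp: symmetric_op_def)
  have "ip (T U) V = ip U (T V)" using T U V by (auto simp: symmetric_op_def)
  then show "ip (lin 1 (T U) (- \<mu>) U) V = ip U (lin 1 (T V) (- \<mu>) V)"
    using U V TU TV bilinear_form_right[OF ip_bilinear_form] by (simp add: ip_lin)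
qed (use T in \<open>auto simp: symmetric_op_def\<close>)

lemma symmetric_op_form:
  assumes T: "symmetric_op M T"
  shows "bilinear_form (\<lambda>U V. ip (T U) (T V))"
proof -
  have TH: "T U \<in> H" if "U \<in> H" for U using T that by (auto simp: symmetric_op_def)
  show ?thesis unfolding bilinear_form_def by (auto simp: symmetric_op_lin[OF T] TH ip_lin ip_sym)
qed

text \<open>For a symmetric operator, being bounded below already gives surjectivity: the Riesz
  representative \<open>W\<close> of \<open>ip F\<close> for the equivalent inner product \<open>ip (T U) (T V)\<close> has
  \<open>T (T W) = F\<close>.\<close>

lemma bounded_below_imp_bij:
  assumes T: "symmetric_op M T" and C: "\<And>U. U \<in> H \<Longrightarrow> nrm U \<le> C * nrm (T U)"
  shows "bij_betw T H H"
proof -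
  have TH: "T U \<in> H" if "U \<in> H" for U using T that by (auto simp: symmetric_op_def)
  have Tb: "nrm (T U) \<le> M * nrm U" if "U \<in> H" for U using T that by (auto simp: symmetric_op_def)
  have M0: "M \<ge> 0" using T by (auto simp: symmetric_op_def)
  have inj: "inj_on T H"
  proof (rule inj_onI)
    fix U V assume UV: "U \<in> H" "V \<in> H" "T U = T V"
    let ?D = "lin 1 U (- 1) V"
    have D: "?D \<in> H" using UV lin_closed by blast
    have "ip (T ?D) (T ?D) = 0"
      using UV by (simp add: symmetric_op_lin[OF T] bilinear_form_square[OF ip_bilinear_form] TH)
    then have "nrm ?D \<le> 0" using C[OF D] by (simp add: nrm_def)
    then have "nrm ?D = 0" using nrm_nonneg[OF D] by simp
    then have "ip ?D ?D = 0" using nrm_sq[OF D] by simp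
    then show "U = V" using ip_definite UV by blast
  qed
  have "\<exists>W\<in>H. T W = F" if F: "F \<in> H" for F
  proof -
    define D where "D = \<bar>C\<bar> + 1"
    have D: "D > 0" by (simp add: D_def)
    have below: "nrm U \<le> D * nrm (T U)" if "U \<in> H" for U
    proof -
      have "C * nrm (T U) \<le> D * nrm (T U)"
        using nrm_nonneg[OF TH[OF that]] by (intro mult_right_mono) (auto simp: D_def)
      then show ?thesis using C[OF that] by simp
    qed
    have "\<exists>W\<in>H. \<forall>V\<in>H. (\<lambda>U V. ip (T U) (T V)) W V = ip F V"
    proof (rule Riesz[OF symmetric_op_form[OF T]])
      show "1 / D\<^sup>2 > 0" using D by simp
      show "1 / D\<^sup>2 * ip U U \<le> ip (T U) (T U)" if U: "U \<in> H" for U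
      proof -
        have "(nrm U)\<^sup>2 \<le> (D * nrm (T U))\<^sup>2" using below[OF U] nrm_nonneg[OF U] by (intro power_mono) auto
        then show ?thesis using D U TH[OF U] by (simp add: power_mult_distrib nrm_sq field_simps)
      qed
      show "\<bar>ip (T U) (T V)\<bar> \<le> M\<^sup>2 * (nrm U * nrm V)" if "U \<in> H" "V \<in> H" for U V
      proof -
        have "\<bar>ip (T U) (T V)\<bar> \<le> nrm (T U) * nrm (T V)" using ip_le_nrm TH that by simp
        also have "\<dots> \<le> (M * nrm U) * (M * nrm V)"
          using Tb that nrm_nonneg TH M0 by (intro mult_mono) auto
        finally show ?thesis by (simp add: power2_eq_square algebra_simps)
      qed
      show "ip F (lin a U c V) = a * ip F U + c * ip F V" if "U \<in> H" "V \<in> H" for U V a c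
        using bilinear_form_right[OF ip_bilinear_form] that F by simp
      show "\<bar>ip F U\<bar> \<le> nrm F * nrm U" if "U \<in> H" for U using ip_le_nrm F that by simp
    qed
    then obtain W where W: "W \<in> H" "\<And>V. V \<in> H \<Longrightarrow> ip (T W) (T V) = ip F V" by blast
    have "T (T W) = F"
      by (rule eqI_ip) (use W F TH T in \<open>auto simp: symmetric_op_def\<close>)
    then show ?thesis using W(1) TH by blast
  qed
  then show ?thesis using inj TH by (auto simp: bij_betw_def)
qed

lemma approximate_eigenvalue:
  assumes T: "symmetric_op M T" and U: "U \<in> H" "nrm U > 0"
    and c: "nrm (lin 1 (T U) (- \<mu>) U) \<le> c * nrm U"
  shows "\<exists>\<nu>. \<bar>\<nu> - \<mu>\<bar> \<le> c \<and> \<not> (\<exists>C. \<forall>U\<in>H. nrm U \<le> C * nrm (lin 1 (T U) (- \<nu>) U))"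
proof (rule ccontr)
  assume neg: "\<not> ?thesis"
  define D where "D \<nu> U = lin 1 (T U) (- \<nu>) U" for \<nu> U
  have Dsym: "symmetric_op (M + \<bar>\<nu>\<bar>) (D \<nu>)" for \<nu>
    using symmetric_op_shift[OF T, of \<nu>] by (simp add: D_def[abs_def])
  have TH: "T V \<in> H" if "V \<in> H" for V using T that by (auto simp: symmetric_op_def)
  have DH: "D \<nu> V \<in> H" if "V \<in> H" for \<nu> V using that by (simp add: D_def lin_closed TH)
  define R where "R V = nrm (D \<mu> V) / nrm V" for V
  define m where "m = Inf (R ` {V\<in>H. nrm V > 0})"
  have R0: "R V \<ge> 0" if "V \<in> H" for V using that DH nrm_nonneg by (simp add: R_def)
  have bdd: "bdd_below (R ` {V\<in>H. nrm V > 0})" using R0 by (intro bdd_belowI[of _ 0]) auto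
  have m_le: "m \<le> R V" if "V \<in> H" "nrm V > 0" for V
    unfolding m_def using that bdd by (intro cInf_lower) auto
  have m0: "m \<ge> 0" unfolding m_def using U R0 by (intro cInf_greatest) auto
  have "R U \<le> c" using c U(2) by (simp add: R_def D_def field_simps)
  then have mc: "m \<le> c" using m_le[OF U] by simp
  define B where "B V W = ip (D \<mu> V) (D \<mu> W) - m\<^sup>2 * ip V W" for V W
  have B: "bilinear_form B"
    using symmetric_op_form[OF Dsym[of \<mu>]] ip_bilinear_form
    by (auto simp: bilinear_form_def B_def algebra_simps)
  have B0: "B V V \<ge> 0" if V: "V \<in> H" for V
  proof -
    have "m * nrm V \<le> nrm (D \<mu> V)"
    proof (cases "nrm V > 0")
      case True
      then show ?thesis using m_le[OF V True] by (simp add: R_def field_simps)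
    next
      case False
      then show ?thesis using nrm_nonneg[OF V] nrm_nonneg[OF DH[OF V]] by simp
    qed
    then have "(m * nrm V)\<^sup>2 \<le> (nrm (D \<mu> V))\<^sup>2" using m0 nrm_nonneg[OF V] by (intro power_mono) auto
    then show ?thesis using V DH by (simp add: B_def power_mult_distrib nrm_sq)
  qed
  define E where "E V = D (\<mu> + m) (D (\<mu> - m) V)" for V
  have EH: "E V \<in> H" if "V \<in> H" for V using that by (simp add: E_def DH)
  have ipE: "ip (E V) W = B V W" if VW: "V \<in> H" "W \<in> H" for V W
  proof -
    have T2: "ip (T (T V)) W = ip (T V) (T W)" "ip V (T W) = ip (T V) W"
      using T VW TH by (auto simp: symmetric_op_def)
    have "T (D (\<mu> - m) V) = lin 1 (T (T V)) (- (\<mu> - m)) (T V)"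
      unfolding D_def using symmetric_op_lin[OF T] VW TH by simp
    then show ?thesis
      using VW TH DH T2
      by (simp add: E_def B_def D_def ip_lin lin_closed bilinear_form_right[OF ip_bilinear_form]
            power2_eq_square algebra_simps)
  qed
  define Q where "Q = (M + \<bar>\<mu>\<bar>)\<^sup>2"
  have BQ: "B V V \<le> Q * ip V V" if V: "V \<in> H" for V
  proof -
    have "nrm (D \<mu> V) \<le> (M + \<bar>\<mu>\<bar>) * nrm V" using Dsym[of \<mu>] V by (auto simp: symmetric_op_def)
    then have "(nrm (D \<mu> V))\<^sup>2 \<le> ((M + \<bar>\<mu>\<bar>) * nrm V)\<^sup>2"
      using nrm_nonneg[OF DH[OF V]] by (intro power_mono) auto
    moreover have "m\<^sup>2 * ip V V \<ge> 0" using ip_nonneg[OF V] by simp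
    ultimately show ?thesis using V DH by (simp add: B_def Q_def power_mult_distrib nrm_sq)
  qed
  have EB: "ip (E V) (E V) \<le> Q * B V V" if V: "V \<in> H" for V
  proof (cases "ip (E V) (E V) > 0")
    case True
    have "(ip (E V) (E V))\<^sup>2 \<le> B V V * B (E V) (E V)"
      using form_Cauchy_Schwarz[OF B V EH[OF V] B0] ipE[OF V EH[OF V]] by simp
    also have "\<dots> \<le> B V V * (Q * ip (E V) (E V))"
      using BQ[OF EH[OF V]] B0[OF V] by (intro mult_left_mono) auto
    finally have "ip (E V) (E V) * ip (E V) (E V) \<le> (Q * B V V) * ip (E V) (E V)"
      by (simp add: power2_eq_square algebra_simps)
    then show ?thesis using True by simp
  next
    case False
    moreover have "Q * B V V \<ge> 0" using B0[OF V] by (simp add: Q_def)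
    ultimately show ?thesis by linarith
  qed
  have below: "\<exists>C. \<forall>U\<in>H. nrm U \<le> C * nrm (D \<nu> U)" if "\<bar>\<nu> - \<mu>\<bar> \<le> c" for \<nu>
    using neg that unfolding D_def by blast
  obtain C1 where C1: "\<And>V. V \<in> H \<Longrightarrow> nrm V \<le> C1 * nrm (D (\<mu> + m) V)"
    using below[of "\<mu> + m"] m0 mc by auto
  obtain C2 where C2: "\<And>V. V \<in> H \<Longrightarrow> nrm V \<le> C2 * nrm (D (\<mu> - m) V)"
    using below[of "\<mu> - m"] m0 mc by auto
  define C where "C = \<bar>C2\<bar> * \<bar>C1\<bar>"
  have C: "nrm V \<le> C * nrm (E V)" if V: "V \<in> H" for V
  proof -
    let ?W = "D (\<mu> - m) V"
    have "nrm V \<le> C2 * nrm ?W" by (rule C2[OF V])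
    also have "\<dots> \<le> \<bar>C2\<bar> * nrm ?W" using nrm_nonneg[OF DH[OF V]] by (intro mult_right_mono) auto
    also have "\<dots> \<le> \<bar>C2\<bar> * (\<bar>C1\<bar> * nrm (D (\<mu> + m) ?W))"
    proof (rule mult_left_mono)
      have "nrm ?W \<le> C1 * nrm (D (\<mu> + m) ?W)" by (rule C1[OF DH[OF V]])
      also have "\<dots> \<le> \<bar>C1\<bar> * nrm (D (\<mu> + m) ?W)"
        using nrm_nonneg[OF DH[OF DH[OF V]]] by (intro mult_right_mono) auto
      finally show "nrm ?W \<le> \<bar>C1\<bar> * nrm (D (\<mu> + m) ?W)" .
    qed simp
    finally show ?thesis by (simp add: C_def E_def)
  qed
  have key: "1 \<le> C\<^sup>2 * Q * ((R V)\<^sup>2 - m\<^sup>2)" if V: "V \<in> H" "nrm V > 0" for V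
  proof -
    have "(nrm V)\<^sup>2 \<le> (C * nrm (E V))\<^sup>2" using C[OF V(1)] nrm_nonneg[OF V(1)] by (intro power_mono) auto
    also have "\<dots> = C\<^sup>2 * ip (E V) (E V)" using V EH by (simp add: power_mult_distrib nrm_sq)
    also have "\<dots> \<le> C\<^sup>2 * (Q * B V V)" using EB[OF V(1)] by (intro mult_left_mono) auto
    also have "B V V = ((R V)\<^sup>2 - m\<^sup>2) * (nrm V)\<^sup>2"
      using V DH by (simp add: B_def R_def nrm_sq[symmetric] power_divide field_simps)
    finally have "1 * (nrm V)\<^sup>2 \<le> (C\<^sup>2 * Q * ((R V)\<^sup>2 - m\<^sup>2)) * (nrm V)\<^sup>2" by (simp add: algebra_simps)
    then show ?thesis using V(2) by (simp only: mult_le_cancel_right) auto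
  qed
  have "\<exists>V\<in>H. nrm V > 0 \<and> R V < m + 1 / real (Suc k)" for k
    using cInf_lessD[of "R ` {V\<in>H. nrm V > 0}" "m + 1 / real (Suc k)"] U by (auto simp: m_def)
  then obtain X where X: "\<And>k. X k \<in> H" "\<And>k. nrm (X k) > 0" "\<And>k. R (X k) < m + 1 / real (Suc k)"
    by metis
  have "1 \<le> C\<^sup>2 * Q * ((m + 1 / real (Suc k))\<^sup>2 - m\<^sup>2)" for k
  proof -
    have "(R (X k))\<^sup>2 \<le> (m + 1 / real (Suc k))\<^sup>2" using X(1)[of k] X(3)[of k] R0 by (intro power_mono) auto
    moreover have "C\<^sup>2 * Q \<ge> 0" by (simp add: Q_def)
    ultimately have "C\<^sup>2 * Q * ((R (X k))\<^sup>2 - m\<^sup>2) \<le> C\<^sup>2 * Q * ((m + 1 / real (Suc k))\<^sup>2 - m\<^sup>2)"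
      by (intro mult_left_mono) auto
    then show ?thesis using key[OF X(1) X(2), of k] by linarith
  qed
  moreover have "(\<lambda>k. C\<^sup>2 * Q * ((m + 1 / real (Suc k))\<^sup>2 - m\<^sup>2)) \<longlonglongrightarrow> C\<^sup>2 * Q * ((m + 0)\<^sup>2 - m\<^sup>2)"
    by (intro tendsto_mult tendsto_diff tendsto_power tendsto_add tendsto_const lim_1_over_n LIMSEQ_Suc)
  ultimately have "1 \<le> C\<^sup>2 * Q * ((m + 0)\<^sup>2 - m\<^sup>2)" by (intro LIMSEQ_le_const) auto
  then show False by simp
qed

lemma dual_nrm_bound:
  assumes U: "U \<in> H" and dense: "\<And>V e. V \<in> H \<Longrightarrow> e > 0 \<Longrightarrow> \<exists>W\<in>S. nrm (lin 1 V (- 1) W) < e"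
    and S: "S \<subseteq> H" and c: "\<And>W. W \<in> S \<Longrightarrow> \<bar>ip U W\<bar> \<le> c * nrm W" "c \<ge> 0"
  shows "nrm U \<le> c"
proof -
  have "(nrm U)\<^sup>2 \<le> c * nrm U + (nrm U + c) * e" if e: "e > 0" for e
  proof -
    obtain W where W: "W \<in> S" "nrm (lin 1 U (- 1) W) < e" using dense[OF U e] by blast
    let ?D = "lin 1 U (- 1) W"
    have WH: "W \<in> H" and D: "?D \<in> H" using W S U lin_closed by auto
    have nW: "nrm W \<le> nrm U + nrm ?D" by (rule nrm_triangle_lin(1)[OF U WH])
    have "(nrm U)\<^sup>2 = ip U W + ip U ?D"
      using U WH bilinear_form_right[OF ip_bilinear_form] by (simp add: nrm_sq)
    also have "\<dots> \<le> c * nrm W + nrm U * nrm ?D"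
      using c(1)[OF W(1)] ip_le_nrm[OF U D] by simp
    also have "\<dots> \<le> c * (nrm U + e) + nrm U * e"
    proof (intro add_mono mult_left_mono)
      show "nrm W \<le> nrm U + e" using nW W(2) by simp
    qed (use W(2) c(2) nrm_nonneg[OF U] in auto)
    finally show ?thesis by (simp add: algebra_simps)
  qed
  note * = this
  have "(nrm U)\<^sup>2 \<le> c * nrm U"
  proof (rule field_le_epsilon)
    fix e :: real assume e: "e > 0"
    define a where "a = nrm U + c"
    have a: "a \<ge> 0" using nrm_nonneg[OF U] c(2) by (simp add: a_def)
    have "a * (e / (a + 1)) \<le> e"
    proof -
      have "a * e \<le> (a + 1) * e" using e by (simp add: algebra_simps)
      then show ?thesis using a by (simp add: field_simps)
    qed
    then show "(nrm U)\<^sup>2 \<le> c * nrm U + e" using *[of "e / (a + 1)"] e a unfolding a_def[symmetric]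
      by (smt (verit) divide_pos_pos)
  qed
  then show ?thesis using nrm_nonneg[OF U] c(2) by (cases "nrm U = 0") (auto simp: power2_eq_square)
qed

end

section \<open>Smooth functions\<close>

lemma has_derivative_grad:
  fixes f :: "real^'n \<Rightarrow> real"
  assumes "f differentiable (at x)"
  shows "(f has_derivative (\<lambda>h. grad f x \<bullet> h)) (at x)"
proof -
  have d: "(f has_derivative frechet_derivative f (at x)) (at x)"
    using assms by (simp add: frechet_derivative_works)
  then interpret l: linear "frechet_derivative f (at x)" by (rule has_derivative_linear)
  have "frechet_derivative f (at x) h = grad f x \<bullet> h" for h
  proof -
    have "frechet_derivative f (at x) h = frechet_derivative f (at x) (\<Sum>i\<in>UNIV. h $ i *\<^sub>R axis i 1)"
      using basis_expansion[of h] by (simp add: scalar_mult_eq_scaleR)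
    also have "\<dots> = (\<Sum>i\<in>UNIV. h $ i * frechet_derivative f (at x) (axis i 1))"
      by (simp add: l.sum l.scaleR)
    finally show ?thesis by (simp add: grad_def inner_vec_def mult.commute)
  qed
  then show ?thesis using d by presburger
qed

lemma grad_eqI:
  fixes f :: "real^'n \<Rightarrow> real"
  assumes "(f has_derivative (\<lambda>h. G \<bullet> h)) (at x)"
  shows "grad f x = G"
proof -
  have "frechet_derivative f (at x) = (\<lambda>h. G \<bullet> h)"
    using frechet_derivative_at[OF assms] by simp
  then show ?thesis by (simp add: grad_def vec_eq_iff inner_axis)
qed

lemma grad_has_derivative_eq:
  fixes f :: "real^'n \<Rightarrow> real"
  assumes "(f has_derivative f') (at x)"
  shows "grad f x $ i = f' (axis i 1)"
  using frechet_derivative_at[OF assms] by (simp add: grad_def)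

lemma grad_const [simp]: "grad (\<lambda>_::real^'n. c) x = 0"
  by (rule grad_eqI) simp

lemma grad_add:
  assumes "f differentiable (at x)" "g differentiable (at x)"
  shows "grad (\<lambda>x::real^'n. f x + g x) x = grad f x + grad g x"
  by (rule grad_eqI) (use has_derivative_add[OF assms[THEN has_derivative_grad]] in \<open>simp add: inner_add_left\<close>)

lemma grad_mult:
  assumes "f differentiable (at x)" "g differentiable (at x)"
  shows "grad (\<lambda>x::real^'n. f x * g x) x = f x *\<^sub>R grad g x + g x *\<^sub>R grad f x"
  by (rule grad_eqI)
    (use has_derivative_mult[OF assms[THEN has_derivative_grad]] in \<open>simp add: inner_add_left mult_ac\<close>)

lemma grad_cmult:
  assumes "f differentiable (at x)"
  shows "grad (\<lambda>x::real^'n. c * f x) x = c *\<^sub>R grad f x"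
  using grad_mult[OF differentiable_const assms, of c] by simp

lemma grad_compose:
  assumes "p differentiable (at x)" "(h has_real_derivative d) (at (p x))"
  shows "grad (\<lambda>x::real^'n. h (p x)) x = d *\<^sub>R grad p x"
    and "(\<lambda>x::real^'n. h (p x)) differentiable (at x)"
proof -
  have "((\<lambda>x. h (p x)) has_derivative (\<lambda>k. (grad p x \<bullet> k) * d)) (at x)"
    using assms(2)[unfolded has_field_derivative_def]
      has_derivative_compose[OF has_derivative_grad[OF assms(1)], of h "(*) d"]
    by (simp add: mult.commute[of d])
  then have d: "((\<lambda>x. h (p x)) has_derivative (\<lambda>k. (d *\<^sub>R grad p x) \<bullet> k)) (at x)"
    by (simp add: mult.commute)
  then show "grad (\<lambda>x. h (p x)) x = d *\<^sub>R grad p x" by (rule grad_eqI)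
  from d show "(\<lambda>x. h (p x)) differentiable (at x)" unfolding differentiable_def by blast
qed

lemma Ck_Suc:
  "Ck (Suc k) f \<longleftrightarrow> (\<forall>x. f differentiable (at x)) \<and> (\<forall>i. Ck k (\<lambda>x. grad f x $ i))"
  by (simp add: grad_def)

lemmas Ck.simps(2) [simp del]

lemma Ck_SucD: "Ck (Suc k) f \<Longrightarrow> Ck k f"
proof (induction k arbitrary: f)
  case 0
  then show ?case
    by (auto simp: Ck_Suc intro!: continuous_at_imp_continuous_on differentiable_imp_continuous_within)
qed (auto simp: Ck_Suc)

lemma Ck_const [simp]: "Ck k (\<lambda>_. c)"
  by (induction k arbitrary: c) (auto simp: Ck_Suc)

lemma Ck_add: "Ck k f \<Longrightarrow> Ck k g \<Longrightarrow> Ck k (\<lambda>x. f x + g x)"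
  by (induction k arbitrary: f g) (auto simp: Ck_Suc grad_add intro: continuous_on_add)

lemma Ck_mult: "Ck k f \<Longrightarrow> Ck k g \<Longrightarrow> Ck k (\<lambda>x. f x * g x)"
proof (induction k arbitrary: f g)
  case 0
  then show ?case by (auto intro: continuous_on_mult)
next
  case (Suc k)
  then show ?case using Suc.prems[THEN Ck_SucD]
    by (auto simp: Ck_Suc grad_mult intro!: Ck_add Suc.IH)
qed

lemma Ck_sum: "(\<And>a. a \<in> A \<Longrightarrow> Ck k (f a)) \<Longrightarrow> Ck k (\<lambda>x. \<Sum>a\<in>A. f a x)"
  by (induction A rule: infinite_finite_induct) (auto intro: Ck_add)

lemma Ck_local:
  assumes "\<And>x. \<exists>S g. open S \<and> x \<in> S \<and> (\<forall>y\<in>S. f y = g y) \<and> Ck k g"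
  shows "Ck k f"
  using assms
proof (induction k arbitrary: f)
  case 0
  show ?case unfolding Ck.simps
  proof (intro continuous_at_imp_continuous_on ballI)
    fix x
    obtain S g where S: "open S" "x \<in> S" "\<forall>y\<in>S. f y = g y" "Ck 0 g" using 0 by blast
    then have "isCont g x" by (simp add: continuous_on_eq_continuous_at)
    moreover have "eventually (\<lambda>y. f y = g y) (nhds x)"
      using S eventually_nhds by blast
    ultimately show "isCont f x" by (simp add: isCont_cong)
  qed
next
  case (Suc k)
  have eq: "f differentiable (at y) \<and> grad f y = grad g y" if "open S" "\<forall>y\<in>S. f y = g y" "Ck (Suc k) g" "y \<in> S" for S g y
  proof -
    have "(g has_derivative (\<lambda>h. grad g y \<bullet> h)) (at y)"
      using that by (intro has_derivative_grad) (auto simp: Ck_Suc)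
    then have "(f has_derivative (\<lambda>h. grad g y \<bullet> h)) (at y)"
      using that by (elim has_derivative_transform_within_open) auto
    then show ?thesis using grad_eqI differentiable_def by blast
  qed
  show ?case unfolding Ck_Suc
  proof (intro conjI allI)
    show "f differentiable (at x)" for x using eq Suc.prems by blast
    show "Ck k (\<lambda>x. grad f x $ i)" for i
    proof (rule Suc.IH)
      fix x
      obtain S g where S: "open S" "x \<in> S" "\<forall>y\<in>S. f y = g y" "Ck (Suc k) g" using Suc.prems by blast
      then show "\<exists>S g. open S \<and> x \<in> S \<and> (\<forall>y\<in>S. grad f y $ i = g y) \<and> Ck k g"
        using eq[OF S(1,3,4)] by (intro exI[of _ S] exI[of _ "\<lambda>x. grad g x $ i"]) (auto simp: Ck_Suc)
    qed
  qed
qed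

lemma grad_affine:
  fixes L :: "real^'n \<Rightarrow> real^'n"
  assumes L: "bounded_linear L" and f: "f differentiable (at (L x + c))"
  shows "grad (\<lambda>x. f (L x + c)) x $ i = grad f (L x + c) \<bullet> L (axis i 1)"
    and "(\<lambda>x. f (L x + c)) differentiable (at x)"
proof -
  have "((\<lambda>x. L x + c) has_derivative L) (at x)"
    using bounded_linear_imp_has_derivative[OF L] by (auto intro!: derivative_eq_intros)
  from has_derivative_compose[OF this has_derivative_grad[OF f]]
  have d: "((\<lambda>x. f (L x + c)) has_derivative (\<lambda>h. grad f (L x + c) \<bullet> L h)) (at x)" .
  then show "grad (\<lambda>x. f (L x + c)) x $ i = grad f (L x + c) \<bullet> L (axis i 1)"
    by (rule grad_has_derivative_eq)
  from d show "(\<lambda>x. f (L x + c)) differentiable (at x)" unfolding differentiable_def by blast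
qed

lemma Ck_affine:
  fixes L :: "real^'n \<Rightarrow> real^'n"
  assumes L: "bounded_linear L"
  shows "Ck k f \<Longrightarrow> Ck k (\<lambda>x. f (L x + c))"
proof (induction k arbitrary: f)
  case 0
  then show ?case
    unfolding Ck.simps
    by (rule continuous_on_compose2) (intro continuous_on_add continuous_on_const linear_continuous_on L subset_UNIV)+
next
  case (Suc k)
  have "Ck k (\<lambda>x. grad (\<lambda>x. f (L x + c)) x $ i)" for i
  proof -
    have "(\<lambda>x. grad (\<lambda>x. f (L x + c)) x $ i) = (\<lambda>x. \<Sum>j\<in>UNIV. grad f (L x + c) $ j * L (axis i 1) $ j)"
      using Suc.prems grad_affine[OF L] by (simp add: Ck_Suc inner_vec_def)
    then show ?thesis using Suc by (auto simp: Ck_Suc intro!: Ck_sum Ck_mult)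
  qed
  then show ?case using Suc.prems grad_affine[OF L] by (auto simp: Ck_Suc)
qed

lemma smooth_Ck: "smooth f \<Longrightarrow> Ck k f" by (simp add: smooth_def)

lemma smooth_differentiable: "smooth f \<Longrightarrow> f differentiable (at x)"
  using smooth_Ck[of f "Suc 0"] by (simp add: Ck_Suc)

lemma smooth_grad: "smooth f \<Longrightarrow> smooth (\<lambda>x. grad f x $ i)"
  using smooth_Ck Ck_Suc unfolding smooth_def by blast

lemma smooth_continuous: "smooth f \<Longrightarrow> continuous_on S f"
  using smooth_Ck[of f 0] continuous_on_subset by auto

lemma smooth_grad_continuous: "smooth f \<Longrightarrow> continuous_on S (grad f)"
  by (subst continuous_on_componentwise)
    (auto simp: Basis_vec_def inner_axis intro!: smooth_continuous smooth_grad)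

lemma smooth_const [simp]: "smooth (\<lambda>_. c)" by (simp add: smooth_def)

lemma smooth_add: "smooth f \<Longrightarrow> smooth g \<Longrightarrow> smooth (\<lambda>x. f x + g x)"
  by (simp add: smooth_def Ck_add)

lemma smooth_mult: "smooth f \<Longrightarrow> smooth g \<Longrightarrow> smooth (\<lambda>x. f x * g x)"
  by (simp add: smooth_def Ck_mult)

lemma smooth_sum: "(\<And>a. a \<in> A \<Longrightarrow> smooth (f a)) \<Longrightarrow> smooth (\<lambda>x. \<Sum>a\<in>A. f a x)"
  by (simp add: smooth_def Ck_sum)

lemma smooth_grad_inner: "smooth f \<Longrightarrow> smooth (\<lambda>x. grad f x \<bullet> e)"
  unfolding inner_vec_def inner_real_def by (intro smooth_sum smooth_mult smooth_const smooth_grad)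

lemma smooth_prod: "(\<And>a. a \<in> A \<Longrightarrow> smooth (f a)) \<Longrightarrow> smooth (\<lambda>x. \<Prod>a\<in>A. f a x)"
  by (induction A rule: infinite_finite_induct) (auto intro: smooth_mult)

lemma smooth_diff: "smooth f \<Longrightarrow> smooth g \<Longrightarrow> smooth (\<lambda>x. f x - g x)"
  using smooth_add[of f "\<lambda>x. - 1 * g x"] smooth_mult[of "\<lambda>_. - 1" g] by simp

lemma smooth_affine:
  fixes L :: "real^'n \<Rightarrow> real^'n"
  shows "smooth f \<Longrightarrow> bounded_linear L \<Longrightarrow> smooth (\<lambda>x. f (L x + c))"
  unfolding smooth_def by (simp add: Ck_affine)

lemma smooth_shift: "smooth f \<Longrightarrow> smooth (\<lambda>x. f (x + c))"
  using smooth_affine[of f "\<lambda>x. x"] by simp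

lemma smooth_scale: "smooth f \<Longrightarrow> smooth (\<lambda>x. f (a *\<^sub>R x))"
  using smooth_affine[of f "\<lambda>x. a *\<^sub>R x" 0] by (simp add: bounded_linear_scaleR_right)

lemma grad_shift:
  assumes "smooth f" shows "grad (\<lambda>x. f (x + c)) x = grad f (x + c)"
  using grad_affine(1)[of "\<lambda>x. x" f x c] assms
  by (simp add: vec_eq_iff smooth_differentiable inner_axis)

lemma grad_scale:
  assumes "smooth f" shows "grad (\<lambda>x. f (a *\<^sub>R x)) x = a *\<^sub>R grad f (a *\<^sub>R x)"
  using grad_affine(1)[of "\<lambda>x. a *\<^sub>R x" f x 0] assms
  by (simp add: vec_eq_iff smooth_differentiable inner_axis bounded_linear_scaleR_right)

lemma grad_sum:
  "(\<And>a. a \<in> A \<Longrightarrow> smooth (f a)) \<Longrightarrow> grad (\<lambda>x. \<Sum>a\<in>A. f a x) x = (\<Sum>a\<in>A. grad (f a) x)"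
  by (induction A rule: infinite_finite_induct)
    (simp_all add: grad_add smooth_sum smooth_differentiable)

lemma smooth_inner: "smooth (\<lambda>x. x \<bullet> e)" and grad_inner: "grad (\<lambda>x. x \<bullet> e) x = e"
proof -
  have g: "((\<lambda>x. x \<bullet> e) has_derivative (\<lambda>h. e \<bullet> h)) (at x)" for x
    by (auto intro!: derivative_eq_intros simp: inner_commute)
  then show "grad (\<lambda>x. x \<bullet> e) x = e" for x by (rule grad_eqI)
  then have "Ck k (\<lambda>x. x \<bullet> e)" for k
    by (cases k) (use g differentiable_def in \<open>auto simp: Ck_Suc intro!: continuous_intros\<close>)
  then show "smooth (\<lambda>x. x \<bullet> e)" by (simp add: smooth_def)
qed

lemma smooth_component: "smooth (\<lambda>x. x $ i)"
  using smooth_inner[of "axis i 1"] by (simp add: inner_axis)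

lemma smooth_compose:
  assumes F: "\<And>h. h \<in> F \<Longrightarrow> \<exists>h'\<in>F. \<forall>t. (h has_real_derivative h' t) (at t)"
    and h: "h \<in> F" and p: "smooth p"
  shows "smooth (\<lambda>x. h (p x))"
proof -
  have "Ck k (\<lambda>x. h (p x))" for k
    using h
  proof (induction k arbitrary: h)
    case 0
    obtain h' where "\<And>t. (h has_real_derivative h' t) (at t)" using F[OF 0] by blast
    then have "continuous_on UNIV h" by (auto intro: DERIV_continuous_on has_field_derivative_at_within)
    then show ?case using smooth_continuous[OF p] by (auto intro: continuous_on_compose2)
  next
    case (Suc k)
    obtain h' where h': "h' \<in> F" "\<And>t. (h has_real_derivative h' t) (at t)" using F[OF Suc.prems] by blast
    have "Ck k (\<lambda>x. h' (p x) * grad p x $ i)" for i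
      by (intro Ck_mult Suc.IH h' smooth_Ck smooth_grad p)
    then show ?case
      using grad_compose[OF smooth_differentiable[OF p] h'(2)] by (simp add: Ck_Suc)
  qed
  then show ?thesis by (simp add: smooth_def)
qed

lemma smooth_exp: "smooth p \<Longrightarrow> smooth (\<lambda>x. exp (p x))"
  by (rule smooth_compose[of "{exp}"]) (auto intro: DERIV_exp)

lemma smooth_sin_shift: "smooth p \<Longrightarrow> smooth (\<lambda>x. sin (p x + c))"
proof (rule smooth_compose[of "range (\<lambda>c t. sin (t + c))" "\<lambda>t. sin (t + c)"])
  fix h :: "real \<Rightarrow> real" assume "h \<in> range (\<lambda>c t. sin (t + c))"
  then obtain c where h: "h = (\<lambda>t. sin (t + c))" by blast
  have "(h has_real_derivative sin (t + (c + pi / 2))) (at t)" for t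
    unfolding h by (auto intro!: derivative_eq_intros simp: sin_add[of _ "pi / 2"] add.assoc[symmetric])
  then show "\<exists>h'\<in>range (\<lambda>c t. sin (t + c)). \<forall>t. (h has_real_derivative h' t) (at t)"
    by (intro bexI[of _ "\<lambda>t. sin (t + (c + pi / 2))"]) auto
qed auto

definition flat :: "nat \<Rightarrow> real \<Rightarrow> real" where
  "flat k t = (if t > 0 then exp (- (1 / t)) / t ^ k else 0)"

lemma flat_limit: "(flat k \<longlongrightarrow> 0) (at_right 0)"
proof -
  have "((\<lambda>s::real. s ^ k / exp s) \<longlongrightarrow> 0) at_top" by (rule tendsto_power_div_exp_0)
  then have "((\<lambda>t::real. (inverse t) ^ k / exp (inverse t)) \<longlongrightarrow> 0) (at_right 0)"
    by (rule filterlim_compose) (rule filterlim_inverse_at_top_right)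
  moreover have "eventually (\<lambda>t. (inverse t) ^ k / exp (inverse t) = flat k t) (at_right 0)"
    by (auto simp: eventually_at_filter flat_def exp_minus field_simps)
  ultimately show ?thesis by (rule Lim_transform_eventually)
qed

lemma flat_deriv: "(flat k has_real_derivative (flat (k + 2) t - real k * flat (k + 1) t)) (at t)"
proof -
  consider "t > 0" | "t < 0" | "t = 0" by linarith
  then show ?thesis
  proof cases
    case 1
    have "((\<lambda>t. exp (- (1 / t)) / t ^ k) has_real_derivative
      exp (- (1 / t)) / t ^ (k + 2) - real k * (exp (- (1 / t)) / t ^ (k + 1))) (at t)"
    proof -
      have "((\<lambda>t. t ^ k) has_real_derivative real k * t ^ k / t) (at t)"
        using DERIV_pow[of k t] 1 by (cases k) auto
      moreover have "((\<lambda>t. exp (- (1 / t))) has_real_derivative exp (- (1 / t)) / t\<^sup>2) (at t)"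
        using 1 by (auto intro!: derivative_eq_intros simp: power2_eq_square)
      ultimately have "((\<lambda>t. exp (- (1 / t)) / t ^ k) has_real_derivative
          (exp (- (1 / t)) / t\<^sup>2 * t ^ k - exp (- (1 / t)) * (real k * t ^ k / t)) / (t ^ k * t ^ k)) (at t)"
        using 1 by (intro DERIV_divide) auto
      moreover have "(exp (- (1 / t)) / t\<^sup>2 * t ^ k - exp (- (1 / t)) * (real k * t ^ k / t)) / (t ^ k * t ^ k)
          = exp (- (1 / t)) / t ^ (k + 2) - real k * (exp (- (1 / t)) / t ^ (k + 1))"
        using 1 by (simp add: diff_divide_distrib power_add power2_eq_square)
      ultimately show ?thesis by simp
    qed
    then have "(flat k has_real_derivative
      exp (- (1 / t)) / t ^ (k + 2) - real k * (exp (- (1 / t)) / t ^ (k + 1))) (at t)"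
      by (rule has_field_derivative_transform_within_open[where S = "{0<..}"]) (use 1 in \<open>auto simp: flat_def\<close>)
    then show ?thesis using 1 by (simp add: flat_def)
  next
    case 2
    have "(flat k has_real_derivative 0) (at t)"
      by (rule has_field_derivative_transform_within_open[where S = "{..<0}" and f = "\<lambda>_. 0"])
        (use 2 in \<open>auto simp: flat_def\<close>)
    then show ?thesis using 2 by (simp add: flat_def)
  next
    case 3
    have "((\<lambda>h. flat k h / h) \<longlongrightarrow> 0) (at_right 0)"
      by (rule Lim_transform_eventually[OF flat_limit[of "Suc k"]])
        (auto simp: eventually_at_filter flat_def)
    moreover have "((\<lambda>h. flat k h / h) \<longlongrightarrow> 0) (at_left 0)"
      by (rule Lim_transform_eventually[OF tendsto_const])
        (auto simp: eventually_at_filter flat_def)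
    ultimately have "((\<lambda>h. flat k h / h) \<longlongrightarrow> 0) (at 0)"
      using filterlim_split_at by blast
    then have "(flat k has_real_derivative 0) (at 0)"
      by (simp add: has_field_derivative_iff flat_def)
    then show ?thesis using 3 by (simp add: flat_def)
  qed
qed

lemma smooth_flat:
  assumes p: "smooth p" shows "smooth (\<lambda>x. flat k (p x))"
proof -
  have "Ck n (\<lambda>x. flat k (p x))" for n
  proof (induction n arbitrary: k)
    case 0
    have "continuous_on UNIV (flat k)"
      by (rule DERIV_continuous_on) (blast intro: has_field_derivative_at_within flat_deriv)
    then show ?case using smooth_continuous[OF p] by (auto intro: continuous_on_compose2)
  next
    case (Suc n)
    have "Ck n (\<lambda>x. (flat (k + 2) (p x) + (- real k) * flat (k + 1) (p x)) * grad p x $ i)" for i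
      by (intro Ck_mult Ck_add Suc.IH Ck_const smooth_Ck smooth_grad p)
    then show ?case
      using grad_compose[OF smooth_differentiable[OF p] flat_deriv] by (simp add: Ck_Suc)
  qed
  then show ?thesis by (simp add: smooth_def)
qed

definition box_bump :: "real^'n \<Rightarrow> real^'n \<Rightarrow> real^'n \<Rightarrow> real" where
  "box_bump a b x = (\<Prod>i\<in>UNIV. flat 0 (x $ i - a $ i) * flat 0 (b $ i - x $ i))"

lemma smooth_box_bump: "smooth (box_bump a b)"
  unfolding box_bump_def[abs_def]
  by (intro smooth_prod smooth_mult smooth_flat smooth_diff smooth_const smooth_component)

lemma flat_nonneg: "flat k t \<ge> 0"
  by (simp add: flat_def)

lemma box_bump_pos: "box_bump a b x > 0 \<longleftrightarrow> x \<in> box a b"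
  and box_bump_nonneg: "box_bump a b x \<ge> 0"
proof -
  have nn: "flat 0 (x $ i - a $ i) * flat 0 (b $ i - x $ i) \<ge> 0" for i
    by (simp add: flat_nonneg)
  then show n: "box_bump a b x \<ge> 0" unfolding box_bump_def by (intro prod_nonneg) auto
  have "box_bump a b x > 0 \<longleftrightarrow> box_bump a b x \<noteq> 0" using n by auto
  also have "\<dots> \<longleftrightarrow> (\<forall>i. flat 0 (x $ i - a $ i) * flat 0 (b $ i - x $ i) \<noteq> 0)"
    by (auto simp: box_bump_def)
  also have "\<dots> \<longleftrightarrow> x \<in> box a b"
    by (auto simp: mem_box_cart flat_def)
  finally show "box_bump a b x > 0 \<longleftrightarrow> x \<in> box a b" .
qed

lemma test_functions_iff:
  "\<phi> \<in> test_functions D \<longleftrightarrow> smooth \<phi> \<and> (\<exists>K. compact K \<and> K \<subseteq> D \<and> (\<forall>x. x \<notin> K \<longrightarrow> \<phi> x = 0))"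
proof -
  have "{x. \<phi> x \<noteq> 0} \<Subset> D" if K: "compact K" "K \<subseteq> D" "\<forall>x. x \<notin> K \<longrightarrow> \<phi> x = 0" for K
  proof -
    have "closure {x. \<phi> x \<noteq> 0} \<subseteq> K" using K by (intro closure_minimal) (auto simp: compact_imp_closed)
    moreover have "bounded {x. \<phi> x \<noteq> 0}"
      using K by (intro bounded_subset[OF compact_imp_bounded[OF K(1)]]) auto
    ultimately show ?thesis using K unfolding compactly_contained_def compact_closure by blast
  qed
  moreover have "\<exists>K. compact K \<and> K \<subseteq> D \<and> (\<forall>x. x \<notin> K \<longrightarrow> \<phi> x = 0)" if "{x. \<phi> x \<noteq> 0} \<Subset> D"
    using that closure_subset[of "{x. \<phi> x \<noteq> 0}"] unfolding compactly_contained_def by blast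
  ultimately show ?thesis unfolding test_functions_def by blast
qed

lemma test_functionsE:
  assumes "\<phi> \<in> test_functions D"
  obtains K where "smooth \<phi>" "compact K" "K \<subseteq> D" "\<And>x. x \<notin> K \<Longrightarrow> \<phi> x = 0"
    "\<And>x. x \<notin> K \<Longrightarrow> grad \<phi> x = 0"
proof -
  obtain K where K: "smooth \<phi>" "compact K" "K \<subseteq> D" "\<forall>x. x \<notin> K \<longrightarrow> \<phi> x = 0"
    using assms test_functions_iff by blast
  have "grad \<phi> x = 0" if "x \<notin> K" for x
  proof (rule grad_eqI)
    have "((\<lambda>_. 0) has_derivative (\<lambda>h. 0 \<bullet> h)) (at x)" by simp
    then show "(\<phi> has_derivative (\<lambda>h. 0 \<bullet> h)) (at x)"
      by (rule has_derivative_transform_within_open[where s = "- K"])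
        (use K that in \<open>auto simp: compact_imp_closed open_Compl\<close>)
  qed
  then show ?thesis using K that by blast
qed

lemma test_functions_smooth: "\<phi> \<in> test_functions D \<Longrightarrow> smooth \<phi>"
  by (simp add: test_functions_def)

lemma test_functions_mono: "D \<subseteq> E \<Longrightarrow> \<phi> \<in> test_functions D \<Longrightarrow> \<phi> \<in> test_functions E"
  by (meson test_functions_iff order_trans)

lemma test_functions_mult:
  assumes "smooth \<psi>" "\<phi> \<in> test_functions D" shows "(\<lambda>x. \<psi> x * \<phi> x) \<in> test_functions D"
proof -
  obtain K where "compact K" "K \<subseteq> D" "\<And>x. x \<notin> K \<Longrightarrow> \<phi> x = 0" "smooth \<phi>"
    using assms(2) by (elim test_functionsE) blast
  then show ?thesis using assms(1) unfolding test_functions_iff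
    by (intro conjI exI[of _ K]) (auto intro: smooth_mult)
qed

lemma test_functions_lin:
  assumes "\<psi> \<in> test_functions D" "\<phi> \<in> test_functions D"
  shows "(\<lambda>x. a * \<psi> x + b * \<phi> x) \<in> test_functions D"
proof -
  obtain K where K: "compact K" "K \<subseteq> D" "\<And>x. x \<notin> K \<Longrightarrow> \<phi> x = 0" "smooth \<phi>"
    using assms(2) by (elim test_functionsE) blast
  obtain L where L: "compact L" "L \<subseteq> D" "\<And>x. x \<notin> L \<Longrightarrow> \<psi> x = 0" "smooth \<psi>"
    using assms(1) by (elim test_functionsE) blast
  show ?thesis using K L unfolding test_functions_iff
    by (intro conjI exI[of _ "K \<union> L"] smooth_add smooth_mult smooth_const) auto
qed

lemma test_functions_grad:
  assumes "\<phi> \<in> test_functions D" shows "(\<lambda>x. grad \<phi> x \<bullet> e) \<in> test_functions D"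
proof -
  obtain K where K: "compact K" "K \<subseteq> D" "\<And>x. x \<notin> K \<Longrightarrow> grad \<phi> x = 0" "smooth \<phi>"
    using assms(1) by (elim test_functionsE) blast
  have "\<forall>x. x \<notin> K \<longrightarrow> grad \<phi> x \<bullet> e = 0" using K(3) by (metis inner_zero_left)
  then show ?thesis unfolding test_functions_iff
    using K(1,2) smooth_grad_inner[OF K(4)] by blast
qed

lemma box_bump_test:
  assumes "cbox a b \<subseteq> D" shows "box_bump a b \<in> test_functions D"
  unfolding test_functions_iff
proof (intro conjI exI[of _ "cbox a b"] allI impI)
  fix x assume "x \<notin> cbox a b"
  then have "x \<notin> box a b" using box_subset_cbox by blast
  then show "box_bump a b x = 0" using box_bump_pos[of a b x] box_bump_nonneg[of a b x] by linarith
qed (use assms smooth_box_bump in auto)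

text \<open>The smooth functions \<open>1 - exp (- k b)\<close>, for a bump function \<open>b\<close>, increase to the indicator
  of a box.\<close>

lemma box_approx_test:
  assumes "cbox a b \<subseteq> D" shows "(\<lambda>x. 1 - exp (- (k * box_bump a b x))) \<in> test_functions D"
proof -
  obtain K where K: "smooth (box_bump a b)" "compact K" "K \<subseteq> D" "\<And>x. x \<notin> K \<Longrightarrow> box_bump a b x = 0"
    using box_bump_test[OF assms] by (elim test_functionsE) blast
  have "smooth (\<lambda>x. - k * box_bump a b x)" by (intro smooth_mult smooth_const smooth_box_bump)
  then show ?thesis unfolding test_functions_iff
    by (intro conjI exI[of _ K] smooth_diff smooth_const smooth_exp) (use K in auto)
qed

lemma box_approx_limit:
  "(\<lambda>k. 1 - exp (- (real k * box_bump a b x))) \<longlonglongrightarrow> indicator (box a b) x"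
proof (cases "x \<in> box a b")
  case True
  then have "box_bump a b x > 0" by (simp add: box_bump_pos)
  then have "filterlim (\<lambda>k. box_bump a b x * real k) at_top sequentially"
    by (intro filterlim_tendsto_pos_mult_at_top[OF tendsto_const]) (auto simp: filterlim_real_sequentially)
  then have "(\<lambda>k. exp (- (box_bump a b x * real k))) \<longlonglongrightarrow> 0"
    by (intro filterlim_compose[OF exp_at_bot]) (simp add: filterlim_uminus_at_top[symmetric])
  then have "(\<lambda>k. 1 - exp (- (real k * box_bump a b x))) \<longlonglongrightarrow> 1 - 0"
    by (intro tendsto_diff tendsto_const) (simp add: mult.commute)
  then show ?thesis using True by simp
next
  case False
  then have "box_bump a b x = 0" using box_bump_pos[of a b x] box_bump_nonneg[of a b x] by linarith
  then show ?thesis using False by simp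
qed

section \<open>Square-integrable functions\<close>

definition sq_integrable :: "'a measure \<Rightarrow> ('a \<Rightarrow> 'b::euclidean_space) \<Rightarrow> bool" where
  "sq_integrable M f \<longleftrightarrow> f \<in> borel_measurable M \<and> integrable M (\<lambda>x. (norm (f x))\<^sup>2)"

definition l2norm :: "'a measure \<Rightarrow> ('a \<Rightarrow> 'b::euclidean_space) \<Rightarrow> real" where
  "l2norm M f = sqrt (LINT x|M. (norm (f x))\<^sup>2)"

lemma L2_iff: "u \<in> L2 D \<longleftrightarrow> sq_integrable (lebesgue_on D) u"
  by (simp add: L2_def sq_integrable_def)

lemma sq_integrable_measurable [measurable_dest]: "sq_integrable M f \<Longrightarrow> f \<in> borel_measurable M"
  by (simp add: sq_integrable_def)

lemma norm_mult_le_squares: "norm a * norm b \<le> (norm a)\<^sup>2 + (norm b)\<^sup>2"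
proof -
  have "0 \<le> (norm a - norm b)\<^sup>2" by simp
  then have "2 * (norm a * norm b) \<le> (norm a)\<^sup>2 + (norm b)\<^sup>2" by (simp add: power2_diff)
  moreover have "0 \<le> norm a * norm b" by simp
  ultimately show ?thesis by linarith
qed

lemma sq_integrable_norm_mult:
  assumes [measurable]: "sq_integrable M f" "sq_integrable M g"
  shows "integrable M (\<lambda>x. norm (f x) * norm (g x))"
proof (rule Bochner_Integration.integrable_bound)
  show "integrable M (\<lambda>x. (norm (f x))\<^sup>2 + (norm (g x))\<^sup>2)"
    using assms by (simp add: sq_integrable_def)
  show "AE x in M. norm (norm (f x) * norm (g x)) \<le> norm ((norm (f x))\<^sup>2 + (norm (g x))\<^sup>2)"
    using norm_mult_le_squares by (auto simp: abs_mult)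
qed simp

lemma sq_integrable_inner:
  assumes [measurable]: "sq_integrable M f" "sq_integrable M g"
  shows "integrable M (\<lambda>x. f x \<bullet> g x)"
  by (rule Bochner_Integration.integrable_bound[OF sq_integrable_norm_mult[OF assms]])
    (auto simp: abs_mult Cauchy_Schwarz_ineq2)

lemma sq_integrable_mult:
  fixes f g :: "'a \<Rightarrow> real"
  assumes "sq_integrable M f" "sq_integrable M g"
  shows "integrable M (\<lambda>x. f x * g x)"
  using sq_integrable_inner[OF assms] by simp

lemma sq_integrable_bound:
  assumes "sq_integrable M f" and [measurable]: "g \<in> borel_measurable M"
    and "AE x in M. norm (g x) \<le> c * norm (f x)"
  shows "sq_integrable M g"
  unfolding sq_integrable_def
proof
  show "integrable M (\<lambda>x. (norm (g x))\<^sup>2)"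
  proof (rule Bochner_Integration.integrable_bound)
    show "integrable M (\<lambda>x. c\<^sup>2 * (norm (f x))\<^sup>2)" using assms(1) by (simp add: sq_integrable_def)
    show "AE x in M. norm ((norm (g x))\<^sup>2) \<le> norm (c\<^sup>2 * (norm (f x))\<^sup>2)"
      using assms(3)
    proof eventually_elim
      case (elim x)
      then have "(norm (g x))\<^sup>2 \<le> (c * norm (f x))\<^sup>2" by (intro power_mono) auto
      then show ?case by (simp add: power_mult_distrib)
    qed
  qed simp
qed simp

lemma sq_integrable_lin:
  assumes [measurable]: "sq_integrable M f" "sq_integrable M g"
  shows "sq_integrable M (\<lambda>x. a *\<^sub>R f x + b *\<^sub>R g x)"
  unfolding sq_integrable_def
proof
  show "integrable M (\<lambda>x. (norm (a *\<^sub>R f x + b *\<^sub>R g x))\<^sup>2)"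
  proof (rule Bochner_Integration.integrable_bound)
    show "integrable M (\<lambda>x. a\<^sup>2 * (norm (f x))\<^sup>2 + 2 * \<bar>a\<bar> * \<bar>b\<bar> * (norm (f x) * norm (g x)) + b\<^sup>2 * (norm (g x))\<^sup>2)"
      using assms sq_integrable_norm_mult[OF assms] by (simp add: sq_integrable_def)
    show "AE x in M. norm ((norm (a *\<^sub>R f x + b *\<^sub>R g x))\<^sup>2) \<le>
      norm (a\<^sup>2 * (norm (f x))\<^sup>2 + 2 * \<bar>a\<bar> * \<bar>b\<bar> * (norm (f x) * norm (g x)) + b\<^sup>2 * (norm (g x))\<^sup>2)"
    proof (intro AE_I2)
      fix x
      have "(norm (a *\<^sub>R f x + b *\<^sub>R g x))\<^sup>2 \<le> (\<bar>a\<bar> * norm (f x) + \<bar>b\<bar> * norm (g x))\<^sup>2"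
        by (intro power_mono norm_triangle_le) auto
      then show "norm ((norm (a *\<^sub>R f x + b *\<^sub>R g x))\<^sup>2) \<le>
        norm (a\<^sup>2 * (norm (f x))\<^sup>2 + 2 * \<bar>a\<bar> * \<bar>b\<bar> * (norm (f x) * norm (g x)) + b\<^sup>2 * (norm (g x))\<^sup>2)"
        by (simp add: power2_sum power_mult_distrib algebra_simps)
    qed
  qed simp
qed simp

lemma sq_integrable_diff: "sq_integrable M f \<Longrightarrow> sq_integrable M g \<Longrightarrow> sq_integrable M (\<lambda>x. f x - g x)"
  using sq_integrable_lin[of M f g 1 "- 1"] by simp

lemma sq_integrable_add: "sq_integrable M f \<Longrightarrow> sq_integrable M g \<Longrightarrow> sq_integrable M (\<lambda>x. f x + g x)"
  using sq_integrable_lin[of M f g 1 1] by simp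

lemma sq_integrable_scale: "sq_integrable M f \<Longrightarrow> sq_integrable M (\<lambda>x. c *\<^sub>R f x)"
  using sq_integrable_lin[of M f f c 0] by simp

lemma sq_integrable_component:
  fixes f :: "'a \<Rightarrow> real^'n"
  assumes f: "sq_integrable M f" shows "sq_integrable M (\<lambda>x. f x $ i)"
proof (rule sq_integrable_bound[OF f, of _ 1])
  have "(\<lambda>x. f x \<bullet> axis i 1) \<in> borel_measurable M" using f by measurable
  then show "(\<lambda>x. f x $ i) \<in> borel_measurable M" by (simp add: inner_axis)
qed (auto simp: component_le_norm_cart)

lemma l2norm_nonneg [simp]: "l2norm M f \<ge> 0"
  by (simp add: l2norm_def)

lemma l2norm_sq: "(l2norm M f)\<^sup>2 = (LINT x|M. (norm (f x))\<^sup>2)"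
  by (simp add: l2norm_def)

lemma l2norm_cong_AE:
  "f \<in> borel_measurable M \<Longrightarrow> g \<in> borel_measurable M \<Longrightarrow> AE x in M. f x = g x \<Longrightarrow> l2norm M f = l2norm M g"
  unfolding l2norm_def by (intro arg_cong[of _ _ sqrt] integral_cong_AE) auto

lemma l2norm_mono:
  assumes "sq_integrable M f" "g \<in> borel_measurable M" "AE x in M. norm (g x) \<le> norm (f x)"
  shows "l2norm M g \<le> l2norm M f"
proof -
  have "sq_integrable M g" by (rule sq_integrable_bound[of M f g 1]) (use assms in auto)
  then have "(LINT x|M. (norm (g x))\<^sup>2) \<le> (LINT x|M. (norm (f x))\<^sup>2)"
    using assms by (intro integral_mono_AE) (auto simp: sq_integrable_def elim!: eventually_mono intro: power_mono)
  then show ?thesis by (simp add: l2norm_def)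
qed

lemma l2norm_scale: "l2norm M (\<lambda>x. c *\<^sub>R f x) = \<bar>c\<bar> * l2norm M f"
  by (simp add: l2norm_def power_mult_distrib real_sqrt_mult)

lemma norm_product_integral_le:
  assumes "sq_integrable M f" "sq_integrable M g"
  shows "(LINT x|M. norm (f x) * norm (g x)) \<le> l2norm M f * l2norm M g"
proof (rule power2_le_imp_le)
  define a where "a = (LINT x|M. norm (f x) * norm (g x))"
  have "a\<^sup>2 \<le> (LINT x|M. (norm (f x))\<^sup>2) * (LINT x|M. (norm (g x))\<^sup>2)"
  proof (rule quadratic_nonneg_discriminant)
    fix t
    have "0 \<le> (LINT x|M. (norm (f x) + t * norm (g x))\<^sup>2)" by simp
    also have "\<dots> = (LINT x|M. (norm (f x))\<^sup>2 + 2 * t * (norm (f x) * norm (g x)) + t\<^sup>2 * (norm (g x))\<^sup>2)"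
      by (simp add: power2_sum power_mult_distrib algebra_simps)
    also have "\<dots> = (LINT x|M. (norm (f x))\<^sup>2) + 2 * t * a + t\<^sup>2 * (LINT x|M. (norm (g x))\<^sup>2)"
      using assms sq_integrable_norm_mult[OF assms] by (simp add: sq_integrable_def a_def)
    finally show "0 \<le> (LINT x|M. (norm (f x))\<^sup>2) + 2 * t * a + t\<^sup>2 * (LINT x|M. (norm (g x))\<^sup>2)" .
  qed
  then show "(LINT x|M. norm (f x) * norm (g x))\<^sup>2 \<le> (l2norm M f * l2norm M g)\<^sup>2"
    by (simp add: power_mult_distrib l2norm_sq a_def)
qed simp

lemma inner_integral_le:
  assumes "sq_integrable M f" "sq_integrable M g"
  shows "\<bar>LINT x|M. f x \<bullet> g x\<bar> \<le> l2norm M f * l2norm M g"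
proof -
  have "\<bar>LINT x|M. f x \<bullet> g x\<bar> \<le> (LINT x|M. \<bar>f x \<bullet> g x\<bar>)" by (rule integral_abs_bound)
  also have "\<dots> \<le> (LINT x|M. norm (f x) * norm (g x))"
    using sq_integrable_inner[OF assms] sq_integrable_norm_mult[OF assms]
    by (intro integral_mono) (auto simp: Cauchy_Schwarz_ineq2)
  finally have "\<bar>LINT x|M. f x \<bullet> g x\<bar> \<le> (LINT x|M. norm (f x) * norm (g x))" .
  then show ?thesis using norm_product_integral_le[OF assms] by linarith
qed

lemma mult_integral_le:
  fixes f g :: "'a \<Rightarrow> real"
  assumes "sq_integrable M f" "sq_integrable M g"
  shows "\<bar>LINT x|M. f x * g x\<bar> \<le> l2norm M f * l2norm M g"
  using inner_integral_le[OF assms] by simp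

lemma l2norm_triangle:
  assumes [measurable]: "sq_integrable M f" "sq_integrable M g"
  shows "l2norm M (\<lambda>x. f x + g x) \<le> l2norm M f + l2norm M g"
proof (rule power2_le_imp_le)
  have "(LINT x|M. (norm (f x + g x))\<^sup>2) \<le> (LINT x|M. (norm (f x))\<^sup>2 + 2 * (norm (f x) * norm (g x)) + (norm (g x))\<^sup>2)"
  proof (rule integral_mono)
    show "integrable M (\<lambda>x. (norm (f x + g x))\<^sup>2)"
      using sq_integrable_add[OF assms] by (simp add: sq_integrable_def)
    show "integrable M (\<lambda>x. (norm (f x))\<^sup>2 + 2 * (norm (f x) * norm (g x)) + (norm (g x))\<^sup>2)"
      using assms sq_integrable_norm_mult[OF assms] by (simp add: sq_integrable_def)
    show "(norm (f x + g x))\<^sup>2 \<le> (norm (f x))\<^sup>2 + 2 * (norm (f x) * norm (g x)) + (norm (g x))\<^sup>2" for x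
      using power_mono[OF norm_triangle_ineq[of "f x" "g x"], of 2] by (simp add: power2_sum algebra_simps)
  qed
  also have "\<dots> = (l2norm M f)\<^sup>2 + 2 * (LINT x|M. norm (f x) * norm (g x)) + (l2norm M g)\<^sup>2"
    using assms sq_integrable_norm_mult[OF assms] by (simp add: sq_integrable_def l2norm_sq)
  also have "\<dots> \<le> (l2norm M f + l2norm M g)\<^sup>2"
    using norm_product_integral_le[OF assms] by (simp add: power2_sum)
  finally show "(l2norm M (\<lambda>x. f x + g x))\<^sup>2 \<le> (l2norm M f + l2norm M g)\<^sup>2" by (simp add: l2norm_sq)
qed simp

lemma l2norm_triangle_diff:
  assumes "sq_integrable M f" "sq_integrable M g" "sq_integrable M h"
  shows "l2norm M (\<lambda>x. f x - h x) \<le> l2norm M (\<lambda>x. f x - g x) + l2norm M (\<lambda>x. g x - h x)"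
  using l2norm_triangle[OF sq_integrable_diff[OF assms(1,2)] sq_integrable_diff[OF assms(2,3)]] by simp

lemma l2norm_minus_commute: "l2norm M (\<lambda>x. f x - g x) = l2norm M (\<lambda>x. g x - f x)"
  by (simp add: l2norm_def norm_minus_commute)

lemma l2norm_eq_0_AE:
  assumes "sq_integrable M f" "l2norm M f = 0" shows "AE x in M. f x = 0"
proof -
  have "(LINT x|M. (norm (f x))\<^sup>2) = 0" using assms(2) by (simp add: l2norm_def)
  then have "AE x in M. (norm (f x))\<^sup>2 = 0"
    using assms(1) by (subst (asm) integral_nonneg_eq_0_iff_AE) (auto simp: sq_integrable_def)
  then show ?thesis by simp
qed

lemma nn_integral_sq: 
  assumes "sq_integrable M f"
  shows "(\<integral>\<^sup>+x. ennreal ((norm (f x))\<^sup>2) \<partial>M) = ennreal ((l2norm M f)\<^sup>2)"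
  using assms by (simp add: l2norm_sq sq_integrable_def nn_integral_eq_integral)

text \<open>Riesz--Fischer. Along a subsequence whose consecutive squared distances are below \<open>4 ^ - k\<close>,
  the integral of the sum of \<open>2 ^ k \<parallel>d\<^sub>k\<parallel>\<^sup>2\<close> is finite, and \<open>\<parallel>d\<^sub>k\<parallel> \<le> 2 ^ - k + 2 ^ k \<parallel>d\<^sub>k\<parallel>\<^sup>2\<close>.\<close>

lemma L2_complete:
  fixes F :: "nat \<Rightarrow> 'a \<Rightarrow> 'b::euclidean_space"
  assumes F: "\<And>k. sq_integrable M (F k)"
    and Cauchy: "\<And>e. e > 0 \<Longrightarrow> \<exists>N. \<forall>m\<ge>N. \<forall>n\<ge>N. l2norm M (\<lambda>x. F m x - F n x) < e"
  shows "\<exists>f. sq_integrable M f \<and> (\<lambda>k. l2norm M (\<lambda>x. F k x - f x)) \<longlonglongrightarrow> 0"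
proof -
  have [measurable]: "F k \<in> borel_measurable M" for k using F by measurable
  have "\<exists>N. \<forall>m\<ge>N. \<forall>n\<ge>N. l2norm M (\<lambda>x. F m x - F n x) < (1/2) ^ k" for k
    using Cauchy[of "(1/2) ^ k"] by simp
  then obtain N where N: "\<And>k m n. m \<ge> N k \<Longrightarrow> n \<ge> N k \<Longrightarrow> l2norm M (\<lambda>x. F m x - F n x) < (1/2) ^ k"
    by metis
  define r where "r k = (\<Sum>i\<le>k. N i) + k" for k
  have rN: "r k \<ge> N k" and rk: "r k \<ge> k" for k
    using member_le_sum[of k "{..k}" N] by (auto simp: r_def)
  have rmono: "r k \<le> r (Suc k)" for k by (simp add: r_def)
  define d where "d k x = F (r (Suc k)) x - F (r k) x" for k x
  have d2: "sq_integrable M (d k)" for k unfolding d_def using F by (intro sq_integrable_diff)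
  have dk: "l2norm M (d k) \<le> (1/2) ^ k" for k
    unfolding d_def using N[of k "r (Suc k)" "r k"] rN[of k] rmono[of k] by simp
  have [measurable]: "d k \<in> borel_measurable M" for k using d2 by measurable
  have "(\<integral>\<^sup>+x. (\<Sum>k. ennreal (2 ^ k * (norm (d k x))\<^sup>2)) \<partial>M) = (\<Sum>k. \<integral>\<^sup>+x. ennreal (2 ^ k * (norm (d k x))\<^sup>2) \<partial>M)"
    by (intro nn_integral_suminf) measurable
  also have "\<dots> \<le> (\<Sum>k. ennreal ((1/2) ^ k))"
  proof (intro suminf_le)
    fix k
    have "(\<integral>\<^sup>+x. ennreal (2 ^ k * (norm (d k x))\<^sup>2) \<partial>M) = ennreal (2 ^ k) * ennreal ((l2norm M (d k))\<^sup>2)"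
      by (simp add: ennreal_mult nn_integral_cmult nn_integral_sq[OF d2, symmetric])
    also have "\<dots> \<le> ennreal (2 ^ k) * ennreal (((1/2) ^ k)\<^sup>2)"
      using dk[of k] by (intro mult_left_mono ennreal_leI power_mono) auto
    also have "\<dots> = ennreal ((1/2) ^ k)"
      by (simp add: ennreal_mult[symmetric] power2_eq_square power_divide)
    finally show "(\<integral>\<^sup>+x. ennreal (2 ^ k * (norm (d k x))\<^sup>2) \<partial>M) \<le> ennreal ((1/2) ^ k)" .
  qed auto
  also have "\<dots> = ennreal (\<Sum>k. (1/2) ^ k)"
    by (intro suminf_ennreal2) (auto intro: summable_geometric)
  also have "\<dots> < \<infinity>" by simp
  finally have fin: "(\<integral>\<^sup>+x. (\<Sum>k. ennreal (2 ^ k * (norm (d k x))\<^sup>2)) \<partial>M) \<noteq> \<infinity>" by simp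
  have "AE x in M. (\<Sum>k. ennreal (2 ^ k * (norm (d k x))\<^sup>2)) \<noteq> \<infinity>"
    by (rule nn_integral_noteq_infinite[OF _ fin]) measurable
  then have conv: "AE x in M. convergent (\<lambda>k. F (r k) x)"
  proof eventually_elim
    case (elim x)
    then have "summable (\<lambda>k. 2 ^ k * (norm (d k x))\<^sup>2)"
      by (intro summable_suminf_not_top) auto
    then have "summable (\<lambda>k. (1/2) ^ k + 2 ^ k * (norm (d k x))\<^sup>2)"
      by (intro summable_add summable_geometric) auto
    then have "summable (\<lambda>k. norm (d k x))"
    proof (rule summable_comparison_test[rotated], intro exI allI impI)
      fix k :: nat
      define p where "p = (2::real) ^ k"
      have p: "p > 0" by (simp add: p_def)
      have "norm (d k x) \<le> 1 / p + p * (norm (d k x))\<^sup>2"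
      proof -
        have "0 \<le> (p * norm (d k x) - 1)\<^sup>2 + p * norm (d k x)" using p by simp
        then have "p * norm (d k x) \<le> 1 + p\<^sup>2 * (norm (d k x))\<^sup>2" by (simp add: power2_diff power_mult_distrib)
        then show ?thesis using p by (simp add: field_simps power2_eq_square)
      qed
      then show "norm (norm (d k x)) \<le> (1/2) ^ k + 2 ^ k * (norm (d k x))\<^sup>2"
        by (simp add: p_def power_divide)
    qed
    then have "summable (\<lambda>k. d k x)" by (rule summable_norm_cancel)
    then have "convergent (\<lambda>n. F (r 0) x + (\<Sum>k<n. d k x))"
      unfolding summable_iff_convergent by (intro convergent_add convergent_const)
    moreover have "F (r 0) x + (\<Sum>k<n. d k x) = F (r n) x" for n
      unfolding d_def by (subst sum_lessThan_telescope) simp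
    ultimately show ?case by simp
  qed
  define f where "f x = lim (\<lambda>k. F (r k) x)" for x
  have [measurable]: "f \<in> borel_measurable M"
    unfolding f_def by measurable
  have lim: "AE x in M. (\<lambda>k. F (r k) x) \<longlonglongrightarrow> f x"
    using conv by eventually_elim (simp add: f_def convergent_LIMSEQ_iff)
  have bound: "sq_integrable M (\<lambda>x. F m x - f x) \<and> l2norm M (\<lambda>x. F m x - f x) \<le> e"
    if m: "\<And>n. n \<ge> K \<Longrightarrow> l2norm M (\<lambda>x. F m x - F n x) \<le> e" and "e \<ge> 0" for m e K
  proof -
    have "(\<integral>\<^sup>+x. ennreal ((norm (F m x - f x))\<^sup>2) \<partial>M)
        = (\<integral>\<^sup>+x. liminf (\<lambda>k. ennreal ((norm (F m x - F (r k) x))\<^sup>2)) \<partial>M)"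
    proof (rule nn_integral_cong_AE)
      show "AE x in M. ennreal ((norm (F m x - f x))\<^sup>2) = liminf (\<lambda>k. ennreal ((norm (F m x - F (r k) x))\<^sup>2))"
        using lim
      proof eventually_elim
        case (elim x)
        then have "(\<lambda>k. ennreal ((norm (F m x - F (r k) x))\<^sup>2)) \<longlonglongrightarrow> ennreal ((norm (F m x - f x))\<^sup>2)"
          by (intro tendsto_ennrealI tendsto_power tendsto_norm tendsto_diff tendsto_const)
        then show ?case by (rule lim_imp_Liminf[symmetric, rotated]) simp
      qed
    qed
    also have "\<dots> \<le> liminf (\<lambda>k. \<integral>\<^sup>+x. ennreal ((norm (F m x - F (r k) x))\<^sup>2) \<partial>M)"
      by (rule nn_integral_liminf) measurable
    also have "\<dots> = liminf (\<lambda>k. ennreal ((l2norm M (\<lambda>x. F m x - F (r k) x))\<^sup>2))"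
      using nn_integral_sq[OF sq_integrable_diff[OF F F]] by simp
    also have "\<dots> \<le> liminf (\<lambda>k. ennreal (e\<^sup>2))"
    proof (rule Liminf_mono)
      show "\<forall>\<^sub>F k in sequentially. ennreal ((l2norm M (\<lambda>x. F m x - F (r k) x))\<^sup>2) \<le> ennreal (e\<^sup>2)"
        using eventually_ge_at_top[of K]
      proof eventually_elim
        case (elim k)
        then have "l2norm M (\<lambda>x. F m x - F (r k) x) \<le> e" using m[of "r k"] rk[of k] by simp
        then show ?case by (intro ennreal_leI power_mono) auto
      qed
    qed
    also have "\<dots> = ennreal (e\<^sup>2)" by (simp add: Liminf_const)
    finally have le: "(\<integral>\<^sup>+x. ennreal ((norm (F m x - f x))\<^sup>2) \<partial>M) \<le> ennreal (e\<^sup>2)" .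
    then have int: "integrable M (\<lambda>x. (norm (F m x - f x))\<^sup>2)"
      by (intro integrableI_bounded) (auto intro: le_less_trans)
    then have sq: "sq_integrable M (\<lambda>x. F m x - f x)" by (simp add: sq_integrable_def)
    then have "(l2norm M (\<lambda>x. F m x - f x))\<^sup>2 \<le> e\<^sup>2"
      using le by (simp add: nn_integral_sq)
    then show ?thesis using sq that(2) by (simp add: power2_le_iff_abs_le)
  qed
  have "sq_integrable M (\<lambda>x. F (N 0) x - f x)"
    using bound[of "N 0" "N 0" 1] N[of 0 "N 0"] by (force intro: less_imp_le)
  then have "sq_integrable M (\<lambda>x. F (N 0) x - (F (N 0) x - f x))"
    by (rule sq_integrable_diff[OF F])
  then have "sq_integrable M f" by simp
  moreover have "(\<lambda>k. l2norm M (\<lambda>x. F k x - f x)) \<longlonglongrightarrow> 0"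
  proof (rule LIMSEQ_I)
    fix e :: real assume e: "e > 0"
    then obtain K where K: "\<And>m n. m \<ge> K \<Longrightarrow> n \<ge> K \<Longrightarrow> l2norm M (\<lambda>x. F m x - F n x) < e / 2"
      using Cauchy[of "e / 2"] by auto
    show "\<exists>no. \<forall>n\<ge>no. norm (l2norm M (\<lambda>x. F n x - f x) - 0) < e"
    proof (intro exI allI impI)
      fix n assume "n \<ge> K"
      then have "l2norm M (\<lambda>x. F n x - f x) \<le> e / 2"
        using bound[of K n "e / 2"] K[of n] e by (force intro: less_imp_le)
      then show "norm (l2norm M (\<lambda>x. F n x - f x) - 0) < e" using e by simp
    qed
  qed
  ultimately show ?thesis by blast
qed

lemma lebesgue_on_integral_lborel:
  fixes f :: "'a::euclidean_space \<Rightarrow> 'b::euclidean_space"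
  assumes [measurable]: "D \<in> sets borel" "f \<in> borel_measurable borel"
  shows "(LINT x|lebesgue_on D. f x) = (LINT x|lborel. indicator D x *\<^sub>R f x)"
    and "integrable (lebesgue_on D) f \<longleftrightarrow> integrable lborel (\<lambda>x. indicator D x *\<^sub>R f x)"
proof -
  have D: "D \<inter> space lebesgue \<in> sets lebesgue" using assms by auto
  show "(LINT x|lebesgue_on D. f x) = (LINT x|lborel. indicator D x *\<^sub>R f x)"
    by (subst integral_restrict_space[OF D]) (simp add: integral_completion)
  show "integrable (lebesgue_on D) f \<longleftrightarrow> integrable lborel (\<lambda>x. indicator D x *\<^sub>R f x)"
    by (subst integrable_restrict_space[OF D]) (simp add: integrable_completion)
qed

lemma borel_measurable_lebesgue_on [simp]:
  "f \<in> borel_measurable borel \<Longrightarrow> f \<in> borel_measurable (lebesgue_on D)"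
  by (intro measurable_restrict_space1 measurable_completion) simp

lemma box_integrals_zero_imp_AE:
  fixes g :: "'a::euclidean_space \<Rightarrow> real"
  assumes g: "integrable lborel g"
    and box: "\<And>a b. (LINT x|lborel. indicator (box a b) x * g x) = 0" and UNIV: "(LINT x|lborel. g x) = 0"
  shows "AE x in lborel. g x = 0"
proof (rule density_unique_real[OF g])
  fix A :: "'a set" assume "A \<in> sets lborel"
  have int: "set_integrable lborel A g" if "A \<in> sets borel" for A
    unfolding set_integrable_def using g that by (intro integrable_mult_indicator) auto
  have "Int_stable (range (\<lambda>(a, b). box a b :: 'a set))"
    by (rule Int_stableI) (force simp: box_Int_box)
  moreover have "range (\<lambda>(a, b). box a b :: 'a set) \<subseteq> Pow UNIV" by simp
  moreover have "A \<in> sigma_sets UNIV (range (\<lambda>(a, b). box a b))"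
    using \<open>A \<in> sets lborel\<close> by (simp add: borel_eq_box)
  ultimately have "(LINT x:A|lborel. g x) = 0"
  proof (induction A rule: sigma_sets_induct_disjoint)
    case (basic A)
    then show ?case using box by (auto simp: set_lebesgue_integral_def)
  next
    case (compl A)
    then have [measurable]: "A \<in> sets borel" by (simp add: borel_eq_box)
    have "(LINT x:UNIV - A|lborel. g x) + (LINT x:A|lborel. g x) = (LINT x:(UNIV - A) \<union> A|lborel. g x)"
      by (rule set_integral_Un[symmetric]) (auto intro: int)
    also have "\<dots> = 0" using UNIV by (simp add: set_lebesgue_integral_def)
    finally show ?case using compl by simp
  next
    case (union A)
    then have "A i \<in> sets borel" for i by (simp add: borel_eq_box image_subset_iff)
    then have "(LINT x:(\<Union>i. A i)|lborel. g x) = (\<Sum>i. LINT x:(A i)|lborel. g x)"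
      using union(1) by (intro lebesgue_integral_countable_add int) (auto simp: disjoint_family_on_def)
    then show ?case using union by simp
  qed (auto simp: set_lebesgue_integral_def)
  then show "(LINT x:A|lborel. g x) = (LINT x:A|lborel. 0)" by (simp add: set_lebesgue_integral_def)
qed simp

lemma fundamental_lemma:
  fixes G :: "real^'n \<Rightarrow> real"
  assumes D: "open D" and G: "sq_integrable (lebesgue_on D) G"
    and zero: "\<And>\<phi>. \<phi> \<in> test_functions D \<Longrightarrow> (LINT x|lebesgue_on D. G x * \<phi> x) = 0"
  shows "AE x in lebesgue_on D. G x = 0"
proof -
  have Dm [measurable]: "D \<in> sets borel" using D by simp
  have "(\<lambda>x. indicator D x *\<^sub>R G x) \<in> borel_measurable lebesgue"
    using G D by (intro borel_measurable_restrict_space_iff[THEN iffD1]) (auto simp: sq_integrable_def)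
  then obtain g where g[measurable]: "g \<in> borel_measurable borel"
    and gG: "AE x in lborel. indicator D x *\<^sub>R G x = g x"
    using completion_ex_borel_measurable_real by fastforce
  have gG': "AE x in lebesgue_on D. G x = g x"
  proof -
    have "AE x in lborel. x \<in> D \<longrightarrow> G x = g x" using gG by eventually_elim auto
    then show ?thesis by (subst AE_restrict_space_iff) (auto simp: AE_completion)
  qed
  have [measurable]: "G \<in> borel_measurable (lebesgue_on D)" using G by measurable
  have g2: "sq_integrable (lebesgue_on D) g"
    by (rule sq_integrable_bound[OF G, of _ 1]) (use gG' in \<open>auto elim: eventually_mono\<close>)
  have zero': "(LINT x|lborel. indicator D x * (g x * \<phi> x)) = 0" if \<phi>: "\<phi> \<in> test_functions D" for \<phi>
  proof -
    have [measurable]: "\<phi> \<in> borel_measurable borel"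
      using \<phi> by (intro borel_measurable_continuous_onI smooth_continuous test_functions_smooth)
    have [measurable]: "\<phi> \<in> borel_measurable (lebesgue_on D)" by simp
    have "0 = (LINT x|lebesgue_on D. g x * \<phi> x)"
      unfolding zero[OF \<phi>, symmetric] using gG' by (intro integral_cong_AE) auto
    then show ?thesis by (simp add: lebesgue_on_integral_lborel)
  qed
  have boxzero: "(LINT x|lborel. indicator (box a b) x * g x) = 0"
    and boxint: "integrable lborel (\<lambda>x. indicator (box a b) x * g x)" if ab: "cbox a b \<subseteq> D" for a b
  proof -
    have one: "sq_integrable (lebesgue_on D) (indicator (box a b) :: _ \<Rightarrow> real)"
    proof -
      have "(\<lambda>x. indicat_real D x *\<^sub>R (norm (indicat_real (box a b) x))\<^sup>2) = indicator (box a b)"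
        using ab box_subset_cbox[of a b] by (auto simp: fun_eq_iff indicator_def)
      moreover have "integrable lborel (indicat_real (box a b))"
        by (intro integrable_real_indicator emeasure_lborel_box_finite) auto
      ultimately show ?thesis unfolding sq_integrable_def by (simp add: lebesgue_on_integral_lborel)
    qed
    have sub: "indicator D x * (g x * indicator (box a b) x) = indicator (box a b) x * g x" for x
      using ab box_subset_cbox[of a b] by (auto simp: indicator_def)
    have "integrable (lebesgue_on D) (\<lambda>x. g x * indicator (box a b) x)"
      by (rule sq_integrable_mult[OF g2 one])
    then show int: "integrable lborel (\<lambda>x. indicator (box a b) x * g x)"
      by (simp add: lebesgue_on_integral_lborel sub)
    let ?\<phi> = "\<lambda>k x. 1 - exp (- (real k * box_bump a b x))"
    have [measurable]: "box_bump a b \<in> borel_measurable borel"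
      by (intro borel_measurable_continuous_onI smooth_continuous smooth_box_bump)
    have "(\<lambda>k. LINT x|lborel. indicator D x * (g x * ?\<phi> k x)) \<longlonglongrightarrow> (LINT x|lborel. indicator (box a b) x * g x)"
    proof (rule integral_dominated_convergence[where w = "\<lambda>x. norm (indicator (box a b) x * g x)"])
      show "AE x in lborel. (\<lambda>k. indicator D x * (g x * ?\<phi> k x)) \<longlonglongrightarrow> indicator (box a b) x * g x"
        unfolding sub[symmetric] by (intro AE_I2 tendsto_mult tendsto_const box_approx_limit)
      show "AE x in lborel. norm (indicator D x * (g x * ?\<phi> k x)) \<le> norm (indicator (box a b) x * g x)" for k
      proof (intro AE_I2)
        fix x
        have p: "0 \<le> ?\<phi> k x" "?\<phi> k x \<le> 1" using box_bump_nonneg[of a b x] by auto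
        show "norm (indicator D x * (g x * ?\<phi> k x)) \<le> norm (indicator (box a b) x * g x)"
        proof (cases "x \<in> box a b")
          case True
          then have "x \<in> D" using ab box_subset_cbox[of a b] by blast
          then show ?thesis using True p by (simp add: abs_mult mult_left_le)
        next
          case False
          then have "box_bump a b x = 0" using box_bump_pos[of a b x] box_bump_nonneg[of a b x] by linarith
          then show ?thesis by simp
        qed
      qed
    qed (use int in auto)
    then show "(LINT x|lborel. indicator (box a b) x * g x) = 0"
      using zero'[OF box_approx_test[OF ab]] by (simp add: LIMSEQ_const_iff)
  qed
  have on_box: "AE x in lborel. x \<in> box a b \<longrightarrow> g x = 0" if ab: "cbox a b \<subseteq> D" for a b
  proof -
    have "AE x in lborel. indicator (box a b) x * g x = 0"
    proof (rule box_integrals_zero_imp_AE[OF boxint[OF ab] _ boxzero[OF ab]])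
      fix c d :: "real^'n"
      obtain p q where pq: "box c d \<inter> box a b = box p q" using box_Int_box by blast
      have "(LINT x|lborel. indicator (box c d) x * (indicator (box a b) x * g x)) = (LINT x|lborel. indicator (box p q) x * g x)"
        unfolding pq[symmetric] by (simp add: indicator_inter_arith mult.assoc)
      also have "\<dots> = 0"
      proof (cases "box p q = {}")
        case False
        have "box p q \<subseteq> cbox a b" using pq box_subset_cbox[of a b] by blast
        then have "cbox p q \<subseteq> cbox a b"
          using closure_minimal[of "box p q" "cbox a b"] closure_box[OF False] closed_cbox[of a b] by simp
        then show ?thesis using ab by (intro boxzero) auto
      qed simp
      finally show "(LINT x|lborel. indicator (box c d) x * (indicator (box a b) x * g x)) = 0" .
    qed
    then show ?thesis by eventually_elim (auto simp: indicator_def split: if_splits)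
  qed
  have on_cbox: "AE x in lborel. x \<in> cbox a b \<longrightarrow> g x = 0" if ab: "cbox a b \<subseteq> D" for a b
  proof -
    have "cbox a b - box a b \<in> null_sets lborel"
      using negligible_frontier_interval[of a b] by (simp add: negligible_iff_null_sets null_sets_completion_iff)
    then have "AE x in lborel. x \<notin> cbox a b - box a b" by (rule AE_not_in)
    then show ?thesis using on_box[OF ab] by eventually_elim auto
  qed
  obtain \<D> where \<D>: "countable \<D>" "\<D> \<subseteq> Pow D" "\<And>X. X \<in> \<D> \<Longrightarrow> \<exists>a b. X = cbox a b" "\<Union>\<D> = D"
    using open_countable_Union_open_cbox[OF D] by blast
  have "AE x in lborel. \<forall>X\<in>\<D>. x \<in> X \<longrightarrow> g x = 0"
  proof (subst AE_ball_countable[OF \<D>(1)], intro ballI)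
    fix X assume X: "X \<in> \<D>"
    then obtain a b where "X = cbox a b" using \<D>(3) by blast
    then show "AE x in lborel. x \<in> X \<longrightarrow> g x = 0" using X \<D>(2) on_cbox by blast
  qed
  then have "AE x in lborel. x \<in> D \<longrightarrow> G x = 0"
    using gG
  proof eventually_elim
    case (elim x)
    show ?case
    proof
      assume x: "x \<in> D"
      then obtain X where "X \<in> \<D>" "x \<in> X" using \<D>(4) by blast
      then have "g x = 0" using elim(1) by blast
      then show "G x = 0" using elim(2) x by simp
    qed
  qed
  then show ?thesis by (subst AE_restrict_space_iff) (auto simp: AE_completion)
qed

section \<open>Weak gradients\<close>

lemma test_functions_bound:
  assumes "\<phi> \<in> test_functions D"
  obtains B R where "B \<ge> 0" "R \<ge> 0" "\<And>x. \<bar>\<phi> x\<bar> \<le> B" "\<And>x. norm (grad \<phi> x) \<le> B"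
    "\<And>x. norm x > R \<Longrightarrow> \<phi> x = 0" "\<And>x. norm x > R \<Longrightarrow> grad \<phi> x = 0"
proof -
  obtain K where K: "smooth \<phi>" "compact K" "\<And>x. x \<notin> K \<Longrightarrow> \<phi> x = 0" "\<And>x. x \<notin> K \<Longrightarrow> grad \<phi> x = 0"
    using assms by (elim test_functionsE) blast
  have "bounded (\<phi> ` K)"
    by (intro compact_imp_bounded compact_continuous_image smooth_continuous K)
  then obtain a where a: "\<And>x. x \<in> K \<Longrightarrow> norm (\<phi> x) \<le> a" by (auto simp: bounded_iff)
  have "bounded (grad \<phi> ` K)"
    by (intro compact_imp_bounded compact_continuous_image smooth_grad_continuous K)
  then obtain b where b: "\<And>x. x \<in> K \<Longrightarrow> norm (grad \<phi> x) \<le> b" by (auto simp: bounded_iff)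
  have "bounded K" by (rule compact_imp_bounded[OF K(2)])
  then obtain R where R: "\<And>x. x \<in> K \<Longrightarrow> norm x \<le> R" by (auto simp: bounded_iff)
  define B where "B = \<bar>a\<bar> + \<bar>b\<bar>"
  have "\<bar>\<phi> x\<bar> \<le> B" for x using a[of x] K(3)[of x] by (cases "x \<in> K") (auto simp: B_def)
  moreover have "norm (grad \<phi> x) \<le> B" for x using b[of x] K(4)[of x] by (cases "x \<in> K") (auto simp: B_def)
  moreover have "x \<notin> K" if "norm x > \<bar>R\<bar>" for x using R[of x] that by auto
  ultimately show ?thesis using K(3,4) that[of B "\<bar>R\<bar>"] by (auto simp: B_def)
qed

lemma smooth_measurable [measurable_dest]: "smooth f \<Longrightarrow> f \<in> borel_measurable borel"
  by (intro borel_measurable_continuous_onI smooth_continuous)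

lemma smooth_grad_measurable: "smooth f \<Longrightarrow> grad f \<in> borel_measurable borel"
  by (intro borel_measurable_continuous_onI smooth_grad_continuous)

lemma sq_integrable_compact_support:
  fixes f :: "'a::euclidean_space \<Rightarrow> 'b::euclidean_space"
  assumes f[measurable]: "f \<in> borel_measurable borel" and D[measurable]: "D \<in> sets borel"
    and bd: "\<And>x. norm (f x) \<le> B" "\<And>x. norm x > R \<Longrightarrow> f x = 0"
  shows "sq_integrable lborel f" "integrable lborel f" "sq_integrable (lebesgue_on D) f"
proof -
  have ind: "integrable lborel (\<lambda>x. indicat_real (cball (0::'a) R) x * c)" for c
    by (intro integrable_mult_left integrable_real_indicator) (use emeasure_bounded_finite[OF bounded_cball] in auto)
  have B0: "B \<ge> 0" using order_trans[OF norm_ge_zero bd(1)] .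
  show s: "sq_integrable lborel f" unfolding sq_integrable_def
  proof (intro conjI Bochner_Integration.integrable_bound[OF ind[of "B\<^sup>2"]] AE_I2)
    fix x show "norm ((norm (f x))\<^sup>2) \<le> norm (indicat_real (cball 0 R) x * B\<^sup>2)"
      using power_mono[OF bd(1)[of x], of 2] bd(2)[of x] by (auto simp: indicator_def not_le)
  qed simp_all
  show "integrable lborel f"
  proof (intro Bochner_Integration.integrable_bound[OF ind[of B]] AE_I2)
    fix x show "norm (f x) \<le> norm (indicat_real (cball 0 R) x * B)"
      using bd[of x] B0 by (auto simp: indicator_def not_le)
  qed simp_all
  show "sq_integrable (lebesgue_on D) f"
    using s integrable_mult_indicator[of D lborel "\<lambda>x. (norm (f x))\<^sup>2"]
    by (simp add: sq_integrable_def lebesgue_on_integral_lborel)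
qed

lemma test_functions_integrable:
  assumes \<phi>: "\<phi> \<in> test_functions D" and E: "E \<in> sets borel"
  shows "sq_integrable (lebesgue_on E) \<phi>" "sq_integrable (lebesgue_on E) (grad \<phi>)"
    "sq_integrable lborel \<phi>" "sq_integrable lborel (grad \<phi>)"
    "integrable lborel \<phi>" "integrable lborel (grad \<phi>)"
proof -
  obtain B R where b: "\<And>x. \<bar>\<phi> x\<bar> \<le> B" "\<And>x. norm (grad \<phi> x) \<le> B"
    "\<And>x. norm x > R \<Longrightarrow> \<phi> x = 0" "\<And>x. norm x > R \<Longrightarrow> grad \<phi> x = 0"
    using \<phi> by (elim test_functions_bound) blast
  have m: "\<phi> \<in> borel_measurable borel" "grad \<phi> \<in> borel_measurable borel"
    using test_functions_smooth[OF \<phi>] smooth_measurable smooth_grad_measurable by blast+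
  show "sq_integrable (lebesgue_on E) \<phi>" "sq_integrable lborel \<phi>" "integrable lborel \<phi>"
    using sq_integrable_compact_support[OF m(1) E b(1)[folded real_norm_def] b(3)] by blast+
  show "sq_integrable (lebesgue_on E) (grad \<phi>)" "sq_integrable lborel (grad \<phi>)" "integrable lborel (grad \<phi>)"
    using sq_integrable_compact_support[OF m(2) E b(2,4)] by blast+
qed

lemma lipschitz_of_grad_bound:
  assumes "smooth \<phi>" "\<And>x. norm (grad \<phi> x) \<le> B"
  shows "\<bar>\<phi> (x + h) - \<phi> x\<bar> \<le> B * norm h"
proof -
  have "norm (\<phi> (x + h) - \<phi> x) \<le> B * norm (x + h - x)"
  proof (rule differentiable_bound[of UNIV])
    show "(\<phi> has_derivative (\<lambda>h. grad \<phi> y \<bullet> h)) (at y within UNIV)" for y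
      using assms(1) by (simp add: has_derivative_grad smooth_differentiable)
    show "onorm (\<lambda>h. grad \<phi> y \<bullet> h) \<le> B" for y
    proof (rule onorm_le)
      fix h
      have "norm (grad \<phi> y \<bullet> h) \<le> norm (grad \<phi> y) * norm h" by (simp add: Cauchy_Schwarz_ineq2)
      also have "\<dots> \<le> B * norm h" using assms(2) by (intro mult_right_mono) auto
      finally show "norm (grad \<phi> y \<bullet> h) \<le> B * norm h" .
    qed
  qed auto
  then show ?thesis by simp
qed

lemma lborel_integral_shift:
  fixes f :: "'a::euclidean_space \<Rightarrow> 'b::euclidean_space"
  assumes [measurable]: "f \<in> borel_measurable borel"
  shows "(LINT x|lborel. f (x + c)) = (LINT x|lborel. f x)"
    and "integrable lborel (\<lambda>x. f (x + c)) \<longleftrightarrow> integrable lborel f"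
proof -
  have "(LINT x|lborel. f x) = (LINT x|distr lborel borel ((+) c). f x)" by (simp add: lborel_distr_plus)
  also have "\<dots> = (LINT x|lborel. f (x + c))" by (subst integral_distr) (auto simp: add.commute)
  finally show "(LINT x|lborel. f (x + c)) = (LINT x|lborel. f x)" by simp
  have "integrable lborel f \<longleftrightarrow> integrable (distr lborel borel ((+) c)) f" by (simp add: lborel_distr_plus)
  also have "\<dots> \<longleftrightarrow> integrable lborel (\<lambda>x. f (x + c))" by (subst integrable_distr_eq) (auto simp: add.commute)
  finally show "integrable lborel (\<lambda>x. f (x + c)) \<longleftrightarrow> integrable lborel f" by simp
qed

text \<open>The difference quotients of \<open>\<phi>\<close> have integral zero by translation invariance.\<close>

lemma test_functions_grad_integral:
  assumes \<phi>: "\<phi> \<in> test_functions D"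
  shows "(LINT x|lborel. grad \<phi> x \<bullet> e) = 0"
proof -
  obtain B R where b: "B \<ge> 0" "\<And>x. \<bar>\<phi> x\<bar> \<le> B" "\<And>x. norm (grad \<phi> x) \<le> B"
    "\<And>x. norm x > R \<Longrightarrow> \<phi> x = 0" "\<And>x. norm x > R \<Longrightarrow> grad \<phi> x = 0"
    using \<phi> by (elim test_functions_bound) blast
  have s: "smooth \<phi>" by (rule test_functions_smooth[OF \<phi>])
  have [measurable]: "\<phi> \<in> borel_measurable borel" "grad \<phi> \<in> borel_measurable borel"
    using s smooth_measurable smooth_grad_measurable by blast+
  have int: "integrable lborel \<phi>" by (rule test_functions_integrable(5)[OF \<phi> sets.top])
  define t where "t k = inverse (real (Suc k))" for k
  have t: "t k > 0" "t k \<le> 1" "t \<longlonglongrightarrow> 0" for k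
    using LIMSEQ_inverse_real_of_nat by (auto simp: t_def[abs_def] field_simps)
  let ?q = "\<lambda>k x. (\<phi> (x + t k *\<^sub>R e) - \<phi> x) / t k"
  have "(\<lambda>k. LINT x|lborel. ?q k x) \<longlonglongrightarrow> (LINT x|lborel. grad \<phi> x \<bullet> e)"
  proof (rule integral_dominated_convergence[where w = "\<lambda>x. indicator (cball 0 (R + norm e)) x * (B * norm e)"])
    show "integrable lborel (\<lambda>x. indicator (cball (0::real^'a) (R + norm e)) x * (B * norm e))"
      by (intro integrable_mult_left integrable_real_indicator) (use emeasure_bounded_finite[OF bounded_cball] in auto)
    show "AE x in lborel. (\<lambda>k. ?q k x) \<longlonglongrightarrow> grad \<phi> x \<bullet> e"
    proof (intro AE_I2)
      fix x
      have "((\<lambda>s. \<phi> (x + s *\<^sub>R e)) has_real_derivative (grad \<phi> x \<bullet> e)) (at 0)"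
      proof -
        have "((\<lambda>s. x + s *\<^sub>R e) has_derivative (\<lambda>s. s *\<^sub>R e)) (at 0)"
          by (auto intro!: derivative_eq_intros)
        from has_derivative_compose[OF this, of \<phi> "\<lambda>h. grad \<phi> x \<bullet> h"]
        show ?thesis using has_derivative_grad[OF smooth_differentiable[OF s], of x]
          by (simp add: has_field_derivative_def mult_commute_abs)
      qed
      then have "((\<lambda>s. (\<phi> (x + s *\<^sub>R e) - \<phi> x) / s) \<longlongrightarrow> grad \<phi> x \<bullet> e) (at 0)"
        by (simp add: has_field_derivative_iff)
      moreover have "filterlim t (at 0) sequentially"
        unfolding filterlim_at using t(3) t(1) by (auto simp: less_imp_neq[symmetric])
      ultimately show "(\<lambda>k. ?q k x) \<longlonglongrightarrow> grad \<phi> x \<bullet> e" by (rule filterlim_compose)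
    qed
    show "AE x in lborel. norm (?q k x) \<le> indicator (cball 0 (R + norm e)) x * (B * norm e)" for k
    proof (intro AE_I2)
      fix x
      show "norm (?q k x) \<le> indicator (cball 0 (R + norm e)) x * (B * norm e)"
      proof (cases "norm x \<le> R + norm e")
        case True
        have "\<bar>\<phi> (x + t k *\<^sub>R e) - \<phi> x\<bar> \<le> B * (t k * norm e)"
          using lipschitz_of_grad_bound[OF s b(3), of x "t k *\<^sub>R e"] t(1)[of k] by simp
        then have "\<bar>?q k x\<bar> \<le> B * norm e" using t(1)[of k] by (simp add: field_simps)
        then show ?thesis using True by simp
      next
        case False
        have "norm (t k *\<^sub>R e) \<le> norm e" using t(1,2)[of k] by (simp add: mult_left_le_one_le)
        moreover have "norm x \<le> norm (x + t k *\<^sub>R e) + norm (t k *\<^sub>R e)"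
          using norm_triangle_ineq4[of "x + t k *\<^sub>R e" "t k *\<^sub>R e"] by simp
        ultimately have "norm (x + t k *\<^sub>R e) > R" "norm x > R" using False norm_ge_zero[of e] by linarith+
        then have "norm (?q k x) = 0" using b(4) by simp
        moreover have "0 \<le> indicator (cball 0 (R + norm e)) x * (B * norm e)" using b(1) by simp
        ultimately show ?thesis by linarith
      qed
    qed
  qed auto
  moreover have "(LINT x|lborel. ?q k x) = 0" for k
    using int lborel_integral_shift[of \<phi> "t k *\<^sub>R e"] by simp
  then have "(\<lambda>k. LINT x|lborel. ?q k x) \<longlonglongrightarrow> 0" by (simp only: tendsto_const)
  ultimately show ?thesis by (rule LIMSEQ_unique)
qed

lemma integral_test_lborel:
  fixes f :: "real^'n \<Rightarrow> real"
  assumes D: "open D" and f: "f \<in> borel_measurable borel" "\<And>x. x \<notin> D \<Longrightarrow> f x = 0"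
  shows "(LINT x|lebesgue_on D. f x) = (LINT x|lborel. f x)"
proof -
  have "(\<lambda>x. indicator D x *\<^sub>R f x) = f" using f(2) by (auto simp: indicator_def fun_eq_iff)
  then show ?thesis using D f(1) by (simp add: lebesgue_on_integral_lborel)
qed

lemma integration_by_parts_test:
  assumes D: "open D" and u: "smooth u" and \<phi>: "\<phi> \<in> test_functions D"
  shows "(LINT x|lebesgue_on D. u x * grad \<phi> x $ i) = - (LINT x|lebesgue_on D. grad u x $ i * \<phi> x)"
proof -
  have s: "smooth \<phi>" by (rule test_functions_smooth[OF \<phi>])
  obtain K where K: "K \<subseteq> D" "\<And>x. x \<notin> K \<Longrightarrow> \<phi> x = 0" "\<And>x. x \<notin> K \<Longrightarrow> grad \<phi> x = 0"
    using \<phi> by (elim test_functionsE) blast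
  have t1: "(\<lambda>x. u x * grad \<phi> x $ i) \<in> test_functions D"
    using test_functions_mult[OF u test_functions_grad[OF \<phi>, of "axis i 1"]] by (simp add: inner_axis)
  have t2: "(\<lambda>x. grad u x $ i * \<phi> x) \<in> test_functions D"
    by (rule test_functions_mult[OF smooth_grad[OF u] \<phi>])
  have g: "grad (\<lambda>x. u x * \<phi> x) x \<bullet> axis i 1 = u x * grad \<phi> x $ i + grad u x $ i * \<phi> x" for x
    using grad_mult[OF smooth_differentiable[OF u] smooth_differentiable[OF s]]
    by (simp add: inner_axis)
  have "0 = (LINT x|lborel. grad (\<lambda>x. u x * \<phi> x) x \<bullet> axis i 1)"
    using test_functions_grad_integral[OF test_functions_mult[OF u \<phi>]] by simp
  also have "\<dots> = (LINT x|lborel. u x * grad \<phi> x $ i) + (LINT x|lborel. grad u x $ i * \<phi> x)"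
    unfolding g by (intro Bochner_Integration.integral_add test_functions_integrable(5)[OF t1 sets.top]
        test_functions_integrable(5)[OF t2 sets.top])
  finally have *: "(LINT x|lborel. u x * grad \<phi> x $ i) = - (LINT x|lborel. grad u x $ i * \<phi> x)" by simp
  have "\<phi> x = 0" "grad \<phi> x = 0" if "x \<notin> D" for x using K that by blast+
  then have z: "u x * grad \<phi> x $ i = 0" "grad u x $ i * \<phi> x = 0" if "x \<notin> D" for x using that by auto
  have "(LINT x|lebesgue_on D. u x * grad \<phi> x $ i) = (LINT x|lborel. u x * grad \<phi> x $ i)"
    by (rule integral_test_lborel[OF D smooth_measurable[OF test_functions_smooth[OF t1]] z(1)])
  moreover have "(LINT x|lebesgue_on D. grad u x $ i * \<phi> x) = (LINT x|lborel. grad u x $ i * \<phi> x)"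
    by (rule integral_test_lborel[OF D smooth_measurable[OF test_functions_smooth[OF t2]] z(2)])
  ultimately show ?thesis using * by argo
qed

lemma weak_gradient_smooth:
  assumes "open D" "smooth u" "sq_integrable (lebesgue_on D) u" "sq_integrable (lebesgue_on D) (grad u)"
  shows "weak_gradient D u (grad u)"
  using assms integration_by_parts_test unfolding weak_gradient_def L2_iff by blast

lemma weak_gradient_sq:
  assumes "weak_gradient D u G"
  shows "sq_integrable (lebesgue_on D) u" "sq_integrable (lebesgue_on D) G"
  using assms by (auto simp: weak_gradient_def L2_iff)

lemma weak_gradient_eq:
  "weak_gradient D u G \<Longrightarrow> \<phi> \<in> test_functions D \<Longrightarrow>
    (LINT x|lebesgue_on D. u x * grad \<phi> x $ i) = - (LINT x|lebesgue_on D. G x $ i * \<phi> x)"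
  by (auto simp: weak_gradient_def)

lemma weak_gradient_unique:
  assumes D: "open D" and w: "weak_gradient D u G" "weak_gradient D v H"
    and eq: "AE x in lebesgue_on D. u x = v x"
  shows "AE x in lebesgue_on D. G x = H x"
proof -
  have Db: "D \<in> sets borel" using D by simp
  have "AE x in lebesgue_on D. G x $ i - H x $ i = 0" for i
  proof (rule fundamental_lemma[OF D])
    show "sq_integrable (lebesgue_on D) (\<lambda>x. G x $ i - H x $ i)"
      by (intro sq_integrable_diff sq_integrable_component weak_gradient_sq(2)[OF w(1)] weak_gradient_sq(2)[OF w(2)])
    fix \<phi> assume \<phi>: "\<phi> \<in> test_functions D"
    have [measurable]: "u \<in> borel_measurable (lebesgue_on D)" "v \<in> borel_measurable (lebesgue_on D)"
      "(\<lambda>x. grad \<phi> x $ i) \<in> borel_measurable (lebesgue_on D)"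
      using weak_gradient_sq[OF w(1)] weak_gradient_sq[OF w(2)]
        sq_integrable_component[OF test_functions_integrable(2)[OF \<phi> Db], of i] by (auto simp: sq_integrable_def)
    have i: "integrable (lebesgue_on D) (\<lambda>x. G x $ i * \<phi> x)" "integrable (lebesgue_on D) (\<lambda>x. H x $ i * \<phi> x)"
      by (intro sq_integrable_mult sq_integrable_component weak_gradient_sq(2)[OF w(1)] weak_gradient_sq(2)[OF w(2)] test_functions_integrable[OF \<phi> Db])+
    have "(LINT x|lebesgue_on D. u x * grad \<phi> x $ i) = (LINT x|lebesgue_on D. v x * grad \<phi> x $ i)"
      using eq by (intro integral_cong_AE) auto
    then have "(LINT x|lebesgue_on D. G x $ i * \<phi> x) = (LINT x|lebesgue_on D. H x $ i * \<phi> x)"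
      using weak_gradient_eq[OF w(1) \<phi>] weak_gradient_eq[OF w(2) \<phi>] by simp
    then show "(LINT x|lebesgue_on D. (G x $ i - H x $ i) * \<phi> x) = 0"
      using i by (simp add: left_diff_distrib)
  qed
  then have "AE x in lebesgue_on D. \<forall>i. G x $ i - H x $ i = 0" by (simp add: AE_all_countable)
  then show ?thesis by eventually_elim (simp add: vec_eq_iff)
qed

lemma weak_gradient_lin:
  assumes D: "open D" and w: "weak_gradient D u G" "weak_gradient D v H"
  shows "weak_gradient D (\<lambda>x. a * u x + b * v x) (\<lambda>x. a *\<^sub>R G x + b *\<^sub>R H x)"
  unfolding weak_gradient_def L2_iff
proof (intro conjI ballI allI)
  show "sq_integrable (lebesgue_on D) (\<lambda>x. a * u x + b * v x)"
    using sq_integrable_lin[OF weak_gradient_sq(1)[OF w(1)] weak_gradient_sq(1)[OF w(2)], of a b] by simp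
  show "sq_integrable (lebesgue_on D) (\<lambda>x. a *\<^sub>R G x + b *\<^sub>R H x)"
    by (rule sq_integrable_lin[OF weak_gradient_sq(2)[OF w(1)] weak_gradient_sq(2)[OF w(2)]])
  fix \<phi> i assume \<phi>: "\<phi> \<in> test_functions D"
  have Db: "D \<in> sets borel" using D by simp
  note t = test_functions_integrable[OF \<phi> Db]
  have i: "integrable (lebesgue_on D) (\<lambda>x. u x * grad \<phi> x $ i)" "integrable (lebesgue_on D) (\<lambda>x. v x * grad \<phi> x $ i)"
    "integrable (lebesgue_on D) (\<lambda>x. G x $ i * \<phi> x)" "integrable (lebesgue_on D) (\<lambda>x. H x $ i * \<phi> x)"
    by (intro sq_integrable_mult sq_integrable_component weak_gradient_sq[OF w(1)] weak_gradient_sq[OF w(2)] t)+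
  have "(LINT x|lebesgue_on D. (a * u x + b * v x) * grad \<phi> x $ i)
      = a * (LINT x|lebesgue_on D. u x * grad \<phi> x $ i) + b * (LINT x|lebesgue_on D. v x * grad \<phi> x $ i)"
    using i by (simp add: distrib_right mult.assoc)
  also have "\<dots> = - (a * (LINT x|lebesgue_on D. G x $ i * \<phi> x) + b * (LINT x|lebesgue_on D. H x $ i * \<phi> x))"
    using weak_gradient_eq[OF w(1) \<phi>] weak_gradient_eq[OF w(2) \<phi>] by simp
  also have "\<dots> = - (LINT x|lebesgue_on D. (a *\<^sub>R G x + b *\<^sub>R H x) $ i * \<phi> x)"
    using i by (simp add: distrib_right mult.assoc)
  finally show "(LINT x|lebesgue_on D. (a * u x + b * v x) * grad \<phi> x $ i) =
    - (LINT x|lebesgue_on D. (a *\<^sub>R G x + b *\<^sub>R H x) $ i * \<phi> x)" .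
qed

lemma l2_limit_integral:
  fixes f :: "nat \<Rightarrow> 'a \<Rightarrow> 'b::euclidean_space"
  assumes f: "\<And>k. sq_integrable M (f k)" "sq_integrable M g" "sq_integrable M h"
    and lim: "(\<lambda>k. l2norm M (\<lambda>x. f k x - g x)) \<longlonglongrightarrow> 0"
  shows "(\<lambda>k. LINT x|M. f k x \<bullet> h x) \<longlonglongrightarrow> (LINT x|M. g x \<bullet> h x)"
proof -
  have "norm ((LINT x|M. f k x \<bullet> h x) - (LINT x|M. g x \<bullet> h x)) \<le> l2norm M (\<lambda>x. f k x - g x) * l2norm M h" for k
    using inner_integral_le[OF sq_integrable_diff[OF f(1,2)] f(3), of k]
      sq_integrable_inner[OF f(1,3), of k] sq_integrable_inner[OF f(2,3)]
    by (simp add: inner_diff_left)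
  moreover have "(\<lambda>k. l2norm M (\<lambda>x. f k x - g x) * l2norm M h) \<longlonglongrightarrow> 0"
    using tendsto_mult_right[OF lim, of "l2norm M h"] by simp
  ultimately have "(\<lambda>k. (LINT x|M. f k x \<bullet> h x) - (LINT x|M. g x \<bullet> h x)) \<longlonglongrightarrow> 0"
    by (intro Lim_null_comparison[of "\<lambda>k. (LINT x|M. f k x \<bullet> h x) - (LINT x|M. g x \<bullet> h x)"]) auto
  then show ?thesis using LIM_zero_iff by blast
qed

lemma l2norm_component_le:
  fixes f :: "'a \<Rightarrow> real^'n"
  assumes "sq_integrable M f" shows "l2norm M (\<lambda>x. f x $ i) \<le> l2norm M f"
  using assms sq_integrable_component[OF assms, of i]
  by (intro l2norm_mono) (auto simp: sq_integrable_def component_le_norm_cart)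

lemma weak_gradient_limit:
  assumes D: "open D" and w: "\<And>k. weak_gradient D (u k) (G k)"
    and sq: "sq_integrable (lebesgue_on D) v" "sq_integrable (lebesgue_on D) H"
    and lim: "(\<lambda>k. l2norm (lebesgue_on D) (\<lambda>x. u k x - v x)) \<longlonglongrightarrow> 0"
      "(\<lambda>k. l2norm (lebesgue_on D) (\<lambda>x. G k x - H x)) \<longlonglongrightarrow> 0"
  shows "weak_gradient D v H"
  unfolding weak_gradient_def L2_iff
proof (intro conjI ballI allI)
  fix \<phi> i assume \<phi>: "\<phi> \<in> test_functions D"
  have Db: "D \<in> sets borel" using D by simp
  note t = test_functions_integrable[OF \<phi> Db]
  have "(\<lambda>k. l2norm (lebesgue_on D) (\<lambda>x. G k x $ i - H x $ i)) \<longlonglongrightarrow> 0"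
  proof (rule tendsto_sandwich[OF _ _ tendsto_const lim(2)])
    show "\<forall>\<^sub>F k in sequentially. l2norm (lebesgue_on D) (\<lambda>x. G k x $ i - H x $ i) \<le> l2norm (lebesgue_on D) (\<lambda>x. G k x - H x)"
      using l2norm_component_le[OF sq_integrable_diff[OF weak_gradient_sq(2)[OF w] sq(2)], of _ i] by simp
  qed simp
  then have "(\<lambda>k. LINT x|lebesgue_on D. G k x $ i * \<phi> x) \<longlonglongrightarrow> (LINT x|lebesgue_on D. H x $ i * \<phi> x)"
    using l2_limit_integral[OF sq_integrable_component[OF weak_gradient_sq(2)[OF w]]
        sq_integrable_component[OF sq(2)] t(1)] by simp
  then have "(\<lambda>k. - (LINT x|lebesgue_on D. G k x $ i * \<phi> x)) \<longlonglongrightarrow> - (LINT x|lebesgue_on D. H x $ i * \<phi> x)"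
    by (rule tendsto_minus)
  moreover have "(\<lambda>k. LINT x|lebesgue_on D. u k x * grad \<phi> x $ i) \<longlonglongrightarrow> (LINT x|lebesgue_on D. v x * grad \<phi> x $ i)"
    using l2_limit_integral[OF weak_gradient_sq(1)[OF w] sq(1) sq_integrable_component[OF t(2)] lim(1), of i] by simp
  ultimately show "(LINT x|lebesgue_on D. v x * grad \<phi> x $ i) = - (LINT x|lebesgue_on D. H x $ i * \<phi> x)"
    using LIMSEQ_unique weak_gradient_eq[OF w \<phi>] by simp
qed (use sq in auto)

lemma weak_gradient_cong:
  assumes D: "open D" and w: "weak_gradient D u G" and v: "sq_integrable (lebesgue_on D) v"
    and eq: "AE x in lebesgue_on D. u x = v x"
  shows "weak_gradient D v G"
proof (rule weak_gradient_limit[OF D w v weak_gradient_sq(2)[OF w]])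
  have "l2norm (lebesgue_on D) (\<lambda>x. u x - v x) = l2norm (lebesgue_on D) (\<lambda>x. 0::real)"
    using eq v weak_gradient_sq[OF w] by (intro l2norm_cong_AE) (auto simp: sq_integrable_def)
  then show "(\<lambda>k. l2norm (lebesgue_on D) (\<lambda>x. u x - v x)) \<longlonglongrightarrow> 0" by (simp add: l2norm_def)
qed (simp add: l2norm_def)

lemma weak_gradient_wgrad: "weak_gradient D u G \<Longrightarrow> weak_gradient D u (wgrad D u)"
  unfolding wgrad_def by (rule someI[of "weak_gradient D u"])

lemma H1_wgrad: "u \<in> H1 D \<longleftrightarrow> weak_gradient D u (wgrad D u)"
  using weak_gradient_wgrad by (auto simp: H1_def)

lemma H1_norm_eq:
  assumes D: "open D" and w: "weak_gradient D u G"
  shows "H1_norm D u = sqrt ((l2norm (lebesgue_on D) u)\<^sup>2 + (l2norm (lebesgue_on D) G)\<^sup>2)"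
proof -
  have "l2norm (lebesgue_on D) (wgrad D u) = l2norm (lebesgue_on D) G"
    using weak_gradient_wgrad[OF w] weak_gradient_unique[OF D weak_gradient_wgrad[OF w] w]
      weak_gradient_sq[OF w] weak_gradient_sq[OF weak_gradient_wgrad[OF w]]
    by (intro l2norm_cong_AE) (auto simp: sq_integrable_def)
  then show ?thesis by (simp add: H1_norm_def l2norm_sq[symmetric]) (simp add: l2norm_sq)
qed

lemma H1_norm_less:
  assumes "open D" "weak_gradient D u G" "H1_norm D u < e"
  shows "l2norm (lebesgue_on D) u < e" "l2norm (lebesgue_on D) G < e"
proof -
  have "l2norm (lebesgue_on D) u \<le> H1_norm D u" "l2norm (lebesgue_on D) G \<le> H1_norm D u"
    unfolding H1_norm_eq[OF assms(1,2)] by (auto intro: real_le_rsqrt)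
  then show "l2norm (lebesgue_on D) u < e" "l2norm (lebesgue_on D) G < e" using assms(3) by auto
qed

lemma H1_norm_le:
  assumes "open D" "weak_gradient D u G"
  shows "H1_norm D u \<le> l2norm (lebesgue_on D) u + l2norm (lebesgue_on D) G"
  unfolding H1_norm_eq[OF assms] by (rule sqrt_sum_squares_le_sum) auto

lemma weak_gradient_diff:
  assumes "open D" "weak_gradient D u G" "weak_gradient D v H"
  shows "weak_gradient D (\<lambda>x. u x - v x) (\<lambda>x. G x - H x)"
  using weak_gradient_lin[OF assms, of 1 "- 1"] by simp

lemma H1_closure_iff:
  assumes D: "open D" and S: "S \<subseteq> H1 D"
  shows "u \<in> H1_closure D S \<longleftrightarrow> (\<exists>G. weak_gradient D u G \<and>
    (\<forall>e>0. \<exists>\<phi>\<in>S. \<exists>H. weak_gradient D \<phi> H \<and> l2norm (lebesgue_on D) (\<lambda>x. u x - \<phi> x) < e \<and>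
       l2norm (lebesgue_on D) (\<lambda>x. G x - H x) < e))"
proof
  assume u: "u \<in> H1_closure D S"
  then have w: "weak_gradient D u (wgrad D u)" by (simp add: H1_closure_def H1_wgrad)
  show "\<exists>G. weak_gradient D u G \<and>
    (\<forall>e>0. \<exists>\<phi>\<in>S. \<exists>H. weak_gradient D \<phi> H \<and> l2norm (lebesgue_on D) (\<lambda>x. u x - \<phi> x) < e \<and>
       l2norm (lebesgue_on D) (\<lambda>x. G x - H x) < e)"
  proof (intro exI conjI allI impI, rule w)
    fix e :: real assume "e > 0"
    then obtain \<phi> where \<phi>: "\<phi> \<in> S" "H1_norm D (\<lambda>x. u x - \<phi> x) < e" using u by (auto simp: H1_closure_def)
    then have w2: "weak_gradient D \<phi> (wgrad D \<phi>)" using S by (auto simp: H1_wgrad)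
    then show "\<exists>\<phi>\<in>S. \<exists>H. weak_gradient D \<phi> H \<and> l2norm (lebesgue_on D) (\<lambda>x. u x - \<phi> x) < e \<and>
       l2norm (lebesgue_on D) (\<lambda>x. wgrad D u x - H x) < e"
      using \<phi> H1_norm_less[OF D weak_gradient_diff[OF D w w2] \<phi>(2)] by blast
  qed
next
  assume "\<exists>G. weak_gradient D u G \<and>
    (\<forall>e>0. \<exists>\<phi>\<in>S. \<exists>H. weak_gradient D \<phi> H \<and> l2norm (lebesgue_on D) (\<lambda>x. u x - \<phi> x) < e \<and>
       l2norm (lebesgue_on D) (\<lambda>x. G x - H x) < e)"
  then obtain G where G: "weak_gradient D u G" and
    appr: "\<And>e. e > 0 \<Longrightarrow> \<exists>\<phi>\<in>S. \<exists>H. weak_gradient D \<phi> H \<and> l2norm (lebesgue_on D) (\<lambda>x. u x - \<phi> x) < e \<and>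
       l2norm (lebesgue_on D) (\<lambda>x. G x - H x) < e" by blast
  have "\<exists>\<phi>\<in>S. H1_norm D (\<lambda>x. u x - \<phi> x) < e" if e: "e > 0" for e
  proof -
    obtain \<phi> H where \<phi>: "\<phi> \<in> S" "weak_gradient D \<phi> H" "l2norm (lebesgue_on D) (\<lambda>x. u x - \<phi> x) < e / 2"
       "l2norm (lebesgue_on D) (\<lambda>x. G x - H x) < e / 2" using appr[OF half_gt_zero[OF e]] by blast
    then show ?thesis using H1_norm_le[OF D weak_gradient_diff[OF D G \<phi>(2)]] by force
  qed
  then show "u \<in> H1_closure D S" using G by (auto simp: H1_closure_def H1_def)
qed

lemma lebesgue_on_subset:
  assumes "A \<in> sets lebesgue" "D \<in> sets lebesgue" "A \<subseteq> D"
  shows "lebesgue_on A = restrict_space (lebesgue_on D) A"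
  using assms by (subst restrict_restrict_space) (auto simp: Int_absorb1)

lemma AE_lebesgue_on_subset:
  assumes "A \<in> sets lebesgue" "D \<in> sets lebesgue" "A \<subseteq> D" "AE x in lebesgue_on D. P x"
  shows "AE x in lebesgue_on A. P x"
  using assms by (auto simp: AE_restrict_space_iff elim!: eventually_mono)

lemma sq_integrable_subset:
  fixes f :: "'a::euclidean_space \<Rightarrow> 'b::euclidean_space"
  assumes A: "A \<in> sets lebesgue" "D \<in> sets lebesgue" "A \<subseteq> D" and f: "sq_integrable (lebesgue_on D) f"
  shows "sq_integrable (lebesgue_on A) f" "l2norm (lebesgue_on A) f \<le> l2norm (lebesgue_on D) f"
proof -
  have As: "A \<inter> space (lebesgue_on D) \<in> sets (lebesgue_on D)"
    using A by (auto simp: sets_restrict_space_iff Int_absorb2)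
  have As': "A \<in> sets (lebesgue_on D)" using A by (auto simp: sets_restrict_space_iff)
  have i: "integrable (lebesgue_on D) (\<lambda>x. (norm (f x))\<^sup>2)" using f by (simp add: sq_integrable_def)
  have fm: "f \<in> borel_measurable (lebesgue_on A)"
    using f unfolding lebesgue_on_subset[OF A] by (intro measurable_restrict_space1[of f "lebesgue_on D"]) (simp add: sq_integrable_def)
  have ii: "integrable (lebesgue_on D) (\<lambda>x. indicator A x *\<^sub>R (norm (f x))\<^sup>2)"
    using integrable_mult_indicator[OF As' i] .
  then show "sq_integrable (lebesgue_on A) f"
    using fm unfolding sq_integrable_def lebesgue_on_subset[OF A] by (simp add: integrable_restrict_space[OF As])
  have "(LINT x|lebesgue_on A. (norm (f x))\<^sup>2) = (LINT x|lebesgue_on D. indicator A x *\<^sub>R (norm (f x))\<^sup>2)"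
    unfolding lebesgue_on_subset[OF A] by (rule integral_restrict_space[OF As])
  also have "\<dots> \<le> (LINT x|lebesgue_on D. (norm (f x))\<^sup>2)"
    using i ii by (intro integral_mono) (auto simp: indicator_def)
  finally show "l2norm (lebesgue_on A) f \<le> l2norm (lebesgue_on D) f" by (simp add: l2norm_def)
qed

section \<open>The energy spaces as Hilbert spaces\<close>

text \<open>The common frame of \<open>H10_space\<close> (\<open>\<kappa> = 0\<close>, \<open>S\<close> the test functions) and \<open>H1per_mod_const\<close>
  (\<open>\<kappa> = 1\<close>, \<open>S\<close> the smooth periodic functions): \<open>\<kappa>\<close> times the integral is the constant that is
  subtracted in the Poincare inequality, and the identification is modulo constants if \<open>\<kappa> = 1\<close>.\<close>

locale gradient_space =
  fixes D :: "(real^'n) set" and S :: "(real^'n \<Rightarrow> real) set" and \<kappa> P :: real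
  assumes D: "open D" and D_finite: "emeasure lborel D < \<infinity>"
    and P_nonneg: "P \<ge> 0" and S_H1: "S \<subseteq> H1 D" and S_nonempty: "S \<noteq> {}"
    and S_lin: "\<phi> \<in> S \<Longrightarrow> \<psi> \<in> S \<Longrightarrow> (\<lambda>x. a * \<phi> x + b * \<psi> x) \<in> S"
    and S_const: "\<kappa> \<noteq> 0 \<Longrightarrow> (\<lambda>_. c) \<in> S"
    and Poincare_S: "\<phi> \<in> S \<Longrightarrow> weak_gradient D \<phi> G \<Longrightarrow>
      l2norm (lebesgue_on D) (\<lambda>x. \<phi> x - \<kappa> * (LINT x|lebesgue_on D. \<phi> x)) \<le> P * l2norm (lebesgue_on D) G"
begin

definition X :: "(real^'n \<Rightarrow> real) set" where "X = H1_closure D S"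

definition eqv :: "((real^'n \<Rightarrow> real) \<times> (real^'n \<Rightarrow> real)) set" where
  "eqv = {(u, v). u \<in> X \<and> v \<in> X \<and> (\<exists>c. (\<kappa> = 0 \<longrightarrow> c = 0) \<and> (AE x in lebesgue_on D. u x = v x + c))}"

definition H :: "(real^'n \<Rightarrow> real) set set" where "H = X // eqv"

abbreviation "M \<equiv> lebesgue_on D"

lemma D_borel [measurable]: "D \<in> sets borel" and D_lebesgue: "D \<in> sets lebesgue"
  using D by auto

lemma const_sq: "sq_integrable M (\<lambda>_. c)"
proof -
  have "integrable lborel (\<lambda>x. indicat_real D x * (norm c)\<^sup>2)"
    using D_finite by (intro integrable_mult_left integrable_real_indicator) auto
  then show ?thesis by (simp add: sq_integrable_def lebesgue_on_integral_lborel)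
qed

lemma const_weak_gradient: "weak_gradient D (\<lambda>_. c) (\<lambda>_. 0)"
proof -
  have "grad (\<lambda>_::real^'n. c) = (\<lambda>_. 0)" by (simp add: fun_eq_iff)
  then show ?thesis using weak_gradient_smooth[OF D smooth_const[of c] const_sq] const_sq[of "0::real^'n"] by simp
qed

lemma X_weak_gradient: "u \<in> X \<Longrightarrow> weak_gradient D u (wgrad D u)"
  by (simp add: X_def H1_closure_def H1_wgrad)

lemma X_approx:
  assumes "u \<in> X" "weak_gradient D u G" "e > 0"
  shows "\<exists>\<phi>\<in>S. \<exists>F. weak_gradient D \<phi> F \<and> l2norm M (\<lambda>x. u x - \<phi> x) < e \<and> l2norm M (\<lambda>x. G x - F x) < e"
proof -
  obtain G' where G': "weak_gradient D u G'" and
    appr: "\<And>e. e > 0 \<Longrightarrow> \<exists>\<phi>\<in>S. \<exists>F. weak_gradient D \<phi> F \<and> l2norm M (\<lambda>x. u x - \<phi> x) < e \<and>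
       l2norm M (\<lambda>x. G' x - F x) < e"
    using assms(1) H1_closure_iff[OF D S_H1] by (auto simp: X_def)
  obtain \<phi> F where \<phi>: "\<phi> \<in> S" "weak_gradient D \<phi> F" "l2norm M (\<lambda>x. u x - \<phi> x) < e" "l2norm M (\<lambda>x. G' x - F x) < e"
    using appr[OF assms(3)] by blast
  have "l2norm M (\<lambda>x. G x - F x) = l2norm M (\<lambda>x. G' x - F x)"
  proof (rule l2norm_cong_AE)
    show "(\<lambda>x. G x - F x) \<in> borel_measurable M" "(\<lambda>x. G' x - F x) \<in> borel_measurable M"
      using weak_gradient_sq(2)[OF assms(2)] weak_gradient_sq(2)[OF G'] weak_gradient_sq(2)[OF \<phi>(2)]
      by (auto intro!: borel_measurable_diff simp: sq_integrable_def)
    show "AE x in M. G x - F x = G' x - F x"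
      using weak_gradient_unique[OF D assms(2) G'] by auto
  qed
  then show ?thesis using \<phi> by (intro bexI[of _ \<phi>] exI[of _ F]) auto
qed

lemma X_I:
  assumes "weak_gradient D u G"
    and "\<And>e. e > 0 \<Longrightarrow> \<exists>\<phi>\<in>S. \<exists>F. weak_gradient D \<phi> F \<and> l2norm M (\<lambda>x. u x - \<phi> x) < e \<and> l2norm M (\<lambda>x. G x - F x) < e"
  shows "u \<in> X"
  unfolding X_def H1_closure_iff[OF D S_H1] using assms by blast

lemma S_sub_X: "S \<subseteq> X"
proof
  fix \<phi> assume \<phi>: "\<phi> \<in> S"
  then have w: "weak_gradient D \<phi> (wgrad D \<phi>)" using S_H1 by (auto simp: H1_wgrad)
  show "\<phi> \<in> X" by (rule X_I[OF w]) (rule bexI[OF _ \<phi>], rule exI[of _ "wgrad D \<phi>"], use w in \<open>simp add: l2norm_def\<close>)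
qed

lemma l2norm_lin_diff:
  fixes u :: "real^'n \<Rightarrow> 'b::euclidean_space"
  assumes "sq_integrable M u" "sq_integrable M v" "sq_integrable M u'" "sq_integrable M v'"
  shows "l2norm M (\<lambda>x. (a *\<^sub>R u x + b *\<^sub>R v x) - (a *\<^sub>R u' x + b *\<^sub>R v' x))
    \<le> \<bar>a\<bar> * l2norm M (\<lambda>x. u x - u' x) + \<bar>b\<bar> * l2norm M (\<lambda>x. v x - v' x)"
proof -
  have "(\<lambda>x. (a *\<^sub>R u x + b *\<^sub>R v x) - (a *\<^sub>R u' x + b *\<^sub>R v' x))
    = (\<lambda>x. a *\<^sub>R (u x - u' x) + b *\<^sub>R (v x - v' x))" by (simp add: algebra_simps)
  then show ?thesis
    using l2norm_triangle[OF sq_integrable_scale[OF sq_integrable_diff[OF assms(1,3)], of a]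
        sq_integrable_scale[OF sq_integrable_diff[OF assms(2,4)], of b]] by (simp add: l2norm_scale)
qed

lemma X_lin:
  assumes "u \<in> X" "v \<in> X" shows "(\<lambda>x. a * u x + b * v x) \<in> X"
proof -
  note w = X_weak_gradient[OF assms(1)] X_weak_gradient[OF assms(2)]
  show ?thesis
  proof (rule X_I[OF weak_gradient_lin[OF D w]])
    fix e :: real assume e: "e > 0"
    define \<eta> where "\<eta> = e / (\<bar>a\<bar> + \<bar>b\<bar> + 1)"
    have \<eta>0: "\<eta> > 0" using e by (simp add: \<eta>_def add_nonneg_pos)
    have "\<eta> * (\<bar>a\<bar> + \<bar>b\<bar> + 1) = e" unfolding \<eta>_def by simp
    then have \<eta>: "\<eta> > 0" "\<bar>a\<bar> * \<eta> + \<bar>b\<bar> * \<eta> < e" using \<eta>0 by (auto simp: algebra_simps)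
    obtain \<phi> F where \<phi>: "\<phi> \<in> S" "weak_gradient D \<phi> F" "l2norm M (\<lambda>x. u x - \<phi> x) < \<eta>" "l2norm M (\<lambda>x. wgrad D u x - F x) < \<eta>"
      using X_approx[OF assms(1) w(1) \<eta>(1)] by blast
    obtain \<psi> F' where \<psi>: "\<psi> \<in> S" "weak_gradient D \<psi> F'" "l2norm M (\<lambda>x. v x - \<psi> x) < \<eta>" "l2norm M (\<lambda>x. wgrad D v x - F' x) < \<eta>"
      using X_approx[OF assms(2) w(2) \<eta>(1)] by blast
    have m: "\<bar>a\<bar> * s + \<bar>b\<bar> * t < e" if "s < \<eta>" "t < \<eta>" for s t
    proof -
      have "\<bar>a\<bar> * s \<le> \<bar>a\<bar> * \<eta>" "\<bar>b\<bar> * t \<le> \<bar>b\<bar> * \<eta>" using that by (auto intro: mult_left_mono)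
      then show ?thesis using \<eta>(2) by linarith
    qed
    note sq = weak_gradient_sq[OF w(1)] weak_gradient_sq[OF w(2)] weak_gradient_sq[OF \<phi>(2)] weak_gradient_sq[OF \<psi>(2)]
    show "\<exists>\<phi>\<in>S. \<exists>F. weak_gradient D \<phi> F \<and> l2norm M (\<lambda>x. (a * u x + b * v x) - \<phi> x) < e \<and>
        l2norm M (\<lambda>x. (a *\<^sub>R wgrad D u x + b *\<^sub>R wgrad D v x) - F x) < e"
    proof (intro bexI exI conjI)
      show "weak_gradient D (\<lambda>x. a * \<phi> x + b * \<psi> x) (\<lambda>x. a *\<^sub>R F x + b *\<^sub>R F' x)"
        by (rule weak_gradient_lin[OF D \<phi>(2) \<psi>(2)])
      show "l2norm M (\<lambda>x. (a * u x + b * v x) - (a * \<phi> x + b * \<psi> x)) < e"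
        using l2norm_lin_diff[OF sq(1,3,5,7), of a b] m[OF \<phi>(3) \<psi>(3)] by simp
      show "l2norm M (\<lambda>x. (a *\<^sub>R wgrad D u x + b *\<^sub>R wgrad D v x) - (a *\<^sub>R F x + b *\<^sub>R F' x)) < e"
        using l2norm_lin_diff[OF sq(2,4,6,8), of a b] m[OF \<phi>(4) \<psi>(4)] by simp
    qed (rule S_lin[OF \<phi>(1) \<psi>(1)])
  qed
qed

lemma X_limit:
  assumes u: "\<And>k::nat. u k \<in> X" "\<And>k. weak_gradient D (u k) (G k)"
    and sq: "sq_integrable M v" "sq_integrable M F"
    and lim: "(\<lambda>k. l2norm M (\<lambda>x. u k x - v x)) \<longlonglongrightarrow> 0" "(\<lambda>k. l2norm M (\<lambda>x. G k x - F x)) \<longlonglongrightarrow> 0"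
  shows "v \<in> X" "weak_gradient D v F"
proof -
  show w: "weak_gradient D v F" by (rule weak_gradient_limit[OF D u(2) sq lim])
  show "v \<in> X"
  proof (rule X_I[OF w])
    fix e :: real assume "e > 0"
    then have e: "e / 2 > 0" by simp
    have "eventually (\<lambda>k. l2norm M (\<lambda>x. u k x - v x) < e / 2 \<and> l2norm M (\<lambda>x. G k x - F x) < e / 2) sequentially"
      by (intro eventually_conj order_tendstoD(2)[OF lim(1) e] order_tendstoD(2)[OF lim(2) e])
    then obtain k where k: "l2norm M (\<lambda>x. u k x - v x) < e / 2" "l2norm M (\<lambda>x. G k x - F x) < e / 2"
      by (auto simp: eventually_sequentially)
    obtain \<phi> F' where \<phi>: "\<phi> \<in> S" "weak_gradient D \<phi> F'" "l2norm M (\<lambda>x. u k x - \<phi> x) < e / 2" "l2norm M (\<lambda>x. G k x - F' x) < e / 2"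
      using X_approx[OF u(1) u(2) e] by blast
    note s = weak_gradient_sq[OF u(2), of k] weak_gradient_sq[OF \<phi>(2)]
    have "l2norm M (\<lambda>x. v x - \<phi> x) < e" "l2norm M (\<lambda>x. F x - F' x) < e"
      using l2norm_triangle_diff[OF sq(1) s(1) s(3)] l2norm_triangle_diff[OF sq(2) s(2) s(4)] k \<phi>(3,4)
        l2norm_minus_commute[of M "u k" v] l2norm_minus_commute[of M "G k" F] by auto
    then show "\<exists>\<phi>\<in>S. \<exists>F'. weak_gradient D \<phi> F' \<and> l2norm M (\<lambda>x. v x - \<phi> x) < e \<and> l2norm M (\<lambda>x. F x - F' x) < e"
      using \<phi> by blast
  qed
qed

definition mean :: "(real^'n \<Rightarrow> real) \<Rightarrow> real" where "mean u = \<kappa> * (LINT x|M. u x)"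

lemma mean_0: "\<kappa> = 0 \<Longrightarrow> mean u = 0" unfolding mean_def by simp

lemma mean_lin:
  assumes "sq_integrable M u" "sq_integrable M v"
  shows "mean (\<lambda>x. a * u x + b * v x) = a * mean u + b * mean v"
proof -
  have "integrable M u" "integrable M v"
    using sq_integrable_mult[OF assms(1) const_sq[of 1]] sq_integrable_mult[OF assms(2) const_sq[of 1]] by auto
  then show ?thesis by (simp add: mean_def algebra_simps)
qed

lemma Poincare:
  assumes u: "u \<in> X" "weak_gradient D u G"
  shows "l2norm M (\<lambda>x. u x - mean u) \<le> P * l2norm M G"
proof -
  define e where "e k = inverse (real (Suc k))" for k
  have e: "e k > 0" for k by (simp add: e_def)
  have e0: "e \<longlonglongrightarrow> 0" unfolding e_def by (rule LIMSEQ_inverse_real_of_nat)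
  note su = weak_gradient_sq[OF u(2)]
  define c1 where "c1 = l2norm M (\<lambda>_. 1::real)"
  have est: "l2norm M (\<lambda>x. u x - mean u) \<le> e k + \<bar>\<kappa>\<bar> * c1 * e k * c1 + \<bar>P\<bar> * (l2norm M G + e k)" for k
  proof -
    obtain \<phi> F where \<phi>: "\<phi> \<in> S" "weak_gradient D \<phi> F" "l2norm M (\<lambda>x. u x - \<phi> x) < e k"
      "l2norm M (\<lambda>x. G x - F x) < e k" using X_approx[OF u e] by blast
    note s\<phi> = weak_gradient_sq[OF \<phi>(2)]
    have d: "mean u - mean \<phi> = mean (\<lambda>x. u x - \<phi> x)"
      using mean_lin[OF su(1) s\<phi>(1), of 1 "- 1"] by simp
    have "\<bar>mean (\<lambda>x. u x - \<phi> x)\<bar> \<le> \<bar>\<kappa>\<bar> * (l2norm M (\<lambda>x. u x - \<phi> x) * c1)"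
      unfolding mean_def abs_mult
      using mult_integral_le[OF sq_integrable_diff[OF su(1) s\<phi>(1)] const_sq[of 1]] 
      by (intro mult_left_mono) (auto simp: c1_def)
    also have "\<dots> \<le> \<bar>\<kappa>\<bar> * (e k * c1)"
      using \<phi>(3) by (intro mult_left_mono mult_right_mono) (auto simp: c1_def)
    finally have m: "\<bar>mean u - mean \<phi>\<bar> \<le> \<bar>\<kappa>\<bar> * c1 * e k" unfolding d by (simp add: mult_ac)
    have "l2norm M (\<lambda>x. u x - mean u) \<le> l2norm M (\<lambda>x. u x - \<phi> x) + l2norm M (\<lambda>x. \<phi> x - mean u)"
      by (rule l2norm_triangle_diff[OF su(1) s\<phi>(1) const_sq])
    also have "l2norm M (\<lambda>x. \<phi> x - mean u) \<le> l2norm M (\<lambda>x. \<phi> x - mean \<phi>) + l2norm M (\<lambda>x. mean \<phi> - mean u)"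
      by (rule l2norm_triangle_diff[OF s\<phi>(1) const_sq const_sq])
    also have "l2norm M (\<lambda>x. mean \<phi> - mean u) = \<bar>mean u - mean \<phi>\<bar> * c1"
      using l2norm_scale[of M "mean \<phi> - mean u" "\<lambda>_. 1::real"] by (simp add: c1_def abs_minus_commute)
    also have "\<dots> \<le> (\<bar>\<kappa>\<bar> * c1 * e k) * c1" using m by (intro mult_right_mono) (auto simp: c1_def)
    also have "l2norm M (\<lambda>x. \<phi> x - mean \<phi>) \<le> \<bar>P\<bar> * (l2norm M G + e k)"
    proof -
      have "l2norm M (\<lambda>x. \<phi> x - mean \<phi>) \<le> P * l2norm M F"
        using Poincare_S[OF \<phi>(1) \<phi>(2)] by (simp add: mean_def)
      also have "\<dots> \<le> \<bar>P\<bar> * l2norm M F" by (intro mult_right_mono) auto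
      also have "l2norm M F \<le> l2norm M G + e k"
        using l2norm_triangle[OF su(2) sq_integrable_diff[OF s\<phi>(2) su(2)]] \<phi>(4)
          l2norm_minus_commute[of M G "F"] by simp
      finally show ?thesis by (simp add: mult_left_mono)
    qed
    finally show ?thesis using \<phi>(3) by linarith
  qed
  have "(\<lambda>k. e k + \<bar>\<kappa>\<bar> * c1 * e k * c1 + \<bar>P\<bar> * (l2norm M G + e k)) \<longlonglongrightarrow>
      0 + \<bar>\<kappa>\<bar> * c1 * 0 * c1 + \<bar>P\<bar> * (l2norm M G + 0)"
    by (intro tendsto_intros e0)
  then show ?thesis using est P_nonneg by (intro LIMSEQ_le_const) auto
qed

lemma mean_const: "\<kappa> \<noteq> 0 \<Longrightarrow> (\<lambda>_. mean u) \<in> X"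
  using S_const S_sub_X by blast

lemma equiv_eqv: "equiv X eqv"
proof (rule equivI)
  show "eqv \<subseteq> X \<times> X" by (auto simp: eqv_def)
  show "refl_on X eqv" by (auto simp: eqv_def refl_on_def intro!: exI[of _ 0])
  show "sym eqv"
  proof (rule symI)
    fix u v assume "(u, v) \<in> eqv"
    then obtain c where c: "u \<in> X" "v \<in> X" "\<kappa> = 0 \<longrightarrow> c = 0" "AE x in M. u x = v x + c" by (auto simp: eqv_def)
    from c(4) have "AE x in M. v x = u x + - c" by eventually_elim simp
    then show "(v, u) \<in> eqv" using c(1-3) by (auto simp: eqv_def intro!: exI[of _ "- c"])
  qed
  show "trans eqv"
  proof (rule transI)
    fix u v w assume "(u, v) \<in> eqv" "(v, w) \<in> eqv"
    then obtain c d where c: "u \<in> X" "\<kappa> = 0 \<longrightarrow> c = 0" "AE x in M. u x = v x + c"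
      and d: "w \<in> X" "\<kappa> = 0 \<longrightarrow> d = 0" "AE x in M. v x = w x + d" by (auto simp: eqv_def)
    from c(3) d(3) have "AE x in M. u x = w x + (c + d)" by eventually_elim simp
    then show "(u, w) \<in> eqv" using c d by (auto simp: eqv_def intro!: exI[of _ "c + d"])
  qed
qed

definition cls :: "(real^'n \<Rightarrow> real) \<Rightarrow> (real^'n \<Rightarrow> real) set" where "cls u = eqv `` {u}"

definition rep :: "(real^'n \<Rightarrow> real) set \<Rightarrow> real^'n \<Rightarrow> real" where "rep U = (SOME u. u \<in> U)"

lemma cls_H: "u \<in> X \<Longrightarrow> cls u \<in> H" by (simp add: cls_def H_def quotientI)

lemma cls_self: "u \<in> X \<Longrightarrow> u \<in> cls u" using equiv_class_self[OF equiv_eqv] by (simp add: cls_def)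

lemma H_sub_X: "U \<in> H \<Longrightarrow> u \<in> U \<Longrightarrow> u \<in> X"
  by (auto simp: H_def quotient_def eqv_def)

lemma rep_in:
  assumes "U \<in> H" shows "rep U \<in> U"
proof -
  have "U \<noteq> {}" using in_quotient_imp_non_empty[OF equiv_eqv] assms by (simp add: H_def)
  then show ?thesis unfolding rep_def by (simp add: some_in_eq)
qed

lemma rep_X: "U \<in> H \<Longrightarrow> rep U \<in> X" using H_sub_X rep_in by blast

lemma H_cls:
  assumes "U \<in> H" "u \<in> U" shows "U = cls u"
proof -
  obtain x where x: "U = eqv `` {x}" using assms(1) by (auto simp: H_def elim: quotientE)
  then have "(x, u) \<in> eqv" using assms(2) by simp
  then show ?thesis unfolding x cls_def by (rule equiv_class_eq[OF equiv_eqv])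
qed

lemma eqv_weak_gradient:
  assumes "(u, v) \<in> eqv" "weak_gradient D u G" shows "weak_gradient D v G"
proof -
  obtain c where c: "v \<in> X" "AE x in M. u x = v x + c" using assms(1) by (auto simp: eqv_def)
  have w: "weak_gradient D (\<lambda>x. u x - c) G"
    using weak_gradient_diff[OF D assms(2) const_weak_gradient[of c]] by simp
  show ?thesis
    by (rule weak_gradient_cong[OF D w weak_gradient_sq(1)[OF X_weak_gradient[OF c(1)]]])
      (use c(2) in eventually_elim, simp)
qed

lemma class_grad:
  assumes "U \<in> H" "u \<in> U" shows "weak_gradient D u (class_grad D U)"
proof (rule eqv_weak_gradient)
  show "(rep U, u) \<in> eqv"
    using rep_in[OF assms(1)] assms quotient_eq_iff[OF equiv_eqv, of U U "rep U" u] by (simp add: H_def)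
  show "weak_gradient D (rep U) (class_grad D U)"
    unfolding class_grad_def rep_def[symmetric] using X_weak_gradient[OF rep_X[OF assms(1)]] .
qed

lemma grad_form_eq:
  assumes U: "U \<in> H" "u \<in> U" "weak_gradient D u G" and V: "V \<in> H" "v \<in> V" "weak_gradient D v F"
    and A: "A \<in> sets lebesgue" "A \<subseteq> D"
  shows "grad_form D A U V = (LINT x|lebesgue_on A. G x \<bullet> F x)"
  unfolding grad_form_def
proof (rule integral_cong_AE)
  note c = class_grad[OF U(1,2)] class_grad[OF V(1,2)]
  have sq: "sq_integrable (lebesgue_on A) G" "sq_integrable (lebesgue_on A) F"
    "sq_integrable (lebesgue_on A) (class_grad D U)" "sq_integrable (lebesgue_on A) (class_grad D V)"
    by (intro sq_integrable_subset(1)[OF A(1) D_lebesgue A(2)] weak_gradient_sq(2)[OF c(1)]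
        weak_gradient_sq(2)[OF c(2)] weak_gradient_sq(2)[OF U(3)] weak_gradient_sq(2)[OF V(3)])+
  show "(\<lambda>x. class_grad D U x \<bullet> class_grad D V x) \<in> borel_measurable (lebesgue_on A)"
    "(\<lambda>x. G x \<bullet> F x) \<in> borel_measurable (lebesgue_on A)"
    using sq_integrable_inner[OF sq(1,2)] sq_integrable_inner[OF sq(3,4)] by auto
  have "AE x in M. class_grad D U x = G x" "AE x in M. class_grad D V x = F x"
    using weak_gradient_unique[OF D c(1) U(3)] weak_gradient_unique[OF D c(2) V(3)] by auto
  then have "AE x in M. class_grad D U x \<bullet> class_grad D V x = G x \<bullet> F x" by eventually_elim simp
  then show "AE x in lebesgue_on A. class_grad D U x \<bullet> class_grad D V x = G x \<bullet> F x"
    by (rule AE_lebesgue_on_subset[OF A(1) D_lebesgue A(2)])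
qed

definition lin :: "real \<Rightarrow> (real^'n \<Rightarrow> real) set \<Rightarrow> real \<Rightarrow> (real^'n \<Rightarrow> real) set \<Rightarrow> (real^'n \<Rightarrow> real) set" where
  "lin a U b V = cls (\<lambda>x. a * rep U x + b * rep V x)"

lemma lin_H: "U \<in> H \<Longrightarrow> V \<in> H \<Longrightarrow> lin a U b V \<in> H"
  unfolding lin_def by (intro cls_H X_lin rep_X)

lemma lin_weak_gradient:
  assumes "U \<in> H" "V \<in> H"
  shows "(\<lambda>x. a * rep U x + b * rep V x) \<in> lin a U b V"
    "weak_gradient D (\<lambda>x. a * rep U x + b * rep V x) (\<lambda>x. a *\<^sub>R class_grad D U x + b *\<^sub>R class_grad D V x)"
  using assms by (auto simp: lin_def intro!: cls_self X_lin rep_X weak_gradient_lin[OF D] class_grad rep_in)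

lemma grad_form_lin:
  assumes U: "U \<in> H" "V \<in> H" "W \<in> H" and A: "A \<in> sets lebesgue" "A \<subseteq> D"
  shows "grad_form D A (lin a U b V) W = a * grad_form D A U W + b * grad_form D A V W"
proof -
  note sq = sq_integrable_subset(1)[OF A(1) D_lebesgue A(2) weak_gradient_sq(2)[OF class_grad[OF U(1) rep_in[OF U(1)]]]]
    sq_integrable_subset(1)[OF A(1) D_lebesgue A(2) weak_gradient_sq(2)[OF class_grad[OF U(2) rep_in[OF U(2)]]]]
    sq_integrable_subset(1)[OF A(1) D_lebesgue A(2) weak_gradient_sq(2)[OF class_grad[OF U(3) rep_in[OF U(3)]]]]
  have "grad_form D A (lin a U b V) W
      = (LINT x|lebesgue_on A. (a *\<^sub>R class_grad D U x + b *\<^sub>R class_grad D V x) \<bullet> class_grad D W x)"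
    by (rule grad_form_eq[OF lin_H[OF U(1,2)] lin_weak_gradient[OF U(1,2)] U(3) rep_in[OF U(3)]
          class_grad[OF U(3) rep_in[OF U(3)]] A])
  then show ?thesis
    using sq_integrable_inner[OF sq(1,3)] sq_integrable_inner[OF sq(2,3)]
    by (simp add: grad_form_def inner_add_left)
qed

lemma grad_form_sq:
  assumes "U \<in> H" "u \<in> U" "weak_gradient D u G"
  shows "grad_form D D U U = (l2norm M G)\<^sup>2"
  using grad_form_eq[OF assms assms D_lebesgue] by (simp add: l2norm_sq power2_norm_eq_inner)

lemma lin_diff_sq:
  assumes U: "U \<in> H" "u \<in> U" "weak_gradient D u G" and V: "V \<in> H" "v \<in> V" "weak_gradient D v F"
  shows "grad_form D D (lin 1 U (- 1) V) (lin 1 U (- 1) V) = (l2norm M (\<lambda>x. G x - F x))\<^sup>2"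
proof -
  have "grad_form D D (lin 1 U (- 1) V) (lin 1 U (- 1) V)
    = (l2norm M (\<lambda>x. 1 *\<^sub>R class_grad D U x + (- 1) *\<^sub>R class_grad D V x))\<^sup>2"
    by (rule grad_form_sq[OF lin_H[OF U(1) V(1)] lin_weak_gradient[OF U(1) V(1)]])
  also have "l2norm M (\<lambda>x. 1 *\<^sub>R class_grad D U x + (- 1) *\<^sub>R class_grad D V x) = l2norm M (\<lambda>x. G x - F x)"
  proof (rule l2norm_cong_AE)
    note c = class_grad[OF U(1,2)] class_grad[OF V(1,2)]
    note sq = weak_gradient_sq(2)[OF c(1)] weak_gradient_sq(2)[OF c(2)] weak_gradient_sq(2)[OF U(3)] weak_gradient_sq(2)[OF V(3)]
    show "(\<lambda>x. 1 *\<^sub>R class_grad D U x + (- 1) *\<^sub>R class_grad D V x) \<in> borel_measurable M" "(\<lambda>x. G x - F x) \<in> borel_measurable M"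
      using sq_integrable_lin[OF sq(1,2), of 1 "- 1"] sq_integrable_diff[OF sq(3,4)] by (auto simp: sq_integrable_def)
    have "AE x in M. class_grad D U x = G x" "AE x in M. class_grad D V x = F x"
      using weak_gradient_unique[OF D c(1) U(3)] weak_gradient_unique[OF D c(2) V(3)] by auto
    then show "AE x in M. 1 *\<^sub>R class_grad D U x + (- 1) *\<^sub>R class_grad D V x = G x - F x" by eventually_elim simp
  qed
  finally show ?thesis .
qed

lemma zero_gradient_eqv:
  assumes u: "u \<in> X" "v \<in> X" and w: "weak_gradient D u G" "weak_gradient D v F"
    and z: "l2norm M (\<lambda>x. G x - F x) = 0"
  shows "(u, v) \<in> eqv"
proof -
  have d: "(\<lambda>x. u x - v x) \<in> X" using X_lin[OF u, of 1 "- 1"] by simp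
  define c where "c = mean (\<lambda>x. u x - v x)"
  have "l2norm M (\<lambda>x. (u x - v x) - c) \<le> 0"
    using Poincare[OF d weak_gradient_diff[OF D w]] z by (simp add: c_def)
  then have "l2norm M (\<lambda>x. (u x - v x) - c) = 0" using l2norm_nonneg[of M "\<lambda>x. (u x - v x) - c"] by linarith
  then have "AE x in M. (u x - v x) - c = 0"
    by (intro l2norm_eq_0_AE sq_integrable_diff const_sq weak_gradient_sq(1)[OF w(1)] weak_gradient_sq(1)[OF w(2)])
  then have "AE x in M. u x = v x + c" by eventually_elim simp
  moreover have "\<kappa> = 0 \<longrightarrow> c = 0" unfolding c_def using mean_0 by blast
  ultimately have "\<exists>c. (\<kappa> = 0 \<longrightarrow> c = 0) \<and> (AE x in M. u x = v x + c)" by blast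
  then show ?thesis unfolding eqv_def mem_Collect_eq prod.case using u by (intro conjI)
qed

sublocale hilbert_carrier H lin "grad_form D D"
proof
  show "lin a U b V \<in> H" if "U \<in> H" "V \<in> H" for U V a b using that by (rule lin_H)
  show "grad_form D D (lin a U b V) W = a * grad_form D D U W + b * grad_form D D V W"
    if "U \<in> H" "V \<in> H" "W \<in> H" for U V W a b by (rule grad_form_lin[OF that D_lebesgue]) simp
  show "grad_form D D U V = grad_form D D V U" for U V by (simp add: grad_form_def inner_commute)
  show "grad_form D D U U \<ge> 0" for U by (simp add: grad_form_def)
  show "U = V" if UV: "U \<in> H" "V \<in> H" "grad_form D D (lin 1 U (- 1) V) (lin 1 U (- 1) V) = 0" for U V
  proof -
    note r = rep_in[OF UV(1)] rep_in[OF UV(2)]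
    have "l2norm M (\<lambda>x. class_grad D U x - class_grad D V x) = 0"
      using UV(3) lin_diff_sq[OF UV(1) r(1) class_grad[OF UV(1) r(1)] UV(2) r(2) class_grad[OF UV(2) r(2)]] by simp
    then have "(rep U, rep V) \<in> eqv"
      by (rule zero_gradient_eqv[OF rep_X[OF UV(1)] rep_X[OF UV(2)] class_grad[OF UV(1) r(1)] class_grad[OF UV(2) r(2)]])
    then show "U = V"
      using quotient_eq_iff[OF equiv_eqv, of U V "rep U" "rep V"] UV r by (simp add: H_def)
  qed
  show "H \<noteq> {}" using S_nonempty S_sub_X cls_H by blast
  fix U :: "nat \<Rightarrow> (real^'n \<Rightarrow> real) set"
  assume U: "\<And>k. U k \<in> H"
    and Cauchy: "\<And>e. e > 0 \<Longrightarrow> \<exists>N. \<forall>m\<ge>N. \<forall>n\<ge>N. grad_form D D (lin 1 (U m) (- 1) (U n)) (lin 1 (U m) (- 1) (U n)) < e"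
  define G where "G k = class_grad D (U k)" for k
  define u where "u k x = rep (U k) x - mean (rep (U k))" for k x
  have wr: "weak_gradient D (rep (U k)) (G k)" for k unfolding G_def by (rule class_grad[OF U rep_in[OF U]])
  have uX: "u k \<in> X" for k
  proof (cases "\<kappa> = 0")
    case True
    then have "u k = rep (U k)" unfolding u_def[abs_def] mean_0[OF True] by simp
    then show ?thesis using rep_X[OF U] by simp
  next
    case False
    have "(\<lambda>x. 1 * rep (U k) x + (- 1) * mean (rep (U k))) \<in> X"
      by (rule X_lin[OF rep_X[OF U] mean_const[OF False]])
    then show ?thesis by (simp add: u_def[abs_def])
  qed
  have wu: "weak_gradient D (u k) (G k)" for k
    using weak_gradient_diff[OF D wr const_weak_gradient] by (simp add: u_def[abs_def])
  have uU: "u k \<in> U k" for k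
  proof -
    have "(rep (U k), u k) \<in> eqv" by (rule zero_gradient_eqv[OF rep_X[OF U] uX wr wu]) (simp add: l2norm_def)
    then have "u k \<in> cls (rep (U k))" by (simp add: cls_def)
    then show ?thesis using H_cls[OF U rep_in[OF U], of k] by blast
  qed
  note su = weak_gradient_sq(1)[OF wu] and sG = weak_gradient_sq(2)[OF wu]
  have dG: "grad_form D D (lin 1 (U m) (- 1) (U n)) (lin 1 (U m) (- 1) (U n)) = (l2norm M (\<lambda>x. G m x - G n x))\<^sup>2" for m n
    by (rule lin_diff_sq[OF U uU wu U uU wu])
  have CG: "\<exists>N. \<forall>m\<ge>N. \<forall>n\<ge>N. l2norm M (\<lambda>x. G m x - G n x) < e" if e: "e > 0" for e
  proof -
    obtain N where N: "\<forall>m\<ge>N. \<forall>n\<ge>N. (l2norm M (\<lambda>x. G m x - G n x))\<^sup>2 < e\<^sup>2"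
      using Cauchy[of "e\<^sup>2"] e unfolding dG by auto
    then show ?thesis using e by (meson less_imp_le power2_less_imp_less)
  qed
  have du: "l2norm M (\<lambda>x. u m x - u n x) \<le> P * l2norm M (\<lambda>x. G m x - G n x)" for m n
  proof -
    have X: "(\<lambda>x. rep (U m) x - rep (U n) x) \<in> X" using X_lin[OF rep_X[OF U[of m]] rep_X[OF U[of n]], of 1 "- 1"] by simp
    have "mean (\<lambda>x. rep (U m) x - rep (U n) x) = mean (rep (U m)) - mean (rep (U n))"
      using mean_lin[OF weak_gradient_sq(1)[OF wr[of m]] weak_gradient_sq(1)[OF wr[of n]], of 1 "- 1"] by simp
    then have "(\<lambda>x. u m x - u n x) = (\<lambda>x. (rep (U m) x - rep (U n) x) - mean (\<lambda>x. rep (U m) x - rep (U n) x))"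
      by (simp add: u_def fun_eq_iff)
    then show ?thesis using Poincare[OF X weak_gradient_diff[OF D wr wr]] by simp
  qed
  have Cu: "\<exists>N. \<forall>m\<ge>N. \<forall>n\<ge>N. l2norm M (\<lambda>x. u m x - u n x) < e" if e: "e > 0" for e
  proof -
    have e': "e / (P + 1) > 0" using e P_nonneg by simp
    obtain N where N: "\<And>m n. m \<ge> N \<Longrightarrow> n \<ge> N \<Longrightarrow> l2norm M (\<lambda>x. G m x - G n x) < e / (P + 1)" using CG[OF e'] by blast
    have "l2norm M (\<lambda>x. u m x - u n x) < e" if "m \<ge> N" "n \<ge> N" for m n
    proof -
      have "P * l2norm M (\<lambda>x. G m x - G n x) \<le> P * (e / (P + 1))"
        using N[OF that] P_nonneg by (intro mult_left_mono) auto
      also have "\<dots> < e" using e P_nonneg by (simp add: field_simps)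
      finally show ?thesis using du[of m n] by linarith
    qed
    then show ?thesis by blast
  qed
  obtain F where F: "sq_integrable M F" "(\<lambda>k. l2norm M (\<lambda>x. G k x - F x)) \<longlonglongrightarrow> 0"
    using L2_complete[OF sG CG] by blast
  obtain v where v: "sq_integrable M v" "(\<lambda>k. l2norm M (\<lambda>x. u k x - v x)) \<longlonglongrightarrow> 0"
    using L2_complete[OF su Cu] by blast
  note vX = X_limit[OF uX wu v(1) F(1) v(2) F(2)]
  have "grad_form D D (lin 1 (U k) (- 1) (cls v)) (lin 1 (U k) (- 1) (cls v)) = (l2norm M (\<lambda>x. G k x - F x))\<^sup>2" for k
    by (rule lin_diff_sq[OF U uU wu cls_H[OF vX(1)] cls_self[OF vX(1)] vX(2)])
  moreover have "(\<lambda>k. (l2norm M (\<lambda>x. G k x - F x))\<^sup>2) \<longlonglongrightarrow> 0" using tendsto_power[OF F(2), of 2] by simp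
  ultimately have "(\<lambda>k. grad_form D D (lin 1 (U k) (- 1) (cls v)) (lin 1 (U k) (- 1) (cls v))) \<longlonglongrightarrow> 0" by presburger
  then show "\<exists>L\<in>H. (\<lambda>k. grad_form D D (lin 1 (U k) (- 1) L) (lin 1 (U k) (- 1) L)) \<longlonglongrightarrow> 0"
    by (rule bexI[OF _ cls_H[OF vX(1)]])
qed

lemma nrm_grad_norm: "nrm = grad_norm D"
  by (simp add: fun_eq_iff nrm_def grad_norm_def)

lemma nrm_eq: "U \<in> H \<Longrightarrow> u \<in> U \<Longrightarrow> weak_gradient D u G \<Longrightarrow> nrm U = l2norm M G"
  by (simp add: nrm_def grad_form_sq)

definition T :: "(real^'n) set \<Rightarrow> (real^'n \<Rightarrow> real) set \<Rightarrow> (real^'n \<Rightarrow> real) set" where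
  "T A U = (THE W. W \<in> H \<and> (\<forall>V\<in>H. grad_form D D W V = grad_form D A U V))"

context
  fixes A assumes A: "A \<in> sets lebesgue" "A \<subseteq> D"
begin

lemma grad_form_bound:
  assumes "U \<in> H" "V \<in> H" shows "\<bar>grad_form D A U V\<bar> \<le> nrm U * nrm V"
proof -
  note c = class_grad[OF assms(1) rep_in[OF assms(1)]] class_grad[OF assms(2) rep_in[OF assms(2)]]
  note s = sq_integrable_subset[OF A(1) D_lebesgue A(2) weak_gradient_sq(2)[OF c(1)]]
    sq_integrable_subset[OF A(1) D_lebesgue A(2) weak_gradient_sq(2)[OF c(2)]]
  have "\<bar>grad_form D A U V\<bar> \<le> l2norm (lebesgue_on A) (class_grad D U) * l2norm (lebesgue_on A) (class_grad D V)"
    unfolding grad_form_def by (rule inner_integral_le[OF s(1) s(3)])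
  also have "\<dots> \<le> nrm U * nrm V"
    unfolding nrm_eq[OF assms(1) rep_in[OF assms(1)] c(1)] nrm_eq[OF assms(2) rep_in[OF assms(2)] c(2)]
    by (intro mult_mono s) auto
  finally show ?thesis .
qed

lemma T_char:
  assumes U: "U \<in> H"
  shows "T A U \<in> H" "V \<in> H \<Longrightarrow> grad_form D D (T A U) V = grad_form D A U V"
proof -
  have "\<exists>W\<in>H. \<forall>V\<in>H. grad_form D D W V = grad_form D A U V"
  proof (rule Riesz[OF ip_bilinear_form, of 1])
    show "\<bar>grad_form D D U V\<bar> \<le> 1 * (nrm U * nrm V)" if "U \<in> H" "V \<in> H" for U V using ip_le_nrm[OF that] by simp
    show "grad_form D A U (lin a V c W) = a * grad_form D A U V + c * grad_form D A U W" if "V \<in> H" "W \<in> H" for V W a c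
      using grad_form_lin[OF that U A] by (simp add: grad_form_def inner_commute)
    show "\<bar>grad_form D A U V\<bar> \<le> nrm U * nrm V" if "V \<in> H" for V by (rule grad_form_bound[OF U that])
  qed auto
  then obtain W where W: "W \<in> H" "\<forall>V\<in>H. grad_form D D W V = grad_form D A U V" by blast
  have "T A U = W" unfolding T_def
  proof (rule the_equality)
    show "W' = W" if "W' \<in> H \<and> (\<forall>V\<in>H. grad_form D D W' V = grad_form D A U V)" for W'
      using that W by (intro eqI_ip) auto
  qed (use W in blast)
  then show "T A U \<in> H" "V \<in> H \<Longrightarrow> grad_form D D (T A U) V = grad_form D A U V" using W by auto
qed

lemma T_symmetric: "symmetric_op 1 (T A)"
  unfolding symmetric_op_def
proof (intro conjI ballI)
  fix U assume U: "U \<in> H"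
  show TU: "T A U \<in> H" by (rule T_char[OF U])
  have "nrm (T A U) * nrm (T A U) \<le> nrm U * nrm (T A U)"
    using grad_form_bound[OF U TU] T_char(2)[OF U TU] nrm_sq[OF TU] by (simp add: power2_eq_square)
  then show "nrm (T A U) \<le> 1 * nrm U" using nrm_nonneg[OF TU] nrm_nonneg[OF U]
    by (cases "nrm (T A U) = 0") auto
  fix V assume V: "V \<in> H"
  show "grad_form D D (T A U) V = grad_form D D U (T A V)"
    using T_char[OF U] T_char[OF V] U V ip_sym by (simp add: grad_form_def inner_commute)
qed simp

lemma op_minus_scalar_eq:
  assumes U: "U \<in> H" shows "op_minus_scalar (T A) \<mu> U = lin 1 (T A U) (- \<mu>) U"
proof -
  let ?W = "T A U"
  have W: "?W \<in> H" by (rule T_char[OF U])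
  note r = rep_X[OF W] rep_X[OF U]
  have cl: "(\<lambda>x. rep ?W x + - \<mu> * rep U x) \<in> X" using X_lin[OF r, of 1 "- \<mu>"] by simp
  have UW: "U = cls (rep U)" "?W = cls (rep ?W)" using H_cls[OF U rep_in[OF U]] H_cls[OF W rep_in[OF W]] by auto
  show ?thesis
  proof (intro set_eqI iffI)
    fix f assume "f \<in> op_minus_scalar (T A) \<mu> U"
    then obtain w u where f: "f = (\<lambda>x. w x - \<mu> * u x)" and wu: "w \<in> ?W" "u \<in> U" by (auto simp: op_minus_scalar_def)
    have "(rep ?W, w) \<in> eqv" "(rep U, u) \<in> eqv"
      using wu UW unfolding cls_def by (metis Image_singleton_iff)+
    then obtain c d where c: "w \<in> X" "\<kappa> = 0 \<longrightarrow> c = 0" "AE x in M. rep ?W x = w x + c"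
      and d: "u \<in> X" "\<kappa> = 0 \<longrightarrow> d = 0" "AE x in M. rep U x = u x + d" by (auto simp: eqv_def)
    have "AE x in M. rep ?W x + - \<mu> * rep U x = (w x - \<mu> * u x) + (c - \<mu> * d)"
      using c(3) d(3) by eventually_elim (simp add: algebra_simps)
    moreover have "(\<lambda>x. w x - \<mu> * u x) \<in> X" using X_lin[OF c(1) d(1), of 1 "- \<mu>"] by simp
    ultimately have "(\<lambda>x. rep ?W x + - \<mu> * rep U x, f) \<in> eqv"
      unfolding f eqv_def using cl c(2) d(2) by (auto intro!: exI[of _ "c - \<mu> * d"])
    then show "f \<in> lin 1 ?W (- \<mu>) U" by (simp add: lin_def cls_def)
  next
    fix f assume "f \<in> lin 1 ?W (- \<mu>) U"
    then have "(\<lambda>x. rep ?W x + - \<mu> * rep U x, f) \<in> eqv" by (simp add: lin_def cls_def)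
    then obtain c where c: "f \<in> X" "\<kappa> = 0 \<longrightarrow> c = 0" "AE x in M. rep ?W x + - \<mu> * rep U x = f x + c"
      by (auto simp: eqv_def)
    define w where "w x = f x + \<mu> * rep U x" for x
    have "w \<in> X" using X_lin[OF c(1) r(2), of 1 \<mu>] by (simp add: w_def[abs_def])
    moreover have "AE x in M. rep ?W x = w x + c" using c(3) by eventually_elim (simp add: w_def)
    ultimately have "(rep ?W, w) \<in> eqv" using r(1) c(2) by (auto simp: eqv_def)
    then have "w \<in> ?W" using UW(2) unfolding cls_def by (metis Image_singleton_iff)
    moreover have "f = (\<lambda>x. w x - \<mu> * rep U x)" by (simp add: w_def fun_eq_iff)
    ultimately show "f \<in> op_minus_scalar (T A) \<mu> U"
      using rep_in[OF U] by (auto simp: op_minus_scalar_def)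
  qed
qed

lemma spectrum_iff:
  "\<mu> \<in> spectrum H (grad_norm D) (T A) \<longleftrightarrow>
    \<not> (\<exists>C. \<forall>U\<in>H. nrm U \<le> C * nrm (lin 1 (T A U) (- \<mu>) U))"
proof -
  have "bij_betw (op_minus_scalar (T A) \<mu>) H H \<longleftrightarrow> bij_betw (\<lambda>U. lin 1 (T A U) (- \<mu>) U) H H"
    by (rule bij_betw_cong) (rule op_minus_scalar_eq)
  then show ?thesis
    using bounded_below_imp_bij[OF symmetric_op_shift[OF T_symmetric]]
    by (auto simp: spectrum_def nrm_grad_norm[symmetric] op_minus_scalar_eq)
qed

lemma S_dense:
  assumes "U \<in> H" "e > 0" shows "\<exists>W\<in>cls ` S. nrm (lin 1 U (- 1) W) < e"
proof -
  note c = class_grad[OF assms(1) rep_in[OF assms(1)]]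
  obtain \<phi> F where \<phi>: "\<phi> \<in> S" "weak_gradient D \<phi> F" "l2norm M (\<lambda>x. class_grad D U x - F x) < e"
    using X_approx[OF rep_X[OF assms(1)] c assms(2)] by blast
  have \<phi>X: "\<phi> \<in> X" using \<phi> S_sub_X by blast
  have "nrm (lin 1 U (- 1) (cls \<phi>)) = l2norm M (\<lambda>x. class_grad D U x - F x)"
    using lin_diff_sq[OF assms(1) rep_in[OF assms(1)] c cls_H[OF \<phi>X] cls_self[OF \<phi>X] \<phi>(2)]
    by (simp add: nrm_def)
  then show ?thesis using \<phi> by (intro bexI[of _ "cls \<phi>"]) auto
qed

lemma spectrum_quasimode:
  assumes \<mu>: "\<mu> \<in> spectrum H (grad_norm D) (T A)" and \<delta>: "\<delta> > 0"
  shows "\<exists>\<phi>\<in>S. \<exists>G. \<exists>r\<in>X. \<exists>R. weak_gradient D \<phi> G \<and> weak_gradient D r R \<and> l2norm M G > 0 \<and>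
    l2norm M R \<le> \<delta> * l2norm M G \<and>
    (\<forall>v\<in>X. \<forall>F. weak_gradient D v F \<longrightarrow>
      (LINT x|lebesgue_on A. G x \<bullet> F x) - \<mu> * (LINT x|M. G x \<bullet> F x) = (LINT x|M. R x \<bullet> F x))"
proof -
  let ?D = "\<lambda>U. lin 1 (T A U) (- \<mu>) U"
  have Dsym: "symmetric_op (1 + \<bar>\<mu>\<bar>) ?D" by (rule symmetric_op_shift[OF T_symmetric])
  have DH: "?D U \<in> H" if "U \<in> H" for U using that by (intro lin_closed T_char)
  obtain U where U: "U \<in> H" "nrm U > (1 / \<delta>) * nrm (?D U)"
    using \<mu>[unfolded spectrum_iff] by (meson not_le)
  have gap: "\<delta> * nrm U - nrm (?D U) > 0" using U(2) \<delta> by (simp add: field_simps)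
  have nU: "nrm U > 0" using U(2) nrm_nonneg[OF DH[OF U(1)]] \<delta>
    by (smt (verit) divide_nonneg_nonneg mult_nonneg_nonneg)
  define m where "m = 1 + \<bar>\<mu>\<bar> + \<delta>"
  have m: "m > 0" using \<delta> by (simp add: m_def)
  define \<eta> where "\<eta> = min (nrm U) ((\<delta> * nrm U - nrm (?D U)) / m)"
  have \<eta>: "\<eta> > 0" using gap nU m by (simp add: \<eta>_def)
  obtain \<phi> where \<phi>: "\<phi> \<in> S" "nrm (lin 1 U (- 1) (cls \<phi>)) < \<eta>" using S_dense[OF U(1) \<eta>] by blast
  have \<phi>X: "\<phi> \<in> X" using \<phi> S_sub_X by blast
  let ?V = "cls \<phi>"
  let ?E = "lin 1 U (- 1) ?V"
  have V: "?V \<in> H" "\<phi> \<in> ?V" using \<phi>X cls_H cls_self by auto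
  have E: "?E \<in> H" using U V lin_closed by auto
  have nE: "nrm (?D ?E) \<le> (1 + \<bar>\<mu>\<bar>) * nrm ?E" using Dsym E by (auto simp: symmetric_op_def)
  have nV: "nrm ?V \<ge> nrm U - nrm ?E" using nrm_triangle_lin(2)[OF U(1) V(1)] by simp
  have "?D ?E = lin 1 (?D U) (- 1) (?D ?V)" by (rule symmetric_op_lin[OF Dsym U(1) V(1)])
  then have "nrm (?D ?V) \<le> nrm (?D U) + nrm (?D ?E)"
    using nrm_triangle_lin(1)[OF DH[OF U(1)] DH[OF V(1)]] by simp
  then have DV: "nrm (?D ?V) \<le> nrm (?D U) + (1 + \<bar>\<mu>\<bar>) * nrm ?E" using nE by linarith
  have "nrm ?E * m \<le> \<delta> * nrm U - nrm (?D U)"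
  proof -
    have "nrm ?E \<le> (\<delta> * nrm U - nrm (?D U)) / m" using \<phi>(2) by (simp add: \<eta>_def)
    then show ?thesis using m by (simp add: field_simps)
  qed
  then have "nrm (?D U) + (1 + \<bar>\<mu>\<bar>) * nrm ?E \<le> \<delta> * (nrm U - nrm ?E)" by (simp add: m_def algebra_simps)
  also have "\<dots> \<le> \<delta> * nrm ?V" using nV \<delta> by (intro mult_left_mono) auto
  finally have small: "nrm (?D ?V) \<le> \<delta> * nrm ?V" using DV by linarith
  have pos: "nrm ?V > 0" using nV \<phi>(2) by (simp add: \<eta>_def)
  let ?W = "?D ?V"
  let ?r = "rep ?W"
  note W = DH[OF V(1)] rep_in[OF DH[OF V(1)]]
  note G = class_grad[OF V] and R = class_grad[OF W]
  show ?thesis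
  proof (rule bexI[OF _ \<phi>(1)], rule exI, rule bexI[OF _ rep_X[OF W(1)]], rule exI, intro conjI ballI allI impI)
    show "weak_gradient D \<phi> (class_grad D ?V)" "weak_gradient D ?r (class_grad D ?W)" using G R by auto
    show "l2norm M (class_grad D ?V) > 0" "l2norm M (class_grad D ?W) \<le> \<delta> * l2norm M (class_grad D ?V)"
      using pos small nrm_eq[OF V G] nrm_eq[OF W R] by auto
    fix v F assume v: "v \<in> X" "weak_gradient D v F"
    note vc = cls_H[OF v(1)] cls_self[OF v(1)] v(2)
    have "grad_form D D ?W (cls v) = grad_form D A ?V (cls v) - \<mu> * grad_form D D ?V (cls v)"
      using ip_lin[OF T_char(1)[OF V(1)] V(1) vc(1), of 1 "- \<mu>"] T_char(2)[OF V(1) vc(1)] by simp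
    then show "(LINT x|lebesgue_on A. class_grad D ?V x \<bullet> F x) - \<mu> * (LINT x|M. class_grad D ?V x \<bullet> F x)
        = (LINT x|M. class_grad D ?W x \<bullet> F x)"
      using grad_form_eq[OF V G vc A] grad_form_eq[OF V G vc D_lebesgue] grad_form_eq[OF W R vc D_lebesgue] by simp
  qed
qed

lemma quasimode_spectrum:
  assumes v: "v \<in> X" "weak_gradient D v G" "l2norm M G > 0" and c: "c \<ge> 0"
    and small: "\<And>w. w \<in> S \<Longrightarrow> \<exists>F. weak_gradient D w F \<and>
      \<bar>(LINT x|lebesgue_on A. G x \<bullet> F x) - \<mu> * (LINT x|M. G x \<bullet> F x)\<bar> \<le> c * l2norm M G * l2norm M F"
  shows "\<exists>\<nu>\<in>spectrum H (grad_norm D) (T A). \<bar>\<nu> - \<mu>\<bar> \<le> c"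
proof -
  let ?V = "cls v"
  have V: "?V \<in> H" "v \<in> ?V" using v cls_H cls_self by auto
  have nV: "nrm ?V = l2norm M G" by (rule nrm_eq[OF V v(2)])
  let ?W = "lin 1 (T A ?V) (- \<mu>) ?V"
  have W: "?W \<in> H" using V by (intro lin_closed T_char)
  have "nrm ?W \<le> c * nrm ?V"
  proof (rule dual_nrm_bound[OF W S_dense])
    show "cls ` S \<subseteq> H" using S_sub_X cls_H by blast
    show "c * nrm ?V \<ge> 0" using c nV by simp
    fix Z assume "Z \<in> cls ` S"
    then obtain w where w: "w \<in> S" "Z = cls w" by blast
    have wX: "w \<in> X" using w S_sub_X by blast
    obtain F where F: "weak_gradient D w F"
      "\<bar>(LINT x|lebesgue_on A. G x \<bullet> F x) - \<mu> * (LINT x|M. G x \<bullet> F x)\<bar> \<le> c * l2norm M G * l2norm M F"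
      using small[OF w(1)] by blast
    note wc = cls_H[OF wX] cls_self[OF wX] F(1)
    have "grad_form D D ?W (cls w) = grad_form D A ?V (cls w) - \<mu> * grad_form D D ?V (cls w)"
      using ip_lin[OF T_char(1)[OF V(1)] V(1) wc(1), of 1 "- \<mu>"] T_char(2)[OF V(1) wc(1)] by simp
    then show "\<bar>grad_form D D ?W Z\<bar> \<le> c * nrm ?V * nrm Z"
      using grad_form_eq[OF V v(2) wc A] grad_form_eq[OF V v(2) wc D_lebesgue] F(2)
        nrm_eq[OF wc] nV w(2) by simp
  qed
  moreover have "nrm ?V > 0" using nV v(3) by simp
  ultimately obtain \<nu> where \<nu>: "\<bar>\<nu> - \<mu>\<bar> \<le> c"
    "\<not> (\<exists>C. \<forall>U\<in>H. nrm U \<le> C * nrm (lin 1 (T A U) (- \<nu>) U))"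
    using approximate_eigenvalue[OF T_symmetric V(1), of \<mu> c] by metis
  show ?thesis by (rule bexI[of _ \<nu>], rule \<nu>(1), subst spectrum_iff, rule \<nu>(2))
qed

lemma grad_form_range:
  assumes "sq_integrable M G"
  shows "0 \<le> (LINT x|lebesgue_on A. G x \<bullet> G x)" "(LINT x|lebesgue_on A. G x \<bullet> G x) \<le> (l2norm M G)\<^sup>2"
proof -
  show "0 \<le> (LINT x|lebesgue_on A. G x \<bullet> G x)" by simp
  show "(LINT x|lebesgue_on A. G x \<bullet> G x) \<le> (l2norm M G)\<^sup>2"
    using power_mono[OF sq_integrable_subset(2)[OF A(1) D_lebesgue A(2) assms], of 2]
    unfolding l2norm_sq[of "lebesgue_on A"] power2_norm_eq_inner by simp
qed

end

end

section \<open>Periodic functions at a small scale\<close>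

definition floor_vec :: "real^'n \<Rightarrow> real^'n" where "floor_vec x = (\<chi> i. of_int \<lfloor>x $ i\<rfloor>)"

lemma floor_vec_lattice: "floor_vec x \<in> lattice_points"
  by (simp add: floor_vec_def lattice_points_def)

lemma lattice_points_closed:
  "\<xi> \<in> lattice_points \<Longrightarrow> \<eta> \<in> lattice_points \<Longrightarrow> \<xi> + \<eta> \<in> lattice_points"
  "\<xi> \<in> lattice_points \<Longrightarrow> - \<xi> \<in> lattice_points"
  "0 \<in> lattice_points"
  by (auto simp: lattice_points_def)

lemma unit_cell_box: "unit_cell = box 0 1"
  by (auto simp: unit_cell_def mem_box_cart)

lemma unit_cell_open: "open unit_cell" by (simp add: unit_cell_box open_box)

lemma unit_cell_borel [measurable]: "unit_cell \<in> sets borel" by (intro borel_open unit_cell_open)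

lemma emeasure_unit_cell: "emeasure lborel (unit_cell :: (real^'n) set) = 1"
proof -
  have "(1 :: real^'n) \<bullet> b = 1" if "b \<in> Basis" for b
    using that by (auto simp: Basis_vec_def inner_axis)
  then show ?thesis unfolding unit_cell_box by (subst emeasure_lborel_box) auto
qed

lemma norm_le_card:
  fixes y :: "real^'n"
  assumes "\<And>i. \<bar>y $ i\<bar> \<le> 1" shows "norm y \<le> real CARD('n)"
proof -
  have "norm y \<le> (\<Sum>i\<in>UNIV. \<bar>y $ i\<bar>)" by (rule norm_le_l1_cart)
  also have "\<dots> \<le> (\<Sum>i\<in>(UNIV::'n set). 1)" by (intro sum_mono assms)
  finally show ?thesis by simp
qed

lemma norm_unit_cell: "(y::real^'n) \<in> unit_cell \<Longrightarrow> norm y \<le> real CARD('n)"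
proof (rule norm_le_card)
  fix i assume "y \<in> unit_cell"
  then have "0 < y $ i" "y $ i < 1" by (auto simp: unit_cell_def)
  then show "\<bar>y $ i\<bar> \<le> 1" by simp
qed

lemma finite_lattice_ball: "finite (lattice_points \<inter> cball (0::real^'n) R)"
proof -
  let ?I = "{- \<lceil>R\<rceil>..\<lceil>R\<rceil>}"
  have "lattice_points \<inter> cball (0::real^'n) R \<subseteq> (\<lambda>f. \<chi> i. real_of_int (f i)) ` (UNIV \<rightarrow>\<^sub>E ?I)"
  proof
    fix \<xi> :: "real^'n" assume \<xi>: "\<xi> \<in> lattice_points \<inter> cball 0 R"
    have e: "\<xi> = (\<chi> i. real_of_int \<lfloor>\<xi> $ i\<rfloor>)"
      using \<xi> by (auto simp: lattice_points_def vec_eq_iff elim!: Ints_cases)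
    have "\<lfloor>\<xi> $ i\<rfloor> \<in> ?I" for i
    proof -
      have "\<bar>\<xi> $ i\<bar> \<le> R" using component_le_norm_cart[of \<xi> i] \<xi> by auto
      then have "- R \<le> \<xi> $ i" "\<xi> $ i \<le> R" by auto
      then show ?thesis by (auto simp: le_floor_iff floor_le_iff) linarith+
    qed
    then show "\<xi> \<in> (\<lambda>f. \<chi> i. real_of_int (f i)) ` (UNIV \<rightarrow>\<^sub>E ?I)"
      using e by (intro image_eqI[of _ _ "\<lambda>i. \<lfloor>\<xi> $ i\<rfloor>"]) auto
  qed
  moreover have "finite ((UNIV :: 'n set) \<rightarrow>\<^sub>E ?I)" by (intro finite_PiE) auto
  ultimately show ?thesis by (rule finite_subset[OF _ finite_imageI])
qed

lemma countable_lattice: "countable (lattice_points :: (real^'n) set)"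
proof -
  have "\<xi> \<in> (\<Union>k::nat. lattice_points \<inter> cball 0 (real k))" if "\<xi> \<in> lattice_points" for \<xi> :: "real^'n"
  proof -
    obtain k :: nat where "norm \<xi> \<le> real k" using real_arch_simple by blast
    then show ?thesis using that by (intro UN_I[of k]) auto
  qed
  then have "(lattice_points :: (real^'n) set) \<subseteq> (\<Union>k::nat. lattice_points \<inter> cball 0 (real k))" by blast
  moreover have "countable (\<Union>k::nat. lattice_points \<inter> cball (0::real^'n) (real k))"
    by (rule countable_UN) (simp_all add: countable_finite finite_lattice_ball)
  ultimately show ?thesis by (rule countable_subset)
qed

text \<open>Points without integer coordinates; for these the lattice translate of the open cell that
  contains them is unique.\<close>

definition generic :: "real^'n \<Rightarrow> bool" where "generic x \<longleftrightarrow> (\<forall>i. x $ i \<notin> \<int>)"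

lemma AE_generic: "AE x in lborel. generic (x :: real^'n)"
proof -
  have "AE x in lborel. (x::real^'n) $ i \<notin> \<int>" for i
  proof -
    have "AE x in lborel. x \<notin> {x. x $ i = real_of_int k}" for k
    proof (rule AE_not_in)
      have "negligible {x::real^'n. x \<bullet> axis i 1 = real_of_int k}"
        by (intro negligible_standard_hyperplane) (auto simp: Basis_vec_def)
      then have "negligible {x::real^'n. x $ i = real_of_int k}" by (simp add: inner_axis)
      moreover have "{x::real^'n. x $ i = real_of_int k} \<in> sets borel"
        by (intro borel_closed closed_Collect_eq continuous_intros)
      ultimately show "{x::real^'n. x $ i = real_of_int k} \<in> null_sets lborel"
        by (simp add: negligible_iff_null_sets null_sets_completion_iff)
    qed
    then have "AE x in lborel. \<forall>k. x \<notin> {x. x $ i = real_of_int k}" by (subst AE_all_countable) auto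
    then show ?thesis by eventually_elim (auto elim!: Ints_cases)
  qed
  then show ?thesis unfolding generic_def by (simp add: AE_all_countable)
qed

lemma generic_cell:
  assumes "generic x" "\<xi> \<in> lattice_points"
  shows "x - \<xi> \<in> unit_cell \<longleftrightarrow> \<xi> = floor_vec x"
proof
  assume x: "x - \<xi> \<in> unit_cell"
  show "\<xi> = floor_vec x"
  proof (rule vec_eq_iff[THEN iffD2], rule allI)
    fix i
    obtain k where k: "\<xi> $ i = of_int k" using assms(2) by (auto simp: lattice_points_def elim: Ints_cases)
    have "0 < x $ i - of_int k" "x $ i - of_int k < 1"
      using x unfolding k[symmetric] unit_cell_def by auto
    then have "\<lfloor>x $ i\<rfloor> = k" by linarith
    then show "\<xi> $ i = floor_vec x $ i" using k by (simp add: floor_vec_def)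
  qed
next
  assume \<xi>: "\<xi> = floor_vec x"
  have "0 < x $ i - of_int \<lfloor>x $ i\<rfloor>" for i
  proof -
    have "x $ i \<noteq> of_int \<lfloor>x $ i\<rfloor>" using assms(1) unfolding generic_def by (metis Ints_of_int)
    then show ?thesis using of_int_floor_le[of "x $ i"] by linarith
  qed
  moreover have "x $ i - of_int \<lfloor>x $ i\<rfloor> < 1" for i by linarith
  ultimately show "x - \<xi> \<in> unit_cell" by (simp add: \<xi> unit_cell_def floor_vec_def)
qed

definition cell_measure :: "(real^'n) measure" where
  "cell_measure = density lborel (indicator unit_cell)"

lemma sets_cell_measure [simp, measurable_cong]: "sets cell_measure = sets borel"
  and space_cell_measure [simp]: "space cell_measure = UNIV"
  by (simp_all add: cell_measure_def)

lemma emeasure_cell [simp]: "emeasure cell_measure (UNIV :: (real^'n) set) = 1"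
  by (simp add: cell_measure_def emeasure_density emeasure_unit_cell)

lemma measure_cell [simp]: "measure cell_measure (UNIV :: (real^'n) set) = 1"
  by (simp add: measure_def)

interpretation cell: finite_measure "cell_measure :: (real^'n) measure"
  by (rule finite_measureI) simp

lemma nn_integral_cell:
  "f \<in> borel_measurable borel \<Longrightarrow> (\<integral>\<^sup>+x. f x \<partial>cell_measure) = (\<integral>\<^sup>+x. indicator unit_cell x * f x \<partial>lborel)"
  unfolding cell_measure_def by (subst nn_integral_density) auto

lemma integral_cell:
  fixes f :: "real^'n \<Rightarrow> 'b::euclidean_space"
  assumes [measurable]: "f \<in> borel_measurable borel"
  shows "(LINT x|cell_measure. f x) = (LINT x|lebesgue_on unit_cell. f x)"
    and "(LINT x|cell_measure. f x) = (LINT x|lborel. indicator unit_cell x *\<^sub>R f x)"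
    and "integrable cell_measure f \<longleftrightarrow> integrable (lebesgue_on unit_cell) f"
    and "integrable cell_measure f \<longleftrightarrow> integrable lborel (\<lambda>x. indicator unit_cell x *\<^sub>R f x)"
proof -
  have e: "cell_measure = density lborel (\<lambda>x. ennreal (indicator unit_cell x))"
    unfolding cell_measure_def by (intro density_cong) (auto simp: indicator_def)
  show 1: "(LINT x|cell_measure. f x) = (LINT x|lborel. indicator unit_cell x *\<^sub>R f x)"
    unfolding e by (subst integral_density) auto
  show 2: "integrable cell_measure f \<longleftrightarrow> integrable lborel (\<lambda>x. indicator unit_cell x *\<^sub>R f x)"
    unfolding e by (subst integrable_density) auto
  show "(LINT x|cell_measure. f x) = (LINT x|lebesgue_on unit_cell. f x)"
    "integrable cell_measure f \<longleftrightarrow> integrable (lebesgue_on unit_cell) f"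
    unfolding 1 2 by (simp_all add: lebesgue_on_integral_lborel)
qed

lemma AE_cell: "AE x in cell_measure. x \<in> unit_cell"
  unfolding cell_measure_def by (subst AE_density) (auto simp: indicator_def)

lemma nn_integral_shift:
  fixes f :: "'a::euclidean_space \<Rightarrow> ennreal"
  assumes [measurable]: "f \<in> borel_measurable borel"
  shows "(\<integral>\<^sup>+x. f (x + c) \<partial>lborel) = (\<integral>\<^sup>+x. f x \<partial>lborel)"
proof -
  have "(\<integral>\<^sup>+x. f x \<partial>lborel) = (\<integral>\<^sup>+x. f x \<partial>distr lborel borel ((+) c))" by (simp add: lborel_distr_plus)
  also have "\<dots> = (\<integral>\<^sup>+x. f (x + c) \<partial>lborel)" by (subst nn_integral_distr) (auto simp: add.commute)
  finally show ?thesis by simp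
qed

definition periodic :: "(real^'n \<Rightarrow> 'b) \<Rightarrow> bool" where
  "periodic h \<longleftrightarrow> (\<forall>\<xi>\<in>lattice_points. \<forall>x. h (x + \<xi>) = h x)"

lemma periodicD: "periodic h \<Longrightarrow> \<xi> \<in> lattice_points \<Longrightarrow> h (x + \<xi>) = h x"
  by (auto simp: periodic_def)

lemma generic_lattice_sum:
  assumes "generic x"
  shows "(\<integral>\<^sup>+\<xi>. indicator unit_cell (x - \<xi>) \<partial>count_space lattice_points) = (1::ennreal)"
proof -
  have "(\<integral>\<^sup>+\<xi>. indicator unit_cell (x - \<xi>) \<partial>count_space lattice_points)
    = (\<integral>\<^sup>+\<xi>. indicator {floor_vec x} \<xi> \<partial>count_space lattice_points)"
    by (intro nn_integral_cong) (auto simp: indicator_def generic_cell[OF assms])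
  also have "\<dots> = emeasure (count_space lattice_points) {floor_vec x}"
    by (intro nn_integral_indicator) (auto simp: floor_vec_lattice)
  also have "\<dots> = 1" using floor_vec_lattice by (subst emeasure_count_space_finite) auto
  finally show ?thesis .
qed

lemma nn_integral_unfold:
  fixes f :: "real^'n \<Rightarrow> ennreal"
  assumes [measurable]: "f \<in> borel_measurable borel"
  shows "(\<integral>\<^sup>+x. f x \<partial>lborel) = (\<integral>\<^sup>+\<xi>. (\<integral>\<^sup>+x. f (x + \<xi>) \<partial>cell_measure) \<partial>count_space lattice_points)"
proof -
  have "(\<integral>\<^sup>+x. f x \<partial>lborel) = (\<integral>\<^sup>+x. (\<integral>\<^sup>+\<xi>. indicator unit_cell (x - \<xi>) * f x \<partial>count_space lattice_points) \<partial>lborel)"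
  proof (rule nn_integral_cong_AE)
    show "AE x in lborel. f x = (\<integral>\<^sup>+\<xi>. indicator unit_cell (x - \<xi>) * f x \<partial>count_space lattice_points)"
      using AE_generic by eventually_elim (simp add: nn_integral_multc generic_lattice_sum)
  qed
  also have "\<dots> = (\<integral>\<^sup>+\<xi>. (\<integral>\<^sup>+x. indicator unit_cell (x - \<xi>) * f x \<partial>lborel) \<partial>count_space lattice_points)"
    by (intro nn_integral_count_space_nn_integral countable_lattice) measurable
  also have "\<dots> = (\<integral>\<^sup>+\<xi>. (\<integral>\<^sup>+x. f (x + \<xi>) \<partial>cell_measure) \<partial>count_space lattice_points)"
  proof (intro nn_integral_cong)
    fix \<xi> :: "real^'n"
    show "(\<integral>\<^sup>+x. indicator unit_cell (x - \<xi>) * f x \<partial>lborel) = (\<integral>\<^sup>+x. f (x + \<xi>) \<partial>cell_measure)"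
      using nn_integral_shift[of "\<lambda>x. indicator unit_cell (x - \<xi>) * f x" \<xi>] by (simp add: nn_integral_cell)
  qed
  finally show ?thesis .
qed

lemma generic_minus_lattice_sum:
  assumes "generic x"
  shows "(\<integral>\<^sup>+\<xi>. indicator unit_cell (x + \<xi>) \<partial>count_space lattice_points) = (1::ennreal)"
proof -
  have "bij_betw uminus lattice_points (lattice_points :: (real^'a) set)"
    by (rule bij_betwI[of _ _ _ uminus]) (auto simp: lattice_points_closed)
  from nn_integral_bij_count_space[OF this, of "\<lambda>\<xi>. indicator unit_cell (x - \<xi>)"]
  show ?thesis using generic_lattice_sum[OF assms] by simp
qed

lemma nn_integral_cell_shift:
  fixes h :: "real^'n \<Rightarrow> ennreal"
  assumes [measurable]: "h \<in> borel_measurable borel" and h: "periodic h"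
  shows "(\<integral>\<^sup>+x. h (x + a) \<partial>cell_measure) = (\<integral>\<^sup>+x. h x \<partial>cell_measure)"
proof -
  have "(\<integral>\<^sup>+x. h (x + a) \<partial>cell_measure) = (\<integral>\<^sup>+x. indicator unit_cell (x - a) * h x \<partial>lborel)"
    using nn_integral_shift[of "\<lambda>x. indicator unit_cell (x - a) * h x" a] by (simp add: nn_integral_cell)
  also have "\<dots> = (\<integral>\<^sup>+\<xi>. (\<integral>\<^sup>+x. indicator unit_cell (x - a + \<xi>) * h x \<partial>cell_measure) \<partial>count_space lattice_points)"
    by (subst nn_integral_unfold) (auto intro!: nn_integral_cong simp: periodicD[OF h] diff_add_eq)
  also have "\<dots> = (\<integral>\<^sup>+x. (\<integral>\<^sup>+\<xi>. indicator unit_cell (x - a + \<xi>) * h x \<partial>count_space lattice_points) \<partial>cell_measure)"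
    by (intro nn_integral_count_space_nn_integral[symmetric] countable_lattice) measurable
  also have "\<dots> = (\<integral>\<^sup>+x. h x \<partial>cell_measure)"
  proof (rule nn_integral_cong_AE)
    have "AE x in lborel. generic (x - a)"
    proof -
      have "AE x in distr lborel borel ((+) (- a)). generic (x :: real^'n)"
        unfolding lborel_distr_plus by (rule AE_generic)
      from AE_distrD[OF _ this] show ?thesis by simp
    qed
    then have "AE x in cell_measure. generic (x - a)"
      unfolding cell_measure_def by (subst AE_density) auto
    then show "AE x in cell_measure. (\<integral>\<^sup>+\<xi>. indicator unit_cell (x - a + \<xi>) * h x \<partial>count_space lattice_points) = h x"
      by eventually_elim (simp add: nn_integral_multc generic_minus_lattice_sum)
  qed
  finally show ?thesis .
qed

lemma integral_cell_shift:
  fixes h :: "real^'n \<Rightarrow> real"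
  assumes [measurable]: "h \<in> borel_measurable borel" and h: "periodic h" and int: "integrable cell_measure h"
  shows "(LINT x|cell_measure. h (x + a)) = (LINT x|cell_measure. h x)"
    and "integrable cell_measure (\<lambda>x. h (x + a))"
proof -
  have eq: "(\<integral>\<^sup>+x. ennreal (f (h (x + a))) \<partial>cell_measure) = (\<integral>\<^sup>+x. ennreal (f (h x)) \<partial>cell_measure)"
    if [measurable]: "f \<in> borel_measurable borel" for f :: "real \<Rightarrow> real"
    using h by (intro nn_integral_cell_shift) (auto simp: periodic_def)
  show i: "integrable cell_measure (\<lambda>x. h (x + a))"
    using int eq[of norm] by (simp add: integrable_iff_bounded)
  show "(LINT x|cell_measure. h (x + a)) = (LINT x|cell_measure. h x)"
    unfolding real_lebesgue_integral_def[OF i] real_lebesgue_integral_def[OF int]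
    using eq[of "\<lambda>x. x"] eq[of "\<lambda>x. - x"] by simp
qed

text \<open>Averaging over a cell of translations replaces the oscillating factor by its mean.\<close>

lemma nn_average:
  fixes q h :: "real^'n \<Rightarrow> ennreal"
  assumes [measurable]: "q \<in> borel_measurable borel" "h \<in> borel_measurable borel" and h: "periodic h"
  shows "(\<integral>\<^sup>+z. (\<integral>\<^sup>+x. q x * h (c *\<^sub>R x + z) \<partial>lborel) \<partial>cell_measure)
    = (\<integral>\<^sup>+x. q x \<partial>lborel) * (\<integral>\<^sup>+z. h z \<partial>cell_measure)"
proof -
  interpret pair_sigma_finite "cell_measure :: (real^'n) measure" "lborel :: (real^'n) measure" ..
  have "(\<integral>\<^sup>+z. (\<integral>\<^sup>+x. q x * h (c *\<^sub>R x + z) \<partial>lborel) \<partial>cell_measure)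
    = (\<integral>\<^sup>+x. (\<integral>\<^sup>+z. q x * h (c *\<^sub>R x + z) \<partial>cell_measure) \<partial>lborel)"
    by (intro Fubini'[symmetric]) measurable
  also have "\<dots> = (\<integral>\<^sup>+x. q x * (\<integral>\<^sup>+z. h z \<partial>cell_measure) \<partial>lborel)"
    using nn_integral_cell_shift[OF _ h] by (simp add: nn_integral_cmult add.commute[of "c *\<^sub>R _"])
  finally show ?thesis by (simp add: nn_integral_multc)
qed

lemma average:
  fixes q h :: "real^'n \<Rightarrow> real"
  assumes qm [measurable]: "q \<in> borel_measurable borel" and hm [measurable]: "h \<in> borel_measurable borel"
    and h: "periodic h" "integrable cell_measure h" and q: "integrable lborel q"
  shows "(LINT z|cell_measure. LINT x|lborel. q x * h (c *\<^sub>R x + z)) = (LINT x|lborel. q x) * (LINT z|cell_measure. h z)"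
    and "integrable cell_measure (\<lambda>z. LINT x|lborel. q x * h (c *\<^sub>R x + z))"
proof -
  interpret pair_sigma_finite "cell_measure :: (real^'n) measure" "lborel :: (real^'n) measure" ..
  have int: "integrable (cell_measure \<Otimes>\<^sub>M lborel) (\<lambda>(z, x). q x * h (c *\<^sub>R x + z))"
  proof (rule integrableI_bounded)
    have "(\<integral>\<^sup>+p. ennreal (norm (case p of (z, x) \<Rightarrow> q x * h (c *\<^sub>R x + z))) \<partial>(cell_measure \<Otimes>\<^sub>M lborel))
      = (\<integral>\<^sup>+z. (\<integral>\<^sup>+x. ennreal \<bar>q x\<bar> * ennreal \<bar>h (c *\<^sub>R x + z)\<bar> \<partial>lborel) \<partial>cell_measure)"
      by (subst lborel.nn_integral_fst[symmetric]) (auto simp: abs_mult ennreal_mult)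
    also have "\<dots> = (\<integral>\<^sup>+x. ennreal \<bar>q x\<bar> \<partial>lborel) * (\<integral>\<^sup>+z. ennreal \<bar>h z\<bar> \<partial>cell_measure)"
      using h by (intro nn_average) (auto simp: periodic_def)
    also have "\<dots> < \<infinity>"
      using q h(2) by (auto simp: integrable_iff_bounded ennreal_mult_less_top)
    finally show "(\<integral>\<^sup>+p. ennreal (norm (case p of (z, x) \<Rightarrow> q x * h (c *\<^sub>R x + z))) \<partial>(cell_measure \<Otimes>\<^sub>M lborel)) < \<infinity>" .
  qed measurable
  show "integrable cell_measure (\<lambda>z. LINT x|lborel. q x * h (c *\<^sub>R x + z))"
    using integrable_fst'[OF int] by simp
  have "(LINT z|cell_measure. LINT x|lborel. q x * h (c *\<^sub>R x + z))
    = (LINT x|lborel. LINT z|cell_measure. q x * h (c *\<^sub>R x + z))"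
    by (rule Fubini_integral[symmetric]) (use int in \<open>simp add: case_prod_beta'\<close>)
  also have "\<dots> = (LINT x|lborel. q x * (LINT z|cell_measure. h z))"
    using integral_cell_shift[OF hm h] by (simp add: add.commute[of "c *\<^sub>R _"])
  finally show "(LINT z|cell_measure. LINT x|lborel. q x * h (c *\<^sub>R x + z)) = (LINT x|lborel. q x) * (LINT z|cell_measure. h z)"
    by simp
qed


lemma cball_measurable [measurable]: "cball (a::'a::euclidean_space) r \<in> sets borel" by simp

lemma periodic_compose: "periodic h \<Longrightarrow> periodic (\<lambda>x. f (h x))"
  by (simp add: periodic_def)

lemma nn_local_bound:
  fixes h :: "real^'n \<Rightarrow> ennreal"
  assumes [measurable]: "h \<in> borel_measurable borel" and h: "periodic h" and s: "s > 0"
  shows "(\<integral>\<^sup>+x. indicator (cball 0 R) x * h ((1 / s) *\<^sub>R x) \<partial>lborel)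
    \<le> emeasure lborel (cball (0::real^'n) (R + s * real CARD('n))) * (\<integral>\<^sup>+z. h z \<partial>cell_measure)"
proof -
  let ?R = "R + s * real CARD('n)"
  have "(\<integral>\<^sup>+x. indicator (cball 0 R) x * h ((1 / s) *\<^sub>R x) \<partial>lborel)
    = (\<integral>\<^sup>+(z::real^'n). (\<integral>\<^sup>+x. indicator (cball 0 R) x * h ((1 / s) *\<^sub>R x) \<partial>lborel) \<partial>cell_measure)"
    by simp
  also have "\<dots> \<le> (\<integral>\<^sup>+z. (\<integral>\<^sup>+x. indicator (cball 0 ?R) x * h ((1 / s) *\<^sub>R x + z) \<partial>lborel) \<partial>cell_measure)"
  proof (rule nn_integral_mono_AE)
    show "AE z in cell_measure. (\<integral>\<^sup>+x. indicator (cball 0 R) x * h ((1 / s) *\<^sub>R x) \<partial>lborel)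
        \<le> (\<integral>\<^sup>+x. indicator (cball 0 ?R) x * h ((1 / s) *\<^sub>R x + z) \<partial>lborel)"
      using AE_cell
    proof eventually_elim
      case (elim z)
      have sh: "(1 / s) *\<^sub>R (x + - (s *\<^sub>R z)) + z = (1 / s) *\<^sub>R x" for x
        using s by (simp add: scaleR_diff_right)
      have "(\<integral>\<^sup>+x. indicator (cball 0 R) x * h ((1 / s) *\<^sub>R x) \<partial>lborel)
        \<le> (\<integral>\<^sup>+x. indicator (cball 0 ?R) (x + - (s *\<^sub>R z)) * h ((1 / s) *\<^sub>R (x + - (s *\<^sub>R z)) + z) \<partial>lborel)"
        unfolding sh
      proof (intro nn_integral_mono mult_right_mono)
        fix x :: "real^'n"
        have "norm (x - s *\<^sub>R z) \<le> norm x + s * norm z"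
          using norm_triangle_ineq4[of x "s *\<^sub>R z"] s by simp
        moreover have "s * norm z \<le> s * real CARD('n)"
          using norm_unit_cell[OF elim] s by (intro mult_left_mono) auto
        ultimately show "indicator (cball 0 R) x \<le> (indicator (cball 0 ?R) (x + - (s *\<^sub>R z)) :: ennreal)"
          by (auto simp: indicator_def)
      qed simp
      also have "\<dots> = (\<integral>\<^sup>+x. indicator (cball 0 ?R) x * h ((1 / s) *\<^sub>R x + z) \<partial>lborel)"
        by (rule nn_integral_shift) simp
      finally show ?case .
    qed
  qed
  also have "\<dots> = emeasure lborel (cball (0::real^'n) ?R) * (\<integral>\<^sup>+z. h z \<partial>cell_measure)"
    by (subst nn_average[OF _ _ h]) auto
  finally show ?thesis .
qed

lemma emeasure_cball: "emeasure lborel (cball (0::real^'n) R) = ennreal (measure lborel (cball (0::real^'n) R))"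
  using emeasure_bounded_finite[OF bounded_cball[of "0::real^'n" R]]
  by (intro emeasure_eq_ennreal_measure) auto

lemma local_bound:
  fixes h :: "real^'n \<Rightarrow> real"
  assumes hm [measurable]: "h \<in> borel_measurable borel" and h: "periodic h" "integrable cell_measure h" and s: "s > 0" "s \<le> 1"
    and R: "R' + real CARD('n) \<le> R"
  shows "integrable lborel (\<lambda>x. indicator (cball 0 R') x * h ((1 / s) *\<^sub>R x))"
    and "(LINT x|lborel. indicator (cball 0 R') x * \<bar>h ((1 / s) *\<^sub>R x)\<bar>)
      \<le> measure lborel (cball (0::real^'n) R) * (LINT z|cell_measure. \<bar>h z\<bar>)"
proof -
  have le: "(\<integral>\<^sup>+x. ennreal (indicator (cball 0 R') x * \<bar>h ((1 / s) *\<^sub>R x)\<bar>) \<partial>lborel)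
      \<le> ennreal (measure lborel (cball (0::real^'n) R) * (LINT z|cell_measure. \<bar>h z\<bar>))"
  proof -
    have "(\<integral>\<^sup>+x. ennreal (indicator (cball 0 R') x * \<bar>h ((1 / s) *\<^sub>R x)\<bar>) \<partial>lborel)
      = (\<integral>\<^sup>+x. indicator (cball 0 R') x * ennreal \<bar>h ((1 / s) *\<^sub>R x)\<bar> \<partial>lborel)"
      by (intro nn_integral_cong) (auto simp: indicator_def)
    also have "\<dots> \<le> emeasure lborel (cball (0::real^'n) (R' + s * real CARD('n))) * (\<integral>\<^sup>+z. ennreal \<bar>h z\<bar> \<partial>cell_measure)"
      by (rule nn_local_bound) (auto simp: s intro: periodic_compose h)
    also have "\<dots> \<le> emeasure lborel (cball (0::real^'n) R) * (\<integral>\<^sup>+z. ennreal \<bar>h z\<bar> \<partial>cell_measure)"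
    proof (intro mult_right_mono emeasure_mono subset_cball)
      have "s * real CARD('n) \<le> 1 * real CARD('n)" using s by (intro mult_right_mono) auto
      then show "R' + s * real CARD('n) \<le> R" using R by linarith
    qed auto
    also have "(\<integral>\<^sup>+z. ennreal \<bar>h z\<bar> \<partial>cell_measure) = ennreal (LINT z|cell_measure. \<bar>h z\<bar>)"
      using h by (intro nn_integral_eq_integral) auto
    finally show ?thesis by (simp add: emeasure_cball ennreal_mult)
  qed
  then show i: "integrable lborel (\<lambda>x. indicator (cball 0 R') x * h ((1 / s) *\<^sub>R x))"
    by (intro integrableI_bounded) (auto simp: abs_mult intro: le_less_trans)
  then have "integrable lborel (\<lambda>x. indicator (cball 0 R') x * \<bar>h ((1 / s) *\<^sub>R x)\<bar>)"
    using integrable_abs[OF i] by (simp add: abs_mult)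
  from nn_integral_eq_integral[OF this] le
  have "ennreal (LINT x|lborel. indicator (cball 0 R') x * \<bar>h ((1 / s) *\<^sub>R x)\<bar>)
      \<le> ennreal (measure lborel (cball (0::real^'n) R) * (LINT z|cell_measure. \<bar>h z\<bar>))" by simp
  then show "(LINT x|lborel. indicator (cball 0 R') x * \<bar>h ((1 / s) *\<^sub>R x)\<bar>)
      \<le> measure lborel (cball (0::real^'n) R) * (LINT z|cell_measure. \<bar>h z\<bar>)"
    by (subst (asm) ennreal_le_iff) auto
qed

lemma product_integrable:
  fixes q h :: "real^'n \<Rightarrow> real"
  assumes [measurable]: "q \<in> borel_measurable borel" and hm [measurable]: "h \<in> borel_measurable borel"
    and h: "periodic h" "integrable cell_measure h" and s: "s > 0" "s \<le> 1"
    and q: "\<And>x. \<bar>q x\<bar> \<le> B" "\<And>x. norm x > R \<Longrightarrow> q x = 0"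
  shows "integrable lborel (\<lambda>x. q x * h ((1 / s) *\<^sub>R x))"
proof (rule Bochner_Integration.integrable_bound)
  show "integrable lborel (\<lambda>x. B * (indicator (cball 0 R) x * h ((1 / s) *\<^sub>R x)))"
    by (intro integrable_mult_right local_bound[OF hm h s order_refl])
  show "AE x in lborel. norm (q x * h ((1 / s) *\<^sub>R x)) \<le> norm (B * (indicator (cball 0 R) x * h ((1 / s) *\<^sub>R x)))"
  proof (intro AE_I2)
    fix x
    have "\<bar>q x\<bar> \<le> \<bar>B\<bar> * indicator (cball 0 R) x"
      using q[of x] by (cases "norm x \<le> R") auto
    then have "\<bar>q x\<bar> * \<bar>h ((1 / s) *\<^sub>R x)\<bar> \<le> (\<bar>B\<bar> * indicator (cball 0 R) x) * \<bar>h ((1 / s) *\<^sub>R x)\<bar>"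
      by (intro mult_right_mono) auto
    then show "norm (q x * h ((1 / s) *\<^sub>R x)) \<le> norm (B * (indicator (cball 0 R) x * h ((1 / s) *\<^sub>R x)))"
      by (simp add: abs_mult)
  qed
qed measurable

lemma oscillation_bound:
  fixes q h :: "real^'n \<Rightarrow> real"
  assumes qm [measurable]: "q \<in> borel_measurable borel" and hm [measurable]: "h \<in> borel_measurable borel"
    and h: "periodic h" "integrable cell_measure h" and s: "s > 0" "s \<le> 1"
    and q: "\<And>x. \<bar>q x\<bar> \<le> B" "\<And>x. norm x > R \<Longrightarrow> q x = 0"
    and K: "\<And>z. z \<in> unit_cell \<Longrightarrow> \<bar>LINT x|lborel. (q x - q (x - s *\<^sub>R z)) * h ((1 / s) *\<^sub>R x)\<bar> \<le> K"
  shows "\<bar>(LINT x|lborel. q x * h ((1 / s) *\<^sub>R x)) - (LINT x|lborel. q x) * (LINT z|cell_measure. h z)\<bar> \<le> K"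
proof -
  define I where "I = (LINT x|lborel. q x * h ((1 / s) *\<^sub>R x))"
  define J where "J z = (LINT x|lborel. q x * h ((1 / s) *\<^sub>R x + z))" for z
  have qi: "integrable lborel q"
    using sq_integrable_compact_support(2)[OF qm sets.top, of B R] q by simp
  have J: "(LINT z|cell_measure. J z) = (LINT x|lborel. q x) * (LINT z|cell_measure. h z)" "integrable cell_measure J"
    unfolding J_def[abs_def] by (rule average[OF qm hm h qi])+
  have i1: "integrable lborel (\<lambda>x. q x * h ((1 / s) *\<^sub>R x))"
    by (rule product_integrable[OF qm hm h s q])
  have IJ: "\<bar>I - J z\<bar> \<le> K" if z: "z \<in> unit_cell" for z
  proof -
    have sh: "(1 / s) *\<^sub>R (x + - (s *\<^sub>R z)) + z = (1 / s) *\<^sub>R x" for x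
      using s by (simp add: scaleR_diff_right)
    have "J z = (LINT x|lborel. q (x + - (s *\<^sub>R z)) * h ((1 / s) *\<^sub>R (x + - (s *\<^sub>R z)) + z))"
      unfolding J_def by (rule lborel_integral_shift(1)[symmetric]) measurable
    then have Jz: "J z = (LINT x|lborel. q (x - s *\<^sub>R z) * h ((1 / s) *\<^sub>R x))" unfolding sh by simp
    have i2: "integrable lborel (\<lambda>x. q (x - s *\<^sub>R z) * h ((1 / s) *\<^sub>R x))"
    proof (rule product_integrable[OF _ hm h s])
      fix x :: "real^'n" assume x: "norm x > R + norm (s *\<^sub>R z)"
      have "norm x \<le> norm (x - s *\<^sub>R z) + norm (s *\<^sub>R z)" using norm_triangle_ineq[of "x - s *\<^sub>R z" "s *\<^sub>R z"] by simp
      then show "q (x - s *\<^sub>R z) = 0" using x by (intro q) linarith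
    qed (use q in auto)
    have "I - J z = (LINT x|lborel. (q x - q (x - s *\<^sub>R z)) * h ((1 / s) *\<^sub>R x))"
      unfolding I_def Jz using i1 i2 by (simp add: left_diff_distrib)
    then show ?thesis using K[OF z] by simp
  qed
  have "I - (LINT z|cell_measure. J z) = (LINT z|cell_measure. I - J z)" using J(2) by simp
  also have "\<bar>\<dots>\<bar> \<le> (LINT z|cell_measure. \<bar>I - J z\<bar>)" by (rule integral_abs_bound)
  also have "\<dots> \<le> (LINT (z::real^'n)|cell_measure. K)"
    using J(2) AE_cell by (intro integral_mono_AE) (auto elim!: eventually_mono intro: IJ)
  also have "\<dots> = K" by simp
  finally show ?thesis by (simp add: J(1) I_def)
qed

lemma weak_limit:
  fixes q h :: "real^'n \<Rightarrow> real"
  assumes q: "q \<in> test_functions D"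
    and hm [measurable]: "h \<in> borel_measurable borel" and h: "periodic h" "integrable cell_measure h"
  shows "\<exists>C\<ge>0. \<forall>s. 0 < s \<longrightarrow> s \<le> 1 \<longrightarrow>
    \<bar>(LINT x|lborel. q x * h ((1 / s) *\<^sub>R x)) - (LINT x|lborel. q x) * (LINT z|cell_measure. h z)\<bar> \<le> C * s"
proof -
  obtain B R where b: "B \<ge> 0" "R \<ge> 0" "\<And>x. \<bar>q x\<bar> \<le> B" "\<And>x. norm (grad q x) \<le> B" "\<And>x. norm x > R \<Longrightarrow> q x = 0"
    using q by (elim test_functions_bound) blast
  have qs: "smooth q" by (rule test_functions_smooth[OF q])
  have qm [measurable]: "q \<in> borel_measurable borel" by (rule smooth_measurable[OF qs])
  let ?N = "real CARD('n)"
  define V where "V = measure lborel (cball (0::real^'n) (R + ?N + ?N)) * (LINT z|cell_measure. \<bar>h z\<bar>)"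
  have V: "V \<ge> 0" by (simp add: V_def)
  show ?thesis
  proof (intro exI[of _ "B * ?N * V"] conjI allI impI)
    show "0 \<le> B * ?N * V" using b V by simp
    fix s :: real assume s: "0 < s" "s \<le> 1"
    show "\<bar>(LINT x|lborel. q x * h ((1 / s) *\<^sub>R x)) - (LINT x|lborel. q x) * (LINT z|cell_measure. h z)\<bar> \<le> B * ?N * V * s"
    proof (rule oscillation_bound[OF qm hm h s b(3,5)])
      fix z :: "real^'n" assume z: "z \<in> unit_cell"
      have sz: "norm (s *\<^sub>R z) \<le> s * ?N" using s norm_unit_cell[OF z] by (simp add: mult_left_mono)
      also have "\<dots> \<le> 1 * ?N" using s by (intro mult_right_mono) auto
      finally have sz1: "norm (s *\<^sub>R z) \<le> ?N" by simp
      note lb = local_bound[OF hm h s order_refl, of "R + ?N"]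
      have "\<bar>LINT x|lborel. (q x - q (x - s *\<^sub>R z)) * h ((1 / s) *\<^sub>R x)\<bar>
        \<le> (LINT x|lborel. \<bar>(q x - q (x - s *\<^sub>R z)) * h ((1 / s) *\<^sub>R x)\<bar>)" by (rule integral_abs_bound)
      also have "\<dots> \<le> (LINT x|lborel. (B * (s * ?N)) * (indicator (cball 0 (R + ?N)) x * \<bar>h ((1 / s) *\<^sub>R x)\<bar>))"
      proof (rule integral_mono')
        show "integrable lborel (\<lambda>x. (B * (s * ?N)) * (indicator (cball 0 (R + ?N)) x * \<bar>h ((1 / s) *\<^sub>R x)\<bar>))"
          using integrable_abs[OF lb(1)] by (intro integrable_mult_right) (simp add: abs_mult)
        fix x
        have "\<bar>q x - q (x - s *\<^sub>R z)\<bar> \<le> (B * (s * ?N)) * indicator (cball 0 (R + ?N)) x"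
        proof (cases "norm x \<le> R + ?N")
          case True
          have "\<bar>q x - q (x - s *\<^sub>R z)\<bar> \<le> B * norm (s *\<^sub>R z)"
            using lipschitz_of_grad_bound[OF qs b(4), of "x - s *\<^sub>R z" "s *\<^sub>R z"] by simp
          also have "\<dots> \<le> B * (s * ?N)" using sz b(1) by (intro mult_left_mono) auto
          finally show ?thesis using True by simp
        next
          case False
          have "norm x \<le> norm (x - s *\<^sub>R z) + norm (s *\<^sub>R z)" using norm_triangle_ineq[of "x - s *\<^sub>R z" "s *\<^sub>R z"] by simp
          then have "norm (x - s *\<^sub>R z) > R" using False sz1 by linarith
          moreover have "norm x > R" using False by simp
          ultimately show ?thesis using b(5) False by simp
        qed
        then have "\<bar>q x - q (x - s *\<^sub>R z)\<bar> * \<bar>h ((1 / s) *\<^sub>R x)\<bar>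
          \<le> ((B * (s * ?N)) * indicator (cball 0 (R + ?N)) x) * \<bar>h ((1 / s) *\<^sub>R x)\<bar>"
          by (intro mult_right_mono) auto
        then show "\<bar>(q x - q (x - s *\<^sub>R z)) * h ((1 / s) *\<^sub>R x)\<bar>
          \<le> (B * (s * ?N)) * (indicator (cball 0 (R + ?N)) x * \<bar>h ((1 / s) *\<^sub>R x)\<bar>)"
          by (simp add: abs_mult mult.assoc)
      qed (use b s in auto)
      also have "\<dots> \<le> (B * (s * ?N)) * V"
        using lb(2) b s by (simp add: V_def mult_left_mono)
      finally show "\<bar>LINT x|lborel. (q x - q (x - s *\<^sub>R z)) * h ((1 / s) *\<^sub>R x)\<bar> \<le> B * ?N * V * s"
        by (simp add: mult_ac)
    qed
  qed
qed

lemma segment_inequality: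
  assumes p: "smooth p"
  shows "ennreal ((p (x + h) - p x)\<^sup>2) \<le> (\<integral>\<^sup>+t. indicator {0..1} t * ennreal ((norm h)\<^sup>2 * (norm (grad p (x + t *\<^sub>R h)))\<^sup>2) \<partial>lborel)"
proof -
  define f where "f t = grad p (x + t *\<^sub>R h) \<bullet> h" for t :: real
  have cont: "continuous_on UNIV f" unfolding f_def
    by (intro continuous_intros continuous_on_compose2[OF smooth_grad_continuous[OF p, of UNIV]]) auto
  have der: "((\<lambda>t. p (x + t *\<^sub>R h)) has_vector_derivative f t) (at t within {0..1})" for t
  proof -
    have "((\<lambda>t. x + t *\<^sub>R h) has_derivative (\<lambda>s. s *\<^sub>R h)) (at t within {0..1})"
      by (auto intro!: derivative_eq_intros)
    from has_derivative_compose[OF this has_derivative_grad[OF smooth_differentiable[OF p]]]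
    show ?thesis by (simp add: has_vector_derivative_def f_def)
  qed
  let ?M = "lebesgue_on {0..1::real}"
  have fm [measurable]: "f \<in> borel_measurable borel" by (rule borel_measurable_continuous_onI[OF cont])
  have bint: "set_integrable lborel {0..1} g" if "continuous_on UNIV g" for g :: "real \<Rightarrow> real"
    by (rule borel_integrable_atLeastAtMost'[OF continuous_on_subset[OF that]]) simp
  have sf: "sq_integrable ?M f"
    using bint[of "\<lambda>t. (norm (f t))\<^sup>2"] cont
    by (simp add: sq_integrable_def lebesgue_on_integral_lborel set_integrable_def continuous_intros)
  have s1: "sq_integrable ?M (\<lambda>_. 1::real)"
    using bint[of "\<lambda>t. 1"] by (simp add: sq_integrable_def lebesgue_on_integral_lborel set_integrable_def)
  have "(LINT t|lborel. indicator {0..1} t *\<^sub>R f t) = p (x + 1 *\<^sub>R h) - p (x + 0 *\<^sub>R h)"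
    by (rule integral_FTC_atLeastAtMost) (use der continuous_on_subset[OF cont] in auto)
  then have FTC: "(LINT t|?M. f t) = p (x + h) - p x"
    by (simp add: lebesgue_on_integral_lborel)
  have "\<bar>LINT t|?M. f t * 1\<bar> \<le> l2norm ?M f * l2norm ?M (\<lambda>_. 1::real)" by (rule mult_integral_le[OF sf s1])
  moreover have "l2norm ?M (\<lambda>_. 1::real) = 1"
    using lebesgue_on_integral_lborel(1)[of "{0..1::real}" "\<lambda>_. 1::real"] by (simp add: l2norm_def)
  ultimately have "\<bar>p (x + h) - p x\<bar> \<le> l2norm ?M f" using FTC by simp
  then have "(p (x + h) - p x)\<^sup>2 \<le> (l2norm ?M f)\<^sup>2" by (simp add: abs_le_square_iff[symmetric])
  then have "ennreal ((p (x + h) - p x)\<^sup>2) \<le> ennreal ((l2norm ?M f)\<^sup>2)" by (rule ennreal_leI)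
  also have "\<dots> = (\<integral>\<^sup>+t. ennreal ((norm (f t))\<^sup>2) \<partial>?M)" by (rule nn_integral_sq[OF sf, symmetric])
  also have "\<dots> = (\<integral>\<^sup>+t. indicator {0..1} t * ennreal ((norm (f t))\<^sup>2) \<partial>lborel)"
    by (subst nn_integral_restrict_space) (auto simp: nn_integral_completion mult.commute)
  also have "\<dots> \<le> (\<integral>\<^sup>+t. indicator {0..1} t * ennreal ((norm h)\<^sup>2 * (norm (grad p (x + t *\<^sub>R h)))\<^sup>2) \<partial>lborel)"
  proof (intro nn_integral_mono mult_left_mono ennreal_leI)
    fix t
    have "\<bar>f t\<bar> \<le> norm (grad p (x + t *\<^sub>R h)) * norm h" unfolding f_def by (rule Cauchy_Schwarz_ineq2)
    then have "\<bar>f t\<bar>\<^sup>2 \<le> (norm (grad p (x + t *\<^sub>R h)) * norm h)\<^sup>2" by (intro power_mono) auto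
    then show "(norm (f t))\<^sup>2 \<le> (norm h)\<^sup>2 * (norm (grad p (x + t *\<^sub>R h)))\<^sup>2"
      by (simp add: power_mult_distrib mult.commute)
  qed simp
  finally show ?thesis .
qed

lemma translation_inequality:
  fixes N :: "(real^'n) measure"
  assumes N: "sigma_finite_measure N" and sets [measurable_cong]: "sets N = sets borel" and p: "smooth p"
    and inv: "\<And>a. (\<integral>\<^sup>+x. ennreal ((norm (grad p (x + a)))\<^sup>2) \<partial>N) = (\<integral>\<^sup>+x. ennreal ((norm (grad p x))\<^sup>2) \<partial>N)"
  shows "(\<integral>\<^sup>+x. ennreal ((p (x + h) - p x)\<^sup>2) \<partial>N) \<le> ennreal ((norm h)\<^sup>2) * (\<integral>\<^sup>+x. ennreal ((norm (grad p x))\<^sup>2) \<partial>N)"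
proof -
  interpret N: sigma_finite_measure N by fact
  interpret pair_sigma_finite N "lborel :: real measure" ..
  have [measurable]: "p \<in> borel_measurable borel" "grad p \<in> borel_measurable borel"
    using p smooth_measurable smooth_grad_measurable by blast+
  have "(\<integral>\<^sup>+x. ennreal ((p (x + h) - p x)\<^sup>2) \<partial>N)
    \<le> (\<integral>\<^sup>+x. (\<integral>\<^sup>+t. indicator {0..1} t * ennreal ((norm h)\<^sup>2 * (norm (grad p (x + t *\<^sub>R h)))\<^sup>2) \<partial>lborel) \<partial>N)"
    by (intro nn_integral_mono segment_inequality p)
  also have "\<dots> = (\<integral>\<^sup>+t. (\<integral>\<^sup>+x. indicator {0..1} t * ennreal ((norm h)\<^sup>2 * (norm (grad p (x + t *\<^sub>R h)))\<^sup>2) \<partial>N) \<partial>lborel)"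
    by (intro Fubini'[symmetric]) measurable
  also have "\<dots> = (\<integral>\<^sup>+(t::real). indicator {0..1} t * (ennreal ((norm h)\<^sup>2) * (\<integral>\<^sup>+x. ennreal ((norm (grad p x))\<^sup>2) \<partial>N)) \<partial>lborel)"
    by (simp add: nn_integral_cmult ennreal_mult inv)
  also have "\<dots> = ennreal ((norm h)\<^sup>2) * (\<integral>\<^sup>+x. ennreal ((norm (grad p x))\<^sup>2) \<partial>N)"
    by (subst nn_integral_multc) auto
  finally show ?thesis .
qed

lemma translation_inequality_test:
  assumes p: "p \<in> test_functions D"
  shows "l2norm lborel (\<lambda>x. p (x + h) - p x) \<le> norm h * l2norm lborel (grad p)"
    and "sq_integrable lborel (\<lambda>x. p (x + h) - p x)"
proof -
  have ps: "smooth p" by (rule test_functions_smooth[OF p])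
  have [measurable]: "p \<in> borel_measurable borel" "grad p \<in> borel_measurable borel"
    using ps smooth_measurable smooth_grad_measurable by blast+
  note sq = test_functions_integrable(3,4)[OF p sets.top]
  have sh: "sq_integrable lborel (\<lambda>x. p (x + h))"
    using sq(1) lborel_integral_shift(2)[of "\<lambda>x. (norm (p x))\<^sup>2" h] by (simp add: sq_integrable_def)
  show sd: "sq_integrable lborel (\<lambda>x. p (x + h) - p x)" by (rule sq_integrable_diff[OF sh sq(1)])
  have "(\<integral>\<^sup>+x. ennreal ((p (x + h) - p x)\<^sup>2) \<partial>lborel) \<le> ennreal ((norm h)\<^sup>2) * (\<integral>\<^sup>+x. ennreal ((norm (grad p x))\<^sup>2) \<partial>lborel)"
    by (rule translation_inequality[OF sigma_finite_lborel _ ps])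
      (auto intro!: nn_integral_shift[of "\<lambda>x. ennreal ((norm (grad p x))\<^sup>2)"])
  then have "ennreal ((l2norm lborel (\<lambda>x. p (x + h) - p x))\<^sup>2) \<le> ennreal ((norm h * l2norm lborel (grad p))\<^sup>2)"
    using nn_integral_sq[OF sd] nn_integral_sq[OF sq(2)] by (simp add: ennreal_mult power_mult_distrib)
  then have "(l2norm lborel (\<lambda>x. p (x + h) - p x))\<^sup>2 \<le> (norm h * l2norm lborel (grad p))\<^sup>2"
    by (subst (asm) ennreal_le_iff) auto
  then show "l2norm lborel (\<lambda>x. p (x + h) - p x) \<le> norm h * l2norm lborel (grad p)"
    by (rule power2_le_imp_le) (intro mult_nonneg_nonneg norm_ge_zero l2norm_nonneg)
qed

lemma sq_integrable_cell_iff: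
  fixes f :: "real^'n \<Rightarrow> 'b::euclidean_space"
  assumes [measurable]: "f \<in> borel_measurable borel"
  shows "sq_integrable (lebesgue_on unit_cell) f \<longleftrightarrow> sq_integrable cell_measure f"
    and "l2norm (lebesgue_on unit_cell) f = l2norm cell_measure f"
  by (simp_all add: sq_integrable_def l2norm_def integral_cell(1,3))

lemma sq_integrable_cell_integrable:
  fixes f :: "real^'n \<Rightarrow> real"
  assumes "sq_integrable cell_measure f" shows "integrable cell_measure f"
  using sq_integrable_mult[OF assms, of "\<lambda>_. 1"] by (simp add: sq_integrable_def)

text \<open>A periodic function of mean zero, oscillating at scale \<open>s\<close>, is of order \<open>s\<close> in the dual of
  the energy space.\<close>

lemma negative_order_bound:
  fixes g :: "real^'n \<Rightarrow> real"
  assumes gm [measurable]: "g \<in> borel_measurable borel" and g: "periodic g" "sq_integrable cell_measure g"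
    and mean: "(LINT z|cell_measure. g z) = 0"
  shows "\<exists>C\<ge>0. \<forall>s p. 0 < s \<longrightarrow> s \<le> 1 \<longrightarrow> p \<in> test_functions UNIV \<longrightarrow> (\<forall>x. norm x > R \<longrightarrow> p x = 0) \<longrightarrow>
    \<bar>LINT x|lborel. p x * g ((1 / s) *\<^sub>R x)\<bar> \<le> C * s * l2norm lborel (grad p)"
proof -
  let ?N = "real CARD('n)"
  define V where "V = measure lborel (cball (0::real^'n) (R + ?N + ?N)) * (LINT z|cell_measure. \<bar>(g z)\<^sup>2\<bar>)"
  have V: "V \<ge> 0" by (simp add: V_def)
  have g2: "integrable cell_measure (\<lambda>z. (g z)\<^sup>2)" using g(2) by (simp add: sq_integrable_def)
  show ?thesis
  proof (intro exI[of _ "?N * sqrt V"] conjI allI impI)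
    show "0 \<le> ?N * sqrt V" using V by simp
    fix s :: real and p :: "real^'n \<Rightarrow> real"
    assume s: "0 < s" "s \<le> 1" and p: "p \<in> test_functions UNIV" and supp: "\<forall>x. norm x > R \<longrightarrow> p x = 0"
    obtain B R' where b: "\<And>x. \<bar>p x\<bar> \<le> B" using p by (elim test_functions_bound) blast
    have pm [measurable]: "p \<in> borel_measurable borel" by (rule smooth_measurable[OF test_functions_smooth[OF p]])
    have "\<bar>(LINT x|lborel. p x * g ((1 / s) *\<^sub>R x)) - (LINT x|lborel. p x) * (LINT z|cell_measure. g z)\<bar>
      \<le> ?N * sqrt V * s * l2norm lborel (grad p)"
    proof (rule oscillation_bound[OF pm gm g(1) sq_integrable_cell_integrable[OF g(2)] s b])
      show "norm x > R \<Longrightarrow> p x = 0" for x using supp by blast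
      fix z :: "real^'n" assume z: "z \<in> unit_cell"
      have sz: "norm (s *\<^sub>R z) \<le> s * ?N" using s norm_unit_cell[OF z] by (simp add: mult_left_mono)
      also have "\<dots> \<le> 1 * ?N" using s by (intro mult_right_mono) auto
      finally have sz1: "norm (s *\<^sub>R z) \<le> ?N" by simp
      let ?d = "\<lambda>x. p (x + - (s *\<^sub>R z)) - p x"
      let ?G = "\<lambda>x. indicator (cball 0 (R + ?N)) x * g ((1 / s) *\<^sub>R x)"
      have lb: "integrable lborel (\<lambda>x. indicator (cball 0 (R + ?N)) x * (g ((1 / s) *\<^sub>R x))\<^sup>2)"
        "(LINT x|lborel. indicator (cball 0 (R + ?N)) x * \<bar>(g ((1 / s) *\<^sub>R x))\<^sup>2\<bar>) \<le> V"
        using local_bound[of "\<lambda>z. (g z)\<^sup>2" s "R + ?N" "R + ?N + ?N"] g2 s periodic_compose[OF g(1), of "\<lambda>t. t\<^sup>2"]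
        by (auto simp: V_def)
      have sqe: "(?G x)\<^sup>2 = indicator (cball 0 (R + ?N)) x * (g ((1 / s) *\<^sub>R x))\<^sup>2" for x
        by (auto simp: indicator_def)
      have G: "sq_integrable lborel ?G"
        using lb(1) unfolding sq_integrable_def real_norm_def power2_abs sqe by simp
      have G2: "l2norm lborel ?G \<le> sqrt V"
        using lb(2) unfolding l2norm_def real_norm_def power2_abs sqe by simp
      have d0: "(p x - p (x - s *\<^sub>R z)) * g ((1 / s) *\<^sub>R x) = - (?d x * ?G x)" for x
      proof (cases "norm x \<le> R + ?N")
        case False
        have "norm x \<le> norm (x - s *\<^sub>R z) + norm (s *\<^sub>R z)" using norm_triangle_ineq[of "x - s *\<^sub>R z" "s *\<^sub>R z"] by simp
        then have "norm (x - s *\<^sub>R z) > R" "norm x > R" using False sz1 by auto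
        then have "p (x - s *\<^sub>R z) = 0" "p x = 0" using supp by blast+
        then show ?thesis by simp
      qed (simp add: algebra_simps)
      have "\<bar>LINT x|lborel. (p x - p (x - s *\<^sub>R z)) * g ((1 / s) *\<^sub>R x)\<bar> = \<bar>LINT x|lborel. ?d x * ?G x\<bar>"
        unfolding d0 by simp
      also have "\<dots> \<le> l2norm lborel ?d * l2norm lborel ?G"
        by (rule mult_integral_le[OF translation_inequality_test(2)[OF p] G])
      also have "\<dots> \<le> (s * ?N * l2norm lborel (grad p)) * sqrt V"
      proof (intro mult_mono)
        have "l2norm lborel ?d \<le> norm (- (s *\<^sub>R z)) * l2norm lborel (grad p)"
          by (rule translation_inequality_test(1)[OF p])
        also have "\<dots> \<le> s * ?N * l2norm lborel (grad p)" using sz by (intro mult_right_mono) auto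
        finally show "l2norm lborel ?d \<le> s * ?N * l2norm lborel (grad p)" .
      qed (use G2 s in auto)
      finally show "\<bar>LINT x|lborel. (p x - p (x - s *\<^sub>R z)) * g ((1 / s) *\<^sub>R x)\<bar> \<le> ?N * sqrt V * s * l2norm lborel (grad p)"
        by (simp add: mult_ac)
    qed
    then show "\<bar>LINT x|lborel. p x * g ((1 / s) *\<^sub>R x)\<bar> \<le> ?N * sqrt V * s * l2norm lborel (grad p)"
      by (simp add: mean)
  qed
qed

definition periodize :: "(real^'n \<Rightarrow> real) \<Rightarrow> real^'n \<Rightarrow> real" where
  "periodize p y = (\<Sum>\<xi>\<in>{\<xi>\<in>lattice_points. p (y + \<xi>) \<noteq> 0}. p (y + \<xi>))"

lemma periodize_eq:
  assumes p: "\<And>x. norm x > R \<Longrightarrow> p x = 0" and y: "norm y < \<rho>"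
  shows "periodize p y = (\<Sum>\<xi>\<in>lattice_points \<inter> cball 0 (R + \<rho>). p (y + \<xi>))"
  unfolding periodize_def
proof (rule sum.mono_neutral_left[OF finite_lattice_ball])
  show "{\<xi> \<in> lattice_points. p (y + \<xi>) \<noteq> 0} \<subseteq> lattice_points \<inter> cball 0 (R + \<rho>)"
  proof
    fix \<xi> assume \<xi>: "\<xi> \<in> {\<xi> \<in> lattice_points. p (y + \<xi>) \<noteq> 0}"
    then have "norm (y + \<xi>) \<le> R" using p by force
    moreover have "norm \<xi> \<le> norm (y + \<xi>) + norm y" using norm_triangle_ineq4[of "y + \<xi>" y] by simp
    ultimately show "\<xi> \<in> lattice_points \<inter> cball 0 (R + \<rho>)" using y \<xi> by simp
  qed
qed auto

lemma periodize_smooth: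
  assumes p: "p \<in> test_functions D" "\<And>x. norm x > R \<Longrightarrow> p x = 0"
  shows "periodize p \<in> smooth_periodic"
    and "norm y < \<rho> \<Longrightarrow> grad (periodize p) y = (\<Sum>\<xi>\<in>lattice_points \<inter> cball 0 (R + \<rho>). grad p (y + \<xi>))"
proof -
  have ps: "smooth p" by (rule test_functions_smooth[OF p(1)])
  define q where "q \<rho> y = (\<Sum>\<xi>\<in>lattice_points \<inter> cball 0 (R + \<rho>). p (y + \<xi>))" for \<rho> y
  have qs: "smooth (q \<rho>)" for \<rho> unfolding q_def by (intro smooth_sum smooth_shift ps)
  have eq: "periodize p y = q \<rho> y" if "y \<in> ball 0 \<rho>" for y \<rho>
    using periodize_eq[OF p(2)] that by (simp add: q_def)
  have "Ck k (periodize p)" for k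
  proof (rule Ck_local)
    fix x :: "real^'a"
    show "\<exists>S g. open S \<and> x \<in> S \<and> (\<forall>y\<in>S. periodize p y = g y) \<and> Ck k g"
      by (intro exI[of _ "ball 0 (norm x + 1)"] exI[of _ "q (norm x + 1)"])
        (use eq smooth_Ck[OF qs] in auto)
  qed
  then have s: "smooth (periodize p)" by (simp add: smooth_def)
  have "periodize p (y + \<eta>) = periodize p y" if \<eta>: "\<eta> \<in> lattice_points" for y \<eta>
    unfolding periodize_def
    by (rule sum.reindex_bij_witness[where i = "\<lambda>\<xi>. \<xi> - \<eta>" and j = "\<lambda>\<xi>. \<xi> + \<eta>"])
      (use \<eta> lattice_points_closed(1)[OF _ \<eta>] lattice_points_closed(1)[OF _ lattice_points_closed(2)[OF \<eta>]] in \<open>auto simp: algebra_simps\<close>)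
  then show "periodize p \<in> smooth_periodic" using s by (simp add: smooth_periodic_def)
  assume y: "norm y < \<rho>"
  have "grad (periodize p) y = grad (q \<rho>) y"
  proof (rule grad_eqI)
    show "(periodize p has_derivative (\<lambda>h. grad (q \<rho>) y \<bullet> h)) (at y)"
      by (rule has_derivative_transform_within_open[OF has_derivative_grad[OF smooth_differentiable[OF qs]], where s = "ball 0 \<rho>"])
        (use eq y in auto)
  qed
  also have "\<dots> = (\<Sum>\<xi>\<in>lattice_points \<inter> cball 0 (R + \<rho>). grad p (y + \<xi>))"
    unfolding q_def by (subst grad_sum) (auto intro: smooth_shift ps simp: grad_shift[OF ps])
  finally show "grad (periodize p) y = (\<Sum>\<xi>\<in>lattice_points \<inter> cball 0 (R + \<rho>). grad p (y + \<xi>))" .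
qed

lemma sq_integrable_shift_cell:
  fixes G :: "real^'n \<Rightarrow> 'b::euclidean_space"
  assumes "p \<in> test_functions D" 
  shows "sq_integrable cell_measure (\<lambda>x. grad p (x + \<xi>))"
proof -
  obtain B where b: "\<And>x. norm (grad p x) \<le> B" using assms by (elim test_functions_bound) blast
  have [measurable]: "grad p \<in> borel_measurable borel"
    by (rule smooth_grad_measurable[OF test_functions_smooth[OF assms]])
  show ?thesis unfolding sq_integrable_def
    by (intro conjI cell.integrable_const_bound[of _ "B\<^sup>2"]) (use b in \<open>auto intro!: power_mono\<close>)
qed

lemma periodize_integral:
  fixes G :: "real^'n \<Rightarrow> real^'n"
  assumes Gm [measurable]: "G \<in> borel_measurable borel" and G: "periodic G" "sq_integrable cell_measure G"
    and p: "p \<in> test_functions D"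
  shows "(LINT x|lborel. G x \<bullet> grad p x) = (LINT y|cell_measure. G y \<bullet> grad (periodize p) y)"
proof -
  obtain R where R: "\<And>x. norm x > R \<Longrightarrow> p x = 0" "\<And>x. norm x > R \<Longrightarrow> grad p x = 0"
    using p by (elim test_functions_bound) blast
  have [measurable]: "grad p \<in> borel_measurable borel"
    by (rule smooth_grad_measurable[OF test_functions_smooth[OF p]])
  let ?N = "real CARD('n)"
  let ?F = "lattice_points \<inter> cball (0::real^'n) (R + (?N + 1))"
  have int: "integrable cell_measure (\<lambda>y. G y \<bullet> grad p (y + \<xi>))" for \<xi>
    by (intro sq_integrable_inner G sq_integrable_shift_cell[OF p])
  have tr: "(LINT y|cell_measure. G y \<bullet> grad p (y + \<xi>)) = (LINT x|lborel. indicator unit_cell (x - \<xi>) * (G x \<bullet> grad p x))"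
    "integrable lborel (\<lambda>x. indicator unit_cell (x - \<xi>) * (G x \<bullet> grad p x))" if \<xi>: "\<xi> \<in> lattice_points" for \<xi>
  proof -
    let ?f = "\<lambda>x. indicator unit_cell (x - \<xi>) * (G x \<bullet> grad p x)"
    have f: "?f (y + \<xi>) = indicator unit_cell y *\<^sub>R (G y \<bullet> grad p (y + \<xi>))" for y
      by (simp add: periodicD[OF G(1) \<xi>])
    have fm: "?f \<in> borel_measurable borel" by measurable
    show "(LINT y|cell_measure. G y \<bullet> grad p (y + \<xi>)) = (LINT x|lborel. ?f x)"
      using lborel_integral_shift(1)[OF fm, of \<xi>] unfolding f by (simp add: integral_cell(2))
    show "integrable lborel ?f"
      using lborel_integral_shift(2)[OF fm, of \<xi>] int[of \<xi>] unfolding f by (simp add: integral_cell(4))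
  qed
  have "(LINT y|cell_measure. G y \<bullet> grad (periodize p) y) = (LINT y|cell_measure. (\<Sum>\<xi>\<in>?F. G y \<bullet> grad p (y + \<xi>)))"
  proof (rule integral_cong_AE)
    have "periodize p \<in> smooth_periodic" by (rule periodize_smooth(1)[OF p R(1)])
    then have [measurable]: "grad (periodize p) \<in> borel_measurable borel"
      by (intro smooth_grad_measurable) (simp add: smooth_periodic_def)
    show "(\<lambda>y. G y \<bullet> grad (periodize p) y) \<in> borel_measurable cell_measure"
      "(\<lambda>y. \<Sum>\<xi>\<in>?F. G y \<bullet> grad p (y + \<xi>)) \<in> borel_measurable cell_measure" by measurable
    show "AE y in cell_measure. G y \<bullet> grad (periodize p) y = (\<Sum>\<xi>\<in>?F. G y \<bullet> grad p (y + \<xi>))"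
      using AE_cell
    proof eventually_elim
      case (elim y)
      then have "norm y < ?N + 1" using norm_unit_cell[of y] by simp
      then show ?case using periodize_smooth(2)[OF p R(1), where y = y and \<rho> = "?N + 1"] by (simp add: inner_sum_right)
    qed
  qed
  also have "\<dots> = (\<Sum>\<xi>\<in>?F. LINT x|lborel. indicator unit_cell (x - \<xi>) * (G x \<bullet> grad p x))"
    using int tr(1) by simp
  also have "\<dots> = (LINT x|lborel. (\<Sum>\<xi>\<in>?F. indicator unit_cell (x - \<xi>) * (G x \<bullet> grad p x)))"
    using tr(2) by (intro Bochner_Integration.integral_sum[symmetric]) auto
  also have "\<dots> = (LINT x|lborel. G x \<bullet> grad p x)"
  proof (rule integral_cong_AE)
    show "AE x in lborel. (\<Sum>\<xi>\<in>?F. indicator unit_cell (x - \<xi>) * (G x \<bullet> grad p x)) = G x \<bullet> grad p x"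
      using AE_generic
    proof eventually_elim
      case (elim x)
      show ?case
      proof (cases "norm x \<le> R")
        case True
        have "x - floor_vec x \<in> unit_cell" using generic_cell[OF elim floor_vec_lattice] by simp
        then have "norm (floor_vec x) \<le> R + (?N + 1)"
          using norm_unit_cell[of "x - floor_vec x"] True norm_triangle_ineq4[of x "x - floor_vec x"] by simp
        then have "floor_vec x \<in> ?F" using floor_vec_lattice by auto
        then have "(\<Sum>\<xi>\<in>?F. indicator unit_cell (x - \<xi>) * (G x \<bullet> grad p x))
          = (\<Sum>\<xi>\<in>{floor_vec x}. indicator unit_cell (x - \<xi>) * (G x \<bullet> grad p x))"
          by (intro sum.mono_neutral_right finite_lattice_ball) (auto simp: indicator_def generic_cell[OF elim])
        then show ?thesis using \<open>x - floor_vec x \<in> unit_cell\<close> by simp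
      next
        case False
        then show ?thesis using R(2) by simp
      qed
    qed
  qed measurable
  finally show ?thesis by simp
qed

lemma lborel_scale:
  fixes f :: "'a::euclidean_space \<Rightarrow> real"
  assumes [measurable]: "f \<in> borel_measurable borel" and c: "c \<noteq> 0"
  shows "(LINT x|lborel. f x) = \<bar>c\<bar> ^ DIM('a) * (LINT x|lborel. f (c *\<^sub>R x))"
proof -
  have "(LINT x|lborel. f x) = (LINT x|density (distr lborel borel (\<lambda>x. 0 + c *\<^sub>R x)) (\<lambda>_. ennreal (\<bar>c\<bar> ^ DIM('a))). f x)"
    using lborel_affine[OF c, of "0::'a"] by simp
  also have "\<dots> = (LINT x|distr lborel borel (\<lambda>x. 0 + c *\<^sub>R x). \<bar>c\<bar> ^ DIM('a) * f x)"
    by (subst integral_density) auto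
  also have "\<dots> = (LINT x|lborel. \<bar>c\<bar> ^ DIM('a) * f (c *\<^sub>R x))"
    by (subst integral_distr) auto
  finally show ?thesis by simp
qed

lemma divergence_free_scaled:
  fixes G :: "real^'n \<Rightarrow> real^'n"
  assumes Gm [measurable]: "G \<in> borel_measurable borel" and G: "periodic G" "sq_integrable cell_measure G"
    and orth: "\<And>v. v \<in> smooth_periodic \<Longrightarrow> (LINT y|cell_measure. G y \<bullet> grad v y) = 0"
    and p: "p \<in> test_functions UNIV" and s: "s > 0"
  shows "(LINT x|lborel. G ((1 / s) *\<^sub>R x) \<bullet> grad p x) = 0"
proof -
  have ps: "smooth p" by (rule test_functions_smooth[OF p])
  have [measurable]: "grad p \<in> borel_measurable borel" by (rule smooth_grad_measurable[OF ps])
  obtain R where R: "\<And>x. norm x > R \<Longrightarrow> p x = 0" using p by (elim test_functions_bound) blast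
  define q where "q y = p (s *\<^sub>R y)" for y
  have q: "q \<in> test_functions UNIV" unfolding test_functions_iff
  proof (intro conjI exI[of _ "cball 0 (R / s)"] allI impI)
    show "smooth q" unfolding q_def[abs_def] by (rule smooth_scale[OF ps])
    fix x :: "real^'n" assume "x \<notin> cball 0 (R / s)"
    then have "norm (s *\<^sub>R x) > R" using s by (simp add: field_simps)
    then show "q x = 0" using R by (simp add: q_def)
  qed auto
  have gq: "grad q y = s *\<^sub>R grad p (s *\<^sub>R y)" for y unfolding q_def[abs_def] by (rule grad_scale[OF ps])
  obtain R' where R': "\<And>x. norm x > R' \<Longrightarrow> q x = 0" using q by (elim test_functions_bound) blast
  have "0 = (LINT x|lborel. G x \<bullet> grad q x)"
    using periodize_integral[OF Gm G q] orth[OF periodize_smooth(1)[OF q R']] by simp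
  also have "\<dots> = \<bar>1 / s\<bar> ^ DIM(real^'n) * (LINT x|lborel. G ((1 / s) *\<^sub>R x) \<bullet> grad q ((1 / s) *\<^sub>R x))"
    by (rule lborel_scale) (use s in \<open>auto simp: gq[abs_def]\<close>)
  finally show ?thesis using s by (simp add: gq)
qed

lemma smooth_periodicD:
  assumes "\<phi> \<in> smooth_periodic"
  shows "smooth \<phi>" "periodic \<phi>" "periodic (grad \<phi>)"
proof -
  show s: "smooth \<phi>" and p: "periodic \<phi>" using assms by (auto simp: smooth_periodic_def periodic_def)
  show "periodic (grad \<phi>)" unfolding periodic_def
  proof (intro ballI allI)
    fix \<xi> x :: "real^'a" assume \<xi>: "\<xi> \<in> lattice_points"
    have "(\<lambda>x. \<phi> (x + \<xi>)) = \<phi>" using periodicD[OF p \<xi>] by auto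
    then show "grad \<phi> (x + \<xi>) = grad \<phi> x" using grad_shift[OF s, of \<xi> x] by simp
  qed
qed

lemma smooth_periodic_bounded:
  assumes "\<phi> \<in> smooth_periodic"
  obtains B where "B \<ge> 0" "\<And>x. \<bar>\<phi> x\<bar> \<le> B" "\<And>x. norm (grad \<phi> x) \<le> B"
proof -
  note \<phi> = smooth_periodicD[OF assms]
  let ?N = "real CARD('a)"
  have "bounded (\<phi> ` cball 0 ?N)"
    by (intro compact_imp_bounded compact_continuous_image smooth_continuous \<phi> compact_cball)
  then obtain a where a: "\<And>x. x \<in> cball 0 ?N \<Longrightarrow> norm (\<phi> x) \<le> a" unfolding bounded_iff by blast
  have "bounded (grad \<phi> ` cball 0 ?N)"
    by (intro compact_imp_bounded compact_continuous_image smooth_grad_continuous \<phi> compact_cball)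
  then obtain b where b: "\<And>x. x \<in> cball 0 ?N \<Longrightarrow> norm (grad \<phi> x) \<le> b" unfolding bounded_iff by blast
  have red: "x - floor_vec x \<in> cball 0 ?N" for x :: "real^'a"
  proof -
    have "\<bar>(x - floor_vec x) $ i\<bar> \<le> 1" for i by (simp add: floor_vec_def) linarith
    then show ?thesis using norm_le_card[of "x - floor_vec x"] by simp
  qed
  have "\<phi> x = \<phi> (x - floor_vec x)" "grad \<phi> x = grad \<phi> (x - floor_vec x)" for x
    using periodicD[OF \<phi>(2) floor_vec_lattice, of "x - floor_vec x" x] periodicD[OF \<phi>(3) floor_vec_lattice, of "x - floor_vec x" x] by auto
  then have "\<bar>\<phi> x\<bar> \<le> \<bar>a\<bar> + \<bar>b\<bar>" "norm (grad \<phi> x) \<le> \<bar>a\<bar> + \<bar>b\<bar>" for x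
    using a[OF red, of x] b[OF red, of x] by force+
  then show ?thesis using that[of "\<bar>a\<bar> + \<bar>b\<bar>"] by auto
qed

lemma smooth_periodic_measurable:
  assumes "\<phi> \<in> smooth_periodic"
  shows "\<phi> \<in> borel_measurable borel" "grad \<phi> \<in> borel_measurable borel"
  using smooth_measurable[OF smooth_periodicD(1)[OF assms]] smooth_grad_measurable[OF smooth_periodicD(1)[OF assms]] by auto

lemma smooth_periodic_sq_integrable:
  assumes "\<phi> \<in> smooth_periodic"
  shows "sq_integrable cell_measure \<phi>" "sq_integrable cell_measure (grad \<phi>)"
proof -
  obtain B where b: "\<And>x. \<bar>\<phi> x\<bar> \<le> B" "\<And>x. norm (grad \<phi> x) \<le> B" using assms by (elim smooth_periodic_bounded) blast
  note [measurable] = smooth_periodic_measurable[OF assms]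
  show "sq_integrable cell_measure \<phi>" unfolding sq_integrable_def
  proof (intro conjI cell.integrable_const_bound[of _ "B\<^sup>2"] AE_I2)
    fix x show "norm ((norm (\<phi> x))\<^sup>2) \<le> B\<^sup>2" using power_mono[OF b(1)[of x], of 2] by simp
  qed measurable
  show "sq_integrable cell_measure (grad \<phi>)" unfolding sq_integrable_def
  proof (intro conjI cell.integrable_const_bound[of _ "B\<^sup>2"] AE_I2)
    fix x show "norm ((norm (grad \<phi> x))\<^sup>2) \<le> B\<^sup>2" using power_mono[OF b(2)[of x], of 2] by simp
  qed measurable
qed

lemma smooth_periodic_weak_gradient:
  assumes "\<phi> \<in> smooth_periodic" shows "weak_gradient unit_cell \<phi> (grad \<phi>)"
  by (rule weak_gradient_smooth[OF unit_cell_open smooth_periodicD(1)[OF assms]])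
    (simp_all add: sq_integrable_cell_iff smooth_periodic_measurable[OF assms] smooth_periodic_sq_integrable[OF assms])

text \<open>Poincare--Wirtinger: \<open>\<phi> x\<close> minus the mean is the average over the cell of \<open>\<phi> x - \<phi> (x + z)\<close>.\<close>

lemma Poincare_cell:
  fixes \<phi> :: "real^'n \<Rightarrow> real"
  assumes \<phi>: "\<phi> \<in> smooth_periodic"
  shows "l2norm cell_measure (\<lambda>x. \<phi> x - (LINT z|cell_measure. \<phi> z)) \<le> real CARD('n) * l2norm cell_measure (grad \<phi>)"
proof -
  note m [measurable] = smooth_periodic_measurable[OF \<phi>] and sq = smooth_periodic_sq_integrable[OF \<phi>]
  note pd = smooth_periodicD[OF \<phi>]
  let ?c = "LINT z|cell_measure. \<phi> z" and ?N = "real CARD('n)"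
  interpret pair_sigma_finite "cell_measure :: (real^'n) measure" "cell_measure :: (real^'n) measure" ..
  have int: "integrable cell_measure \<phi>" by (rule sq_integrable_cell_integrable[OF sq(1)])
  have sc: "sq_integrable cell_measure (\<lambda>_. c)" for c :: real by (simp add: sq_integrable_def)
  have pt: "ennreal ((\<phi> x - ?c)\<^sup>2) \<le> (\<integral>\<^sup>+z. ennreal ((\<phi> (x + z) - \<phi> x)\<^sup>2) \<partial>cell_measure)" for x
  proof -
    have i1: "integrable cell_measure (\<lambda>z. \<phi> (x + z))" and i2: "(LINT z|cell_measure. \<phi> (x + z)) = ?c"
      using integral_cell_shift[OF m(1) pd(2) int, of x] by (simp_all add: add.commute)
    have "sq_integrable cell_measure (\<lambda>z. \<phi> (z + x))"
      using integral_cell_shift(2)[of "\<lambda>z. (norm (\<phi> z))\<^sup>2" x] periodic_compose[OF pd(2), of "\<lambda>t. t\<^sup>2"] sq(1)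
      by (simp add: sq_integrable_def)
    then have sd: "sq_integrable cell_measure (\<lambda>z. \<phi> (x + z) - \<phi> x)"
      using sq_integrable_diff[OF _ sc[of "\<phi> x"]] by (simp add: add.commute)
    have "(LINT z|cell_measure. (\<phi> (x + z) - \<phi> x) * 1) = ?c - \<phi> x" using i1 i2 by simp
    moreover have "\<bar>LINT z|cell_measure. (\<phi> (x + z) - \<phi> x) * 1\<bar>
        \<le> l2norm cell_measure (\<lambda>z. \<phi> (x + z) - \<phi> x) * l2norm cell_measure (\<lambda>_::real^'n. 1::real)"
      by (rule mult_integral_le[OF sd sc])
    ultimately have "\<bar>?c - \<phi> x\<bar> \<le> l2norm cell_measure (\<lambda>z. \<phi> (x + z) - \<phi> x)" by (simp add: l2norm_def[of _ "\<lambda>_. 1::real"])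
    then have "(\<phi> x - ?c)\<^sup>2 \<le> (l2norm cell_measure (\<lambda>z. \<phi> (x + z) - \<phi> x))\<^sup>2"
      by (simp add: abs_le_square_iff[symmetric] abs_minus_commute)
    then show ?thesis using nn_integral_sq[OF sd] by (simp add: ennreal_leI)
  qed
  have "(\<integral>\<^sup>+x. ennreal ((\<phi> x - ?c)\<^sup>2) \<partial>cell_measure)
    \<le> (\<integral>\<^sup>+x. (\<integral>\<^sup>+z. ennreal ((\<phi> (x + z) - \<phi> x)\<^sup>2) \<partial>cell_measure) \<partial>cell_measure)"
    by (intro nn_integral_mono pt)
  also have "\<dots> = (\<integral>\<^sup>+z. (\<integral>\<^sup>+x. ennreal ((\<phi> (x + z) - \<phi> x)\<^sup>2) \<partial>cell_measure) \<partial>cell_measure)"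
    by (intro Fubini'[symmetric]) measurable
  also have "\<dots> \<le> (\<integral>\<^sup>+(z::real^'n). ennreal (?N\<^sup>2) * (\<integral>\<^sup>+x. ennreal ((norm (grad \<phi> x))\<^sup>2) \<partial>cell_measure) \<partial>cell_measure)"
  proof (rule nn_integral_mono_AE)
    show "AE z in cell_measure. (\<integral>\<^sup>+x. ennreal ((\<phi> (x + z) - \<phi> x)\<^sup>2) \<partial>cell_measure)
      \<le> ennreal (?N\<^sup>2) * (\<integral>\<^sup>+x. ennreal ((norm (grad \<phi> x))\<^sup>2) \<partial>cell_measure)"
      using AE_cell
    proof eventually_elim
      case (elim z)
      have "(\<integral>\<^sup>+x. ennreal ((\<phi> (x + z) - \<phi> x)\<^sup>2) \<partial>cell_measure)
        \<le> ennreal ((norm z)\<^sup>2) * (\<integral>\<^sup>+x. ennreal ((norm (grad \<phi> x))\<^sup>2) \<partial>cell_measure)"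
        by (rule translation_inequality[OF cell.sigma_finite_measure_axioms sets_cell_measure pd(1)])
          (rule nn_integral_cell_shift[of "\<lambda>x. ennreal ((norm (grad \<phi> x))\<^sup>2)"], measurable, rule periodic_compose[OF pd(3)])
      also have "\<dots> \<le> ennreal (?N\<^sup>2) * (\<integral>\<^sup>+x. ennreal ((norm (grad \<phi> x))\<^sup>2) \<partial>cell_measure)"
        using norm_unit_cell[OF elim] by (intro mult_right_mono ennreal_leI power_mono) auto
      finally show ?case .
    qed
  qed
  also have "\<dots> = ennreal ((?N * l2norm cell_measure (grad \<phi>))\<^sup>2)"
    by (simp add: nn_integral_sq[OF sq(2)] ennreal_mult power_mult_distrib)
  finally have "ennreal ((l2norm cell_measure (\<lambda>x. \<phi> x - ?c))\<^sup>2) \<le> ennreal ((?N * l2norm cell_measure (grad \<phi>))\<^sup>2)"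
    using nn_integral_sq[OF sq_integrable_diff[OF sq(1) sc[of ?c]]] by simp
  then have "(l2norm cell_measure (\<lambda>x. \<phi> x - ?c))\<^sup>2 \<le> (?N * l2norm cell_measure (grad \<phi>))\<^sup>2"
    by (subst (asm) ennreal_le_iff) auto
  then show ?thesis by (rule power2_le_imp_le) (intro mult_nonneg_nonneg l2norm_nonneg of_nat_0_le_iff)
qed

lemma l2norm_weak_gradient_unique:
  assumes "open D" "weak_gradient D u G" "weak_gradient D u F"
  shows "l2norm (lebesgue_on D) G = l2norm (lebesgue_on D) F"
  using weak_gradient_unique[OF assms] weak_gradient_sq[OF assms(2)] weak_gradient_sq[OF assms(3)]
  by (intro l2norm_cong_AE) (auto simp: sq_integrable_def)

interpretation cell_space: gradient_space "unit_cell :: (real^'n) set" smooth_periodic 1 "real CARD('n)"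
proof
  show "open unit_cell" by (rule unit_cell_open)
  show "emeasure lborel (unit_cell :: (real^'n) set) < \<infinity>" by (simp add: emeasure_unit_cell)
  show "(smooth_periodic :: (real^'n \<Rightarrow> real) set) \<subseteq> H1 unit_cell"
    using smooth_periodic_weak_gradient by (auto simp: H1_def)
  show c: "(\<lambda>_. c) \<in> smooth_periodic" for c by (simp add: smooth_periodic_def)
  then show "smooth_periodic \<noteq> {}" by blast
  show "(\<lambda>x. a * \<phi> x + b * \<psi> x) \<in> smooth_periodic" if "\<phi> \<in> smooth_periodic" "\<psi> \<in> smooth_periodic" for a b and \<phi> \<psi> :: "real^'n \<Rightarrow> real"
    using that by (auto simp: smooth_periodic_def intro!: smooth_add smooth_mult)
  fix \<phi> :: "real^'n \<Rightarrow> real" and G assume \<phi>: "\<phi> \<in> smooth_periodic" and G: "weak_gradient unit_cell \<phi> G"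
  note [measurable] = smooth_periodic_measurable[OF \<phi>]
  show "l2norm (lebesgue_on unit_cell) (\<lambda>x. \<phi> x - 1 * (LINT x|lebesgue_on unit_cell. \<phi> x))
    \<le> real CARD('n) * l2norm (lebesgue_on unit_cell) G"
    using Poincare_cell[OF \<phi>] l2norm_weak_gradient_unique[OF unit_cell_open G smooth_periodic_weak_gradient[OF \<phi>]]
    by (simp add: sq_integrable_cell_iff integral_cell(1))
qed simp

lemma test_functions_weak_gradient:
  assumes "open D" "\<phi> \<in> test_functions D" shows "weak_gradient D \<phi> (grad \<phi>)"
  using assms test_functions_integrable[OF assms(2), of D]
  by (intro weak_gradient_smooth test_functions_smooth[OF assms(2)]) auto

lemma l2norm_test_lborel:
  fixes f :: "real^'n \<Rightarrow> 'b::euclidean_space"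
  assumes D: "open D" and f: "f \<in> borel_measurable borel" "\<And>x. x \<notin> D \<Longrightarrow> f x = 0"
  shows "l2norm (lebesgue_on D) f = l2norm lborel f"
  unfolding l2norm_def using f by (subst integral_test_lborel[OF D]) auto

lemma test_functions_zero_outside:
  assumes "\<phi> \<in> test_functions D" "x \<notin> D" shows "\<phi> x = 0" "grad \<phi> x = 0"
  using assms by (auto elim!: test_functionsE)

text \<open>A translation by more than the diameter moves the support of a test function out of \<open>\<Omega>\<close>.\<close>

lemma Poincare_test:
  fixes \<phi> :: "real^'n \<Rightarrow> real"
  assumes D: "open D" and R: "D \<subseteq> cball 0 R" "R \<ge> 0" and \<phi>: "\<phi> \<in> test_functions D"
  shows "l2norm lborel \<phi> \<le> (2 * R + 1) * l2norm lborel (grad \<phi>)"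
proof -
  obtain e :: "real^'n" where e: "norm e = 1" using vector_choose_size[of 1] by auto
  define h where "h = (2 * R + 1) *\<^sub>R e"
  have h: "norm h = 2 * R + 1" using R e by (simp add: h_def)
  have sq: "sq_integrable lborel (\<lambda>x. \<phi> (x + h) - \<phi> x)" by (rule translation_inequality_test(2)[OF \<phi>])
  have "l2norm lborel \<phi> \<le> l2norm lborel (\<lambda>x. \<phi> (x + h) - \<phi> x)"
  proof (rule l2norm_mono[OF sq])
    show "\<phi> \<in> borel_measurable lborel" using smooth_measurable[OF test_functions_smooth[OF \<phi>]] by simp
    show "AE x in lborel. norm (\<phi> x) \<le> norm (\<phi> (x + h) - \<phi> x)"
    proof (intro AE_I2)
      fix x
      show "norm (\<phi> x) \<le> norm (\<phi> (x + h) - \<phi> x)"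
      proof (cases "x \<in> D")
        case True
        then have "norm x \<le> R" using R by auto
        then have "norm (x + h) > R" using h norm_triangle_ineq4[of "x + h" x] by simp
        then have "x + h \<notin> D" using R by auto
        then show ?thesis using test_functions_zero_outside[OF \<phi>] by simp
      next
        case False
        then show ?thesis using test_functions_zero_outside[OF \<phi>] by simp
      qed
    qed
  qed
  also have "\<dots> \<le> (2 * R + 1) * l2norm lborel (grad \<phi>)" using translation_inequality_test(1)[OF \<phi>, of h] h by simp
  finally show ?thesis .
qed

lemma test_space:
  assumes D: "open D" and R: "D \<subseteq> cball 0 R" "R \<ge> 0"
  shows "gradient_space D (test_functions D) 0 (2 * R + 1)"
proof
  show "open D" by fact
  have "emeasure lborel D \<le> emeasure lborel (cball (0::real^'a) R)" using R by (intro emeasure_mono) auto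
  then show "emeasure lborel D < \<infinity>" using emeasure_bounded_finite[OF bounded_cball[of "0::real^'a" R]] by (rule le_less_trans)
  show "test_functions D \<subseteq> H1 D" using test_functions_weak_gradient[OF D] by (auto simp: H1_def)
  have "(\<lambda>_. 0) \<in> test_functions D" by (auto simp: test_functions_iff intro: exI[of _ "{}"])
  then show "test_functions D \<noteq> {}" by blast
  show "(\<lambda>x. a * \<phi> x + b * \<psi> x) \<in> test_functions D" if "\<phi> \<in> test_functions D" "\<psi> \<in> test_functions D" for a b \<phi> \<psi>
    by (rule test_functions_lin[OF that])
  fix \<phi> G assume \<phi>: "\<phi> \<in> test_functions D" and G: "weak_gradient D \<phi> G"
  have s: "smooth \<phi>" by (rule test_functions_smooth[OF \<phi>])
  have "l2norm (lebesgue_on D) G = l2norm (lebesgue_on D) (grad \<phi>)"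
    by (rule l2norm_weak_gradient_unique[OF D G test_functions_weak_gradient[OF D \<phi>]])
  then show "l2norm (lebesgue_on D) (\<lambda>x. \<phi> x - 0 * (LINT x|lebesgue_on D. \<phi> x)) \<le> (2 * R + 1) * l2norm (lebesgue_on D) G"
    using Poincare_test[OF D R \<phi>] test_functions_zero_outside[OF \<phi>]
      l2norm_test_lborel[OF D smooth_measurable[OF s]] l2norm_test_lborel[OF D smooth_grad_measurable[OF s]] by simp
qed (use R in auto)

section \<open>Quasimodes\<close>

definition frac_vec :: "real^'n \<Rightarrow> real^'n" where "frac_vec x = x - floor_vec x"

lemma frac_vec_periodic: "periodic frac_vec"
  unfolding periodic_def
proof (intro ballI allI)
  fix \<xi> x :: "real^'a" assume \<xi>: "\<xi> \<in> lattice_points"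
  show "frac_vec (x + \<xi>) = frac_vec x"
  proof (rule vec_eq_iff[THEN iffD2], rule allI)
    fix i
    obtain k where "\<xi> $ i = of_int k" using \<xi> by (auto simp: lattice_points_def elim: Ints_cases)
    then show "frac_vec (x + \<xi>) $ i = frac_vec x $ i" by (simp add: frac_vec_def floor_vec_def)
  qed
qed

lemma frac_vec_cell: "x \<in> unit_cell \<Longrightarrow> frac_vec x = x"
  by (simp add: frac_vec_def floor_vec_def unit_cell_def vec_eq_iff floor_eq_iff less_imp_le)

lemma frac_vec_measurable [measurable]: "frac_vec \<in> borel_measurable borel"
proof (rule borel_measurable_euclidean_space[THEN iffD2], intro ballI)
  fix b :: "real^'a" assume "b \<in> Basis"
  then obtain i where b: "b = axis i 1" by (auto simp: Basis_vec_def)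
  have "frac_vec x \<bullet> b = x \<bullet> b - real_of_int \<lfloor>x \<bullet> b\<rfloor>" for x
    by (simp add: b frac_vec_def floor_vec_def inner_axis inner_diff_left)
  then show "(\<lambda>x. frac_vec x \<bullet> b) \<in> borel_measurable borel" by simp
qed

text \<open>Passing to a Borel representative first makes the composition with \<open>frac_vec\<close> measurable.\<close>

lemma periodic_representative:
  fixes R :: "real^'n \<Rightarrow> real^'n"
  assumes R: "R \<in> borel_measurable (lebesgue_on unit_cell)"
  shows "\<exists>R'. R' \<in> borel_measurable borel \<and> periodic R' \<and> (AE x in lebesgue_on unit_cell. R x = R' x)"
proof -
  have "\<exists>g. g \<in> borel_measurable borel \<and> (AE x in lborel. x \<in> unit_cell \<longrightarrow> R x $ i = g x)" for i
  proof -
    have "(\<lambda>x. R x \<bullet> axis i 1) \<in> borel_measurable (lebesgue_on unit_cell)" using R by measurable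
    then have "(\<lambda>x. indicator unit_cell x *\<^sub>R (R x $ i)) \<in> borel_measurable lebesgue"
      by (intro borel_measurable_restrict_space_iff[THEN iffD1]) (auto simp: inner_axis)
    then obtain g where g: "g \<in> borel_measurable lborel" "AE x in lborel. indicator unit_cell x *\<^sub>R (R x $ i) = g x"
      using completion_ex_borel_measurable_real by blast
    from g(2) have "AE x in lborel. x \<in> unit_cell \<longrightarrow> R x $ i = g x" by eventually_elim auto
    then show ?thesis using g(1) by auto
  qed
  then have "\<exists>g. \<forall>i. g i \<in> borel_measurable borel \<and> (AE x in lborel. x \<in> unit_cell \<longrightarrow> R x $ i = g i x)"
    by (intro choice allI)
  then obtain g where "\<forall>i. g i \<in> borel_measurable borel \<and> (AE x in lborel. x \<in> unit_cell \<longrightarrow> R x $ i = g i x)"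
    by (rule exE)
  then have g: "\<And>i. g i \<in> borel_measurable borel" "\<And>i. AE x in lborel. x \<in> unit_cell \<longrightarrow> R x $ i = g i x"
    by simp_all
  define R0 where "R0 x = (\<chi> i. g i x)" for x
  have [measurable]: "R0 \<in> borel_measurable borel"
    by (rule borel_measurable_euclidean_space[THEN iffD2]) (auto simp: R0_def Basis_vec_def inner_axis g)
  have "AE x in lborel. \<forall>i. x \<in> unit_cell \<longrightarrow> R x $ i = g i x"
    by (subst AE_all_countable) (intro allI g(2))
  then have "AE x in lborel. x \<in> unit_cell \<longrightarrow> R x = R0 (frac_vec x)"
    by eventually_elim (simp add: R0_def vec_eq_iff frac_vec_cell)
  then have "AE x in lebesgue_on unit_cell. R x = R0 (frac_vec x)"
    by (subst AE_restrict_space_iff) (auto simp: AE_completion)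
  then show ?thesis using periodic_compose[OF frac_vec_periodic, of R0] by (intro exI[of _ "\<lambda>x. R0 (frac_vec x)"]) auto
qed

lemma cell_space_H: "cell_space.H = (H1per_mod_const :: (real^'n \<Rightarrow> real) set set)"
  unfolding cell_space.H_def cell_space.X_def cell_space.eqv_def H1per_mod_const_def H1per_def by simp

lemma cell_space_T: "cell_space.T \<omega> = T_zero \<omega>"
  by (simp add: fun_eq_iff cell_space.T_def T_zero_def cell_space_H)

definition cell_field :: "(real^'n) set \<Rightarrow> real \<Rightarrow> (real^'n \<Rightarrow> real) \<Rightarrow> real^'n \<Rightarrow> real^'n" where
  "cell_field \<omega> \<mu> \<phi> x = (indicator \<omega> (frac_vec x) - \<mu>) *\<^sub>R grad \<phi> x"

lemma cell_field:
  assumes \<omega> [measurable]: "\<omega> \<in> sets borel" and \<phi>: "\<phi> \<in> smooth_periodic"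
  shows "cell_field \<omega> \<mu> \<phi> \<in> borel_measurable borel" "periodic (cell_field \<omega> \<mu> \<phi>)"
    "sq_integrable cell_measure (cell_field \<omega> \<mu> \<phi>)"
proof -
  note [measurable] = smooth_periodic_measurable[OF \<phi>]
  show m: "cell_field \<omega> \<mu> \<phi> \<in> borel_measurable borel" unfolding cell_field_def by measurable
  show "periodic (cell_field \<omega> \<mu> \<phi>)"
    by (simp add: periodic_def cell_field_def periodicD[OF frac_vec_periodic] periodicD[OF smooth_periodicD(3)[OF \<phi>]])
  show "sq_integrable cell_measure (cell_field \<omega> \<mu> \<phi>)"
  proof (rule sq_integrable_bound[OF smooth_periodic_sq_integrable(2)[OF \<phi>], of _ "1 + \<bar>\<mu>\<bar>"])
    show "AE x in cell_measure. norm (cell_field \<omega> \<mu> \<phi> x) \<le> (1 + \<bar>\<mu>\<bar>) * norm (grad \<phi> x)"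
    proof (intro AE_I2)
      fix x
      have "\<bar>indicator \<omega> (frac_vec x) - \<mu>\<bar> \<le> 1 + \<bar>\<mu>\<bar>" by (auto simp: indicator_def)
      then show "norm (cell_field \<omega> \<mu> \<phi> x) \<le> (1 + \<bar>\<mu>\<bar>) * norm (grad \<phi> x)"
        by (simp add: cell_field_def mult_right_mono)
    qed
  qed (use m in simp)
qed

lemma cell_quasimode:
  fixes \<omega> :: "(real^'n) set"
  assumes \<mu>: "\<mu> \<in> cell_spectrum \<omega>" and \<omega>: "\<omega> \<in> sets borel" "\<omega> \<subseteq> unit_cell" and \<delta>: "\<delta> > 0"
  shows "\<exists>\<phi> R. \<phi> \<in> smooth_periodic \<and> R \<in> borel_measurable borel \<and> periodic R \<and> sq_integrable cell_measure R \<and>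
    l2norm cell_measure (grad \<phi>) > 0 \<and> l2norm cell_measure R \<le> \<delta> * l2norm cell_measure (grad \<phi>) \<and>
    (\<forall>v\<in>smooth_periodic. (LINT y|cell_measure. (cell_field \<omega> \<mu> \<phi> y - R y) \<bullet> grad v y) = 0) \<and>
    - \<delta> \<le> \<mu> \<and> \<mu> \<le> 1 + \<delta>"
proof -
  have \<omega>l: "\<omega> \<in> sets lebesgue" using \<omega>(1) by auto
  have "\<mu> \<in> spectrum cell_space.H (grad_norm unit_cell) (cell_space.T \<omega>)"
    using \<mu> by (simp add: cell_spectrum_def cell_space_H cell_space_T)
  from cell_space.spectrum_quasimode[OF \<omega>l \<omega>(2) this \<delta>] obtain \<phi> G r R where
    \<phi>: "\<phi> \<in> smooth_periodic" "weak_gradient unit_cell \<phi> G" and r: "weak_gradient unit_cell r R"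
    and G: "l2norm (lebesgue_on unit_cell) G > 0"
    and R: "l2norm (lebesgue_on unit_cell) R \<le> \<delta> * l2norm (lebesgue_on unit_cell) G"
    and eq: "\<forall>v\<in>cell_space.X. \<forall>F. weak_gradient unit_cell v F \<longrightarrow>
      (LINT x|lebesgue_on \<omega>. G x \<bullet> F x) - \<mu> * (LINT x|lebesgue_on unit_cell. G x \<bullet> F x)
        = (LINT x|lebesgue_on unit_cell. R x \<bullet> F x)"
    by (elim bexE exE conjE) (rule that; assumption)
  note mm [measurable] = smooth_periodic_measurable[OF \<phi>(1)]
  note wg = smooth_periodic_weak_gradient[OF \<phi>(1)]
  note Gsq = weak_gradient_sq(2)[OF \<phi>(2)] and Rsq = weak_gradient_sq(2)[OF r]
  obtain R' where R'm [measurable]: "R' \<in> borel_measurable borel" and R'p: "periodic R'"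
    and R'R: "AE x in lebesgue_on unit_cell. R x = R' x"
    using periodic_representative[of R] Rsq by (auto simp: sq_integrable_def)
  have R'sq: "sq_integrable (lebesgue_on unit_cell) R'"
    by (rule sq_integrable_bound[OF Rsq, of _ 1]) (use R'R in \<open>auto elim: eventually_mono\<close>)
  have nG: "l2norm (lebesgue_on unit_cell) G = l2norm cell_measure (grad \<phi>)"
    using l2norm_weak_gradient_unique[OF unit_cell_open \<phi>(2) wg] sq_integrable_cell_iff(2)[OF mm(2)] by simp
  have nR: "l2norm (lebesgue_on unit_cell) R = l2norm cell_measure R'"
  proof -
    have "l2norm (lebesgue_on unit_cell) R = l2norm (lebesgue_on unit_cell) R'"
      by (rule l2norm_cong_AE) (use Rsq R'R in \<open>auto simp: sq_integrable_def\<close>)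
    then show ?thesis using sq_integrable_cell_iff(2)[OF R'm] by simp
  qed
  have R'sqc: "sq_integrable cell_measure R'" using R'sq sq_integrable_cell_iff(1)[OF R'm] by simp
  have Gphi: "AE x in lebesgue_on unit_cell. G x = grad \<phi> x"
    by (rule weak_gradient_unique[OF unit_cell_open \<phi>(2) wg]) simp
  have ph: "(LINT x|lebesgue_on \<omega>. grad \<phi> x \<bullet> grad v x) - \<mu> * (LINT x|cell_measure. grad \<phi> x \<bullet> grad v x)
        = (LINT x|cell_measure. R' x \<bullet> grad v x)" if v: "v \<in> smooth_periodic" for v
  proof -
    note mv [measurable] = smooth_periodic_measurable[OF v]
    note vs = smooth_periodic_weak_gradient[OF v]
    note vsq = weak_gradient_sq(2)[OF vs]
    have [measurable]: "G \<in> borel_measurable (lebesgue_on unit_cell)" "R \<in> borel_measurable (lebesgue_on unit_cell)"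
      "G \<in> borel_measurable (lebesgue_on \<omega>)"
      using Gsq Rsq sq_integrable_subset(1)[OF \<omega>l cell_space.D_lebesgue \<omega>(2) Gsq] by (auto simp: sq_integrable_def)
    have [measurable]: "grad v \<in> borel_measurable (lebesgue_on A)" "grad \<phi> \<in> borel_measurable (lebesgue_on A)" for A
      by (auto intro: borel_measurable_lebesgue_on mv mm)
    have [measurable]: "R' \<in> borel_measurable (lebesgue_on unit_cell)" by simp
    have "v \<in> cell_space.X" using v cell_space.S_sub_X by blast
    then have "(LINT x|lebesgue_on \<omega>. G x \<bullet> grad v x) - \<mu> * (LINT x|lebesgue_on unit_cell. G x \<bullet> grad v x)
        = (LINT x|lebesgue_on unit_cell. R x \<bullet> grad v x)" using eq vs by blast
    moreover have "(LINT x|lebesgue_on \<omega>. G x \<bullet> grad v x) = (LINT x|lebesgue_on \<omega>. grad \<phi> x \<bullet> grad v x)"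
      using AE_lebesgue_on_subset[OF \<omega>l cell_space.D_lebesgue \<omega>(2) Gphi] by (intro integral_cong_AE) auto
    moreover have "(LINT x|lebesgue_on unit_cell. G x \<bullet> grad v x) = (LINT x|cell_measure. grad \<phi> x \<bullet> grad v x)"
      using Gphi by (subst integral_cell(1)) (auto intro!: integral_cong_AE)
    moreover have "(LINT x|lebesgue_on unit_cell. R x \<bullet> grad v x) = (LINT x|cell_measure. R' x \<bullet> grad v x)"
      using R'R by (subst integral_cell(1)) (auto intro!: integral_cong_AE)
    ultimately show ?thesis by simp
  qed
  have orth: "(LINT y|cell_measure. (cell_field \<omega> \<mu> \<phi> y - R' y) \<bullet> grad v y) = 0" if v: "v \<in> smooth_periodic" for v
  proof -
    note mv [measurable] = smooth_periodic_measurable[OF v] and svq = smooth_periodic_sq_integrable(2)[OF v]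
    note cf = cell_field[OF \<omega>(1) \<phi>(1), of \<mu>]
    have f0: "cell_field \<omega> 0 \<phi> \<in> borel_measurable borel" by (rule cell_field(1)[OF \<omega>(1) \<phi>(1)])
    have "(LINT x|lebesgue_on \<omega>. grad \<phi> x \<bullet> grad v x) = (LINT x|lborel. indicator \<omega> x *\<^sub>R (grad \<phi> x \<bullet> grad v x))"
      using \<omega>(1) by (subst lebesgue_on_integral_lborel) auto
    also have "\<dots> = (LINT x|lborel. indicator unit_cell x *\<^sub>R (cell_field \<omega> 0 \<phi> x \<bullet> grad v x))"
      using \<omega>(2) by (intro Bochner_Integration.integral_cong) (auto simp: indicator_def cell_field_def frac_vec_cell)
    also have "\<dots> = (LINT x|cell_measure. cell_field \<omega> 0 \<phi> x \<bullet> grad v x)"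
      using f0 by (subst integral_cell(2)) auto
    finally have 1: "(LINT x|lebesgue_on \<omega>. grad \<phi> x \<bullet> grad v x) = (LINT x|cell_measure. cell_field \<omega> 0 \<phi> x \<bullet> grad v x)" .
    have cfe: "(cell_field \<omega> \<mu> \<phi> y - R' y) \<bullet> grad v y
      = cell_field \<omega> 0 \<phi> y \<bullet> grad v y - \<mu> * (grad \<phi> y \<bullet> grad v y) - R' y \<bullet> grad v y" for y
      by (simp add: cell_field_def inner_diff_left algebra_simps)
    have i: "integrable cell_measure (\<lambda>y. cell_field \<omega> 0 \<phi> y \<bullet> grad v y)" "integrable cell_measure (\<lambda>y. grad \<phi> y \<bullet> grad v y)"
      "integrable cell_measure (\<lambda>y. R' y \<bullet> grad v y)"
      by (intro sq_integrable_inner svq cell_field(3)[OF \<omega>(1) \<phi>(1)] smooth_periodic_sq_integrable(2)[OF \<phi>(1)] R'sqc)+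
    show ?thesis unfolding cfe using i ph[OF v] 1 by simp
  qed
  have "0 \<le> (LINT x|lebesgue_on \<omega>. grad \<phi> x \<bullet> grad \<phi> x)"
    "(LINT x|lebesgue_on \<omega>. grad \<phi> x \<bullet> grad \<phi> x) \<le> (l2norm (lebesgue_on unit_cell) (grad \<phi>))\<^sup>2"
    using cell_space.grad_form_range[OF \<omega>l \<omega>(2) weak_gradient_sq(2)[OF wg]] by auto
  then have range: "0 \<le> (LINT x|lebesgue_on \<omega>. grad \<phi> x \<bullet> grad \<phi> x)"
    "(LINT x|lebesgue_on \<omega>. grad \<phi> x \<bullet> grad \<phi> x) \<le> (l2norm cell_measure (grad \<phi>))\<^sup>2"
    using sq_integrable_cell_iff(2)[OF mm(2)] by auto
  define L where "L = l2norm cell_measure (grad \<phi>)"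
  have L: "L > 0" using G nG by (simp add: L_def)
  have "\<bar>LINT x|cell_measure. R' x \<bullet> grad \<phi> x\<bar> \<le> l2norm cell_measure R' * L"
    unfolding L_def by (rule inner_integral_le[OF R'sqc smooth_periodic_sq_integrable(2)[OF \<phi>(1)]])
  also have "\<dots> \<le> (\<delta> * L) * L" using R nG nR L by (intro mult_right_mono) (auto simp: L_def)
  finally have Rb: "\<bar>LINT x|cell_measure. R' x \<bullet> grad \<phi> x\<bar> \<le> \<delta> * L\<^sup>2" by (simp add: power2_eq_square)
  have "(LINT x|cell_measure. grad \<phi> x \<bullet> grad \<phi> x) = L\<^sup>2"
    unfolding L_def l2norm_sq power2_norm_eq_inner ..
  then have "(LINT x|lebesgue_on \<omega>. grad \<phi> x \<bullet> grad \<phi> x) - \<mu> * L\<^sup>2 = (LINT x|cell_measure. R' x \<bullet> grad \<phi> x)"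
    using ph[OF \<phi>(1)] by simp
  then have "0 \<le> (\<mu> + \<delta>) * L\<^sup>2" "\<mu> * L\<^sup>2 \<le> (1 + \<delta>) * L\<^sup>2"
    using range Rb unfolding L_def[symmetric] by (auto simp: algebra_simps)
  then have "- \<delta> \<le> \<mu>" "\<mu> \<le> 1 + \<delta>" using L by (auto simp: zero_le_mult_iff)
  then show ?thesis using \<phi>(1) R'm R'p R'sqc L R nG nR orth by (intro exI[of _ \<phi>] exI[of _ R']) (auto simp: L_def)
qed

lemma wave_gradient:
  "smooth (\<lambda>x. sin (K * (x \<bullet> e) + c))"
  "grad (\<lambda>x. sin (K * (x \<bullet> e) + c)) x = (K * cos (K * (x \<bullet> e) + c)) *\<^sub>R e"
proof -
  have s: "smooth (\<lambda>x. K * (x \<bullet> e))" by (intro smooth_mult smooth_const smooth_inner)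
  then show "smooth (\<lambda>x. sin (K * (x \<bullet> e) + c))" by (rule smooth_sin_shift)
  have g: "grad (\<lambda>x. K * (x \<bullet> e)) x = K *\<^sub>R e"
    using grad_cmult[OF smooth_differentiable[OF smooth_inner[of e]], where c = K and x = x] by (simp add: grad_inner)
  have "((\<lambda>t. sin (t + c)) has_real_derivative cos (t + c)) (at t)" for t
    by (auto intro!: derivative_eq_intros)
  from grad_compose(1)[OF smooth_differentiable[OF s] this]
  show "grad (\<lambda>x. sin (K * (x \<bullet> e) + c)) x = (K * cos (K * (x \<bullet> e) + c)) *\<^sub>R e"
    by (simp add: g mult.commute)
qed

text \<open>The mean \<open>m\<close> of the divergence-free field is harmless for amplitudes that oscillate at a high
  frequency \<open>K\<close> in a direction \<open>e\<close> orthogonal to \<open>m\<close>: integration by parts along \<open>e\<close> gains the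
  factor \<open>1 / K\<close>. The sine and the cosine of the phase cannot both have a small norm.\<close>

lemma amplitude:
  fixes \<Omega> :: "(real^'n) set"
  assumes \<Omega>: "open \<Omega>" "\<Omega> \<noteq> {}" "\<Omega> \<subseteq> cball 0 r" "r \<ge> 0" and e: "norm e = 1" "e \<bullet> m = 0" and \<tau>: "\<tau> > 0"
  shows "\<exists>\<psi>\<in>test_functions \<Omega>. l2norm lborel \<psi> > 0 \<and> (\<forall>w\<in>test_functions \<Omega>.
    \<bar>LINT x|lborel. w x * (grad \<psi> x \<bullet> m)\<bar> \<le> \<tau> * l2norm lborel \<psi> * l2norm lborel (grad w))"
proof -
  obtain x0 where "x0 \<in> \<Omega>" using \<Omega>(2) by blast
  then obtain a b where ab: "x0 \<in> box a b" "cbox a b \<subseteq> \<Omega>" using open_contains_cbox[OF \<Omega>(1)] by metis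
  define \<eta> where "\<eta> = box_bump a b"
  have \<eta>: "\<eta> \<in> test_functions \<Omega>" unfolding \<eta>_def by (rule box_bump_test[OF ab(2)])
  have \<eta>s: "smooth \<eta>" by (rule test_functions_smooth[OF \<eta>])
  have \<eta>sq: "sq_integrable lborel \<eta>" by (rule test_functions_integrable(3)[OF \<eta> sets.top])
  define A where "A = l2norm lborel \<eta>"
  have A: "A > 0"
  proof (rule ccontr)
    assume "\<not> A > 0"
    then have "A = 0" using l2norm_nonneg[of lborel \<eta>] unfolding A_def by linarith
    then have "AE x in lborel. \<eta> x = 0" using l2norm_eq_0_AE[OF \<eta>sq] by (simp add: A_def)
    then have "AE x in lborel. x \<notin> box a b"
      by eventually_elim (metis box_bump_pos less_irrefl \<eta>_def)
    then have "box a b \<in> null_sets lborel" by (subst AE_iff_null_sets) auto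
    then have "negligible (box a b)" by (simp add: negligible_iff_null_sets null_sets_completionI)
    then show False using open_not_negligible[OF open_box, of a b] ab(1) by blast
  qed
  define \<beta> where "\<beta> x = grad \<eta> x \<bullet> m" for x
  have \<beta>: "\<beta> \<in> test_functions \<Omega>" unfolding \<beta>_def[abs_def] by (rule test_functions_grad[OF \<eta>])
  have \<beta>s: "smooth \<beta>" by (rule test_functions_smooth[OF \<beta>])
  define C where "C = l2norm lborel \<beta> + (2 * r + 1) * l2norm lborel (\<lambda>x. grad \<beta> x \<bullet> e)"
  have C: "C \<ge> 0" using \<Omega>(4) by (simp add: C_def)
  define K where "K = 2 * C / (\<tau> * A) + 1"
  have K: "K > 0" using C \<tau> A by (simp add: K_def add_nonneg_pos)
  have KC: "C / K \<le> \<tau> * (A / 2)"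
  proof -
    have "\<tau> * (A / 2) * K = C + \<tau> * (A / 2)" using \<tau> A by (simp add: K_def field_simps)
    then have "C \<le> \<tau> * (A / 2) * K" using \<tau> A by simp
    then show ?thesis using K by (simp add: pos_divide_le_eq)
  qed
  define S where "S c x = sin (K * (x \<bullet> e) + c)" for c x
  have Ss: "smooth (S c)" and gS: "grad (S c) x = (K * S (c + pi / 2) x) *\<^sub>R e" for c x
    using wave_gradient(1)[of K e c] wave_gradient(2)[of K e c x]
    by (simp_all add: S_def[abs_def] sin_add[of _ "pi/2"] add.assoc[symmetric])
  have S1: "\<bar>S c x\<bar> \<le> 1" for c x by (simp add: S_def)
  define \<psi> where "\<psi> c x = S (c + pi / 2) x * \<eta> x" for c x
  have \<psi>: "\<psi> c \<in> test_functions \<Omega>" for c unfolding \<psi>_def[abs_def] by (rule test_functions_mult[OF Ss \<eta>])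
  have \<psi>sq: "sq_integrable lborel (\<psi> c)" for c by (rule test_functions_integrable(3)[OF \<psi> sets.top])
  have g\<psi>: "grad (\<psi> c) x \<bullet> m = S (c + pi / 2) x * \<beta> x" for c x
    using grad_mult[OF smooth_differentiable[OF Ss] smooth_differentiable[OF \<eta>s], of "c + pi / 2" x] e(2)
    by (simp add: \<psi>_def[abs_def] inner_add_left gS \<beta>_def)
  have small: "\<bar>LINT x|lborel. w x * (grad (\<psi> c) x \<bullet> m)\<bar> \<le> C / K * l2norm lborel (grad w)"
    if w: "w \<in> test_functions \<Omega>" for c w
  proof -
    have ws: "smooth w" by (rule test_functions_smooth[OF w])
    have wb: "(\<lambda>x. w x * \<beta> x) \<in> test_functions \<Omega>" by (rule test_functions_mult[OF ws \<beta>])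
    have t: "(\<lambda>x. S c x * (w x * \<beta> x)) \<in> test_functions \<Omega>" by (rule test_functions_mult[OF Ss wb])
    have gt: "grad (\<lambda>x. S c x * (w x * \<beta> x)) x \<bullet> e
      = K * (w x * (grad (\<psi> c) x \<bullet> m)) + ((S c x * \<beta> x) * (grad w x \<bullet> e) + w x * (S c x * (grad \<beta> x \<bullet> e)))" for x
    proof -
      have "e \<bullet> e = 1" using e(1) by (simp add: power2_norm_eq_inner[symmetric])
      then show ?thesis
      using grad_mult[OF smooth_differentiable[OF Ss] smooth_differentiable[OF test_functions_smooth[OF wb]], of c x]
        grad_mult[OF smooth_differentiable[OF ws] smooth_differentiable[OF \<beta>s], of x]
      by (simp add: g\<psi> gS inner_add_left algebra_simps)
    qed
    have sS: "sq_integrable lborel (\<lambda>x. S c x * f x)" "l2norm lborel (\<lambda>x. S c x * f x) \<le> l2norm lborel f"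
      if f: "f \<in> test_functions \<Omega>" for f
    proof -
      have le: "AE x in lborel. norm (S c x * f x) \<le> norm (f x)"
        using S1 by (auto simp: abs_mult intro!: mult_left_le_one_le)
      show "sq_integrable lborel (\<lambda>x. S c x * f x)"
        by (rule test_functions_integrable(3)[OF test_functions_mult[OF Ss f] sets.top])
      then show "l2norm lborel (\<lambda>x. S c x * f x) \<le> l2norm lborel f"
        by (intro l2norm_mono[OF test_functions_integrable(3)[OF f sets.top] _ le]) (simp add: sq_integrable_def)
    qed
    note gb = test_functions_grad[OF \<beta>, of e]
    note ge = test_functions_grad[OF w, of e]
    note wsq = test_functions_integrable(3)[OF w sets.top] and gwsq = test_functions_integrable(4)[OF w sets.top]
      and gesq = test_functions_integrable(3)[OF ge sets.top]
    have i1: "integrable lborel (\<lambda>x. K * (w x * (grad (\<psi> c) x \<bullet> m)))"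
      by (intro integrable_mult_right sq_integrable_mult wsq test_functions_integrable(3)[OF test_functions_grad[OF \<psi>] sets.top])
    have i2: "integrable lborel (\<lambda>x. (S c x * \<beta> x) * (grad w x \<bullet> e))" by (rule sq_integrable_mult[OF sS(1)[OF \<beta>] gesq])
    have i3: "integrable lborel (\<lambda>x. w x * (S c x * (grad \<beta> x \<bullet> e)))" by (rule sq_integrable_mult[OF wsq sS(1)[OF gb]])
    have "0 = (LINT x|lborel. grad (\<lambda>x. S c x * (w x * \<beta> x)) x \<bullet> e)" using test_functions_grad_integral[OF t] by simp
    also have "\<dots> = K * (LINT x|lborel. w x * (grad (\<psi> c) x \<bullet> m))
      + ((LINT x|lborel. (S c x * \<beta> x) * (grad w x \<bullet> e)) + (LINT x|lborel. w x * (S c x * (grad \<beta> x \<bullet> e))))"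
      unfolding gt using i1 i2 i3 by simp
    finally have "\<bar>K * (LINT x|lborel. w x * (grad (\<psi> c) x \<bullet> m))\<bar>
      \<le> \<bar>LINT x|lborel. (S c x * \<beta> x) * (grad w x \<bullet> e)\<bar> + \<bar>LINT x|lborel. w x * (S c x * (grad \<beta> x \<bullet> e))\<bar>" by linarith
    also have "\<dots> \<le> l2norm lborel \<beta> * l2norm lborel (grad w)
        + ((2 * r + 1) * l2norm lborel (grad w)) * l2norm lborel (\<lambda>x. grad \<beta> x \<bullet> e)"
    proof (intro add_mono)
      have "\<bar>LINT x|lborel. (S c x * \<beta> x) * (grad w x \<bullet> e)\<bar> \<le> l2norm lborel (\<lambda>x. S c x * \<beta> x) * l2norm lborel (\<lambda>x. grad w x \<bullet> e)"
        by (rule mult_integral_le[OF sS(1)[OF \<beta>] gesq])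
      also have "\<dots> \<le> l2norm lborel \<beta> * l2norm lborel (grad w)"
      proof (intro mult_mono sS \<beta>)
        show "l2norm lborel (\<lambda>x. grad w x \<bullet> e) \<le> l2norm lborel (grad w)"
        proof (rule l2norm_mono[OF gwsq])
          show "(\<lambda>x. grad w x \<bullet> e) \<in> borel_measurable lborel" by (rule sq_integrable_measurable[OF gesq])
          show "AE x in lborel. norm (grad w x \<bullet> e) \<le> norm (grad w x)"
            using Cauchy_Schwarz_ineq2[of "grad w _" e] by (simp add: e(1))
        qed
      qed auto
      finally show "\<bar>LINT x|lborel. (S c x * \<beta> x) * (grad w x \<bullet> e)\<bar> \<le> l2norm lborel \<beta> * l2norm lborel (grad w)" .
      have "\<bar>LINT x|lborel. w x * (S c x * (grad \<beta> x \<bullet> e))\<bar> \<le> l2norm lborel w * l2norm lborel (\<lambda>x. S c x * (grad \<beta> x \<bullet> e))"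
        by (rule mult_integral_le[OF wsq sS(1)[OF gb]])
      also have "\<dots> \<le> ((2 * r + 1) * l2norm lborel (grad w)) * l2norm lborel (\<lambda>x. grad \<beta> x \<bullet> e)"
        using \<Omega>(4) by (intro mult_mono sS gb Poincare_test[OF \<Omega>(1,3,4) w]) auto
      finally show "\<bar>LINT x|lborel. w x * (S c x * (grad \<beta> x \<bullet> e))\<bar>
        \<le> ((2 * r + 1) * l2norm lborel (grad w)) * l2norm lborel (\<lambda>x. grad \<beta> x \<bullet> e)" .
    qed
    also have "\<dots> = C * l2norm lborel (grad w)" by (simp add: C_def algebra_simps)
    finally show ?thesis using K by (simp add: abs_mult field_simps)
  qed
  have "(l2norm lborel (\<psi> 0))\<^sup>2 + (l2norm lborel (\<psi> (pi / 2)))\<^sup>2 = A\<^sup>2"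
  proof -
    have "(norm (\<psi> 0 x))\<^sup>2 + (norm (\<psi> (pi / 2) x))\<^sup>2 = (norm (\<eta> x))\<^sup>2" for x
    proof -
      have "S (0 + pi / 2) x = cos (K * (x \<bullet> e))" "S (pi / 2 + pi / 2) x = - sin (K * (x \<bullet> e))"
        by (simp_all add: S_def sin_add)
      then show ?thesis
        using sin_cos_squared_add2[of "K * (x \<bullet> e)"] by (simp add: \<psi>_def power_mult_distrib distrib_right[symmetric])
    qed
    then have "(LINT x|lborel. (norm (\<eta> x))\<^sup>2) = (LINT x|lborel. (norm (\<psi> 0 x))\<^sup>2 + (norm (\<psi> (pi / 2) x))\<^sup>2)" by simp
    also have "\<dots> = (LINT x|lborel. (norm (\<psi> 0 x))\<^sup>2) + (LINT x|lborel. (norm (\<psi> (pi / 2) x))\<^sup>2)"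
      using \<psi>sq[of 0] \<psi>sq[of "pi / 2"] unfolding sq_integrable_def by (intro Bochner_Integration.integral_add) auto
    finally show ?thesis by (simp add: l2norm_sq A_def)
  qed
  then have "\<exists>c. l2norm lborel (\<psi> c) \<ge> A / 2"
  proof -
    assume s: "(l2norm lborel (\<psi> 0))\<^sup>2 + (l2norm lborel (\<psi> (pi / 2)))\<^sup>2 = A\<^sup>2"
    show ?thesis
    proof (rule ccontr)
      assume "\<not> ?thesis"
      then have "(l2norm lborel (\<psi> c))\<^sup>2 \<le> (A / 2)\<^sup>2" for c by (intro power_mono) (auto simp: not_le less_imp_le)
      from this[of 0] this[of "pi / 2"] have "A\<^sup>2 \<le> (A / 2)\<^sup>2 + (A / 2)\<^sup>2" using s by linarith
      then show False using A by (simp add: power_divide)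
    qed
  qed
  then obtain c where c: "l2norm lborel (\<psi> c) \<ge> A / 2" by blast
  show ?thesis
  proof (rule bexI[OF _ \<psi>[of c]], intro conjI ballI)
    show "l2norm lborel (\<psi> c) > 0" using c A by linarith
    fix w assume w: "w \<in> test_functions \<Omega>"
    have "C / K \<le> \<tau> * l2norm lborel (\<psi> c)"
      using KC mult_left_mono[OF c, of \<tau>] \<tau> by linarith
    then have "C / K * l2norm lborel (grad w) \<le> \<tau> * l2norm lborel (\<psi> c) * l2norm lborel (grad w)"
      by (intro mult_right_mono) auto
    then show "\<bar>LINT x|lborel. w x * (grad (\<psi> c) x \<bullet> m)\<bar> \<le> \<tau> * l2norm lborel (\<psi> c) * l2norm lborel (grad w)"
      using small[OF w, of c] by linarith
  qed
qed

lemma scaled_sq_integrable: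
  fixes h :: "real^'n \<Rightarrow> real^'n"
  assumes \<psi>: "\<psi> \<in> test_functions D" and hm [measurable]: "h \<in> borel_measurable borel"
    and h: "periodic h" "sq_integrable cell_measure h"
  shows "0 < s \<Longrightarrow> s \<le> 1 \<Longrightarrow> sq_integrable lborel (\<lambda>x. \<psi> x *\<^sub>R h ((1 / s) *\<^sub>R x))"
    and "\<exists>C\<ge>0. \<forall>s. 0 < s \<longrightarrow> s \<le> 1 \<longrightarrow>
      \<bar>(l2norm lborel (\<lambda>x. \<psi> x *\<^sub>R h ((1 / s) *\<^sub>R x)))\<^sup>2 - (l2norm lborel \<psi>)\<^sup>2 * (l2norm cell_measure h)\<^sup>2\<bar> \<le> C * s"
proof -
  have \<psi>s: "smooth \<psi>" by (rule test_functions_smooth[OF \<psi>])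
  have [measurable]: "\<psi> \<in> borel_measurable borel" by (rule smooth_measurable[OF \<psi>s])
  have \<psi>2: "(\<lambda>x. \<psi> x * \<psi> x) \<in> test_functions D" by (rule test_functions_mult[OF \<psi>s \<psi>])
  have p2: "periodic (\<lambda>x. (norm (h x))\<^sup>2)" by (rule periodic_compose[OF h(1), of "\<lambda>y. (norm y)\<^sup>2"])
  have i2: "integrable cell_measure (\<lambda>x. (norm (h x))\<^sup>2)" using h(2) by (simp add: sq_integrable_def)
  have m2: "(\<lambda>x. (norm (h x))\<^sup>2) \<in> borel_measurable borel" by measurable
  have e: "(norm (\<psi> x *\<^sub>R h ((1 / s) *\<^sub>R x)))\<^sup>2 = (\<psi> x * \<psi> x) * (norm (h ((1 / s) *\<^sub>R x)))\<^sup>2" for s x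
    by (simp add: power_mult_distrib power2_eq_square)
  show "sq_integrable lborel (\<lambda>x. \<psi> x *\<^sub>R h ((1 / s) *\<^sub>R x))" if s: "0 < s" "s \<le> 1"
  proof -
    obtain B R where b: "\<And>x. \<bar>\<psi> x * \<psi> x\<bar> \<le> B" "\<And>x. norm x > R \<Longrightarrow> \<psi> x * \<psi> x = 0"
      using \<psi>2 by (elim test_functions_bound) blast
    have "integrable lborel (\<lambda>x. (\<psi> x * \<psi> x) * (norm (h ((1 / s) *\<^sub>R x)))\<^sup>2)"
      by (rule product_integrable[OF _ m2 p2 i2 s b]) measurable
    then show ?thesis unfolding sq_integrable_def e by simp
  qed
  show "\<exists>C\<ge>0. \<forall>s. 0 < s \<longrightarrow> s \<le> 1 \<longrightarrow>
      \<bar>(l2norm lborel (\<lambda>x. \<psi> x *\<^sub>R h ((1 / s) *\<^sub>R x)))\<^sup>2 - (l2norm lborel \<psi>)\<^sup>2 * (l2norm cell_measure h)\<^sup>2\<bar> \<le> C * s"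
    using weak_limit[OF \<psi>2 m2 p2 i2] unfolding l2norm_sq e by (simp add: power2_eq_square)
qed

lemma product_gradient_bound:
  fixes \<Omega> :: "(real^'n) set"
  assumes \<Omega>: "open \<Omega>" "\<Omega> \<subseteq> cball 0 r" "r \<ge> 0" and b: "b \<in> test_functions \<Omega>"
  shows "\<exists>C\<ge>0. \<forall>w\<in>test_functions \<Omega>. l2norm lborel (grad (\<lambda>x. w x * b x)) \<le> C * l2norm lborel (grad w)"
proof -
  obtain B where B: "B \<ge> 0" "\<And>x. \<bar>b x\<bar> \<le> B" "\<And>x. norm (grad b x) \<le> B" using b by (elim test_functions_bound) blast
  have bs: "smooth b" by (rule test_functions_smooth[OF b])
  note [measurable] = smooth_measurable[OF bs] smooth_grad_measurable[OF bs]
  show ?thesis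
  proof (intro exI[of _ "B * (2 * r + 1) + B"] conjI ballI)
    show "0 \<le> B * (2 * r + 1) + B" using B \<Omega>(3) by simp
    fix w assume w: "w \<in> test_functions \<Omega>"
    have ws: "smooth w" by (rule test_functions_smooth[OF w])
    note [measurable] = smooth_measurable[OF ws] smooth_grad_measurable[OF ws]
    note sq = test_functions_integrable(3,4)[OF w sets.top]
    have g: "grad (\<lambda>x. w x * b x) = (\<lambda>x. w x *\<^sub>R grad b x + b x *\<^sub>R grad w x)"
      using grad_mult[OF smooth_differentiable[OF ws] smooth_differentiable[OF bs]] by auto
    have l1: "AE x in lborel. norm (w x *\<^sub>R grad b x) \<le> norm (B *\<^sub>R w x)"
      using B(1) mult_left_mono[OF B(3), of "\<bar>w _\<bar>"] by (simp add: abs_mult mult.commute)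
    have l2: "AE x in lborel. norm (b x *\<^sub>R grad w x) \<le> norm (B *\<^sub>R grad w x)"
      using B(1) mult_right_mono[OF B(2)] by (simp add: abs_mult)
    have s1: "sq_integrable lborel (\<lambda>x. w x *\<^sub>R grad b x)" "l2norm lborel (\<lambda>x. w x *\<^sub>R grad b x) \<le> B * l2norm lborel w"
    proof -
      show "sq_integrable lborel (\<lambda>x. w x *\<^sub>R grad b x)"
        by (rule sq_integrable_bound[OF sq_integrable_scale[OF sq(1), of B], of _ 1]) (use l1 in auto)
      have "l2norm lborel (\<lambda>x. w x *\<^sub>R grad b x) \<le> l2norm lborel (\<lambda>x. B *\<^sub>R w x)"
        by (rule l2norm_mono[OF sq_integrable_scale[OF sq(1), of B] _ l1]) simp
      then show "l2norm lborel (\<lambda>x. w x *\<^sub>R grad b x) \<le> B * l2norm lborel w"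
        unfolding l2norm_scale using B(1) by simp
    qed
    have s2: "sq_integrable lborel (\<lambda>x. b x *\<^sub>R grad w x)" "l2norm lborel (\<lambda>x. b x *\<^sub>R grad w x) \<le> B * l2norm lborel (grad w)"
    proof -
      show "sq_integrable lborel (\<lambda>x. b x *\<^sub>R grad w x)"
        by (rule sq_integrable_bound[OF sq_integrable_scale[OF sq(2), of B], of _ 1]) (use l2 in auto)
      have "l2norm lborel (\<lambda>x. b x *\<^sub>R grad w x) \<le> l2norm lborel (\<lambda>x. B *\<^sub>R grad w x)"
        by (rule l2norm_mono[OF sq_integrable_scale[OF sq(2), of B] _ l2]) simp
      then show "l2norm lborel (\<lambda>x. b x *\<^sub>R grad w x) \<le> B * l2norm lborel (grad w)"
        unfolding l2norm_scale using B(1) by simp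
    qed
    have "l2norm lborel (grad (\<lambda>x. w x * b x)) \<le> B * l2norm lborel w + B * l2norm lborel (grad w)"
      unfolding g using l2norm_triangle[OF s1(1) s2(1)] s1(2) s2(2) by linarith
    also have "\<dots> \<le> B * ((2 * r + 1) * l2norm lborel (grad w)) + B * l2norm lborel (grad w)"
      using Poincare_test[OF \<Omega> w] B(1) by (intro add_mono mult_left_mono) auto
    finally show "l2norm lborel (grad (\<lambda>x. w x * b x)) \<le> (B * (2 * r + 1) + B) * l2norm lborel (grad w)"
      by (simp add: algebra_simps)
  qed
qed

lemma vector_negative_order:
  fixes \<Omega> :: "(real^'n) set" and G :: "real^'n \<Rightarrow> real^'n"
  assumes \<Omega>: "open \<Omega>" "\<Omega> \<subseteq> cball 0 r" "r \<ge> 0" and \<psi>: "\<psi> \<in> test_functions \<Omega>"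
    and Gm [measurable]: "G \<in> borel_measurable borel" and G: "periodic G" "sq_integrable cell_measure G"
    and m: "\<And>i. m $ i = (LINT z|cell_measure. G z $ i)"
  shows "\<exists>C\<ge>0. \<forall>s w. 0 < s \<longrightarrow> s \<le> 1 \<longrightarrow> w \<in> test_functions \<Omega> \<longrightarrow>
    \<bar>(LINT x|lborel. w x * (G ((1 / s) *\<^sub>R x) \<bullet> grad \<psi> x)) - (LINT x|lborel. w x * (grad \<psi> x \<bullet> m))\<bar>
      \<le> C * s * l2norm lborel (grad w)"
    (is "\<exists>C\<ge>0. ?P C")
proof -
  define b where "b i x = grad \<psi> x $ i" for i x
  have b: "b i \<in> test_functions \<Omega>" for i
    using test_functions_grad[OF \<psi>, of "axis i 1"] by (simp add: b_def[abs_def] inner_axis)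
  define g where "g i x = G x $ i - m $ i" for i x
  have Gi [measurable]: "(\<lambda>x. G x $ i) \<in> borel_measurable borel" for i
  proof -
    have "(\<lambda>x. G x \<bullet> axis i 1) \<in> borel_measurable borel" by measurable
    then show ?thesis by (simp add: inner_axis)
  qed
  have gm: "g i \<in> borel_measurable borel" for i unfolding g_def[abs_def] by measurable
  have gp: "periodic (g i)" for i unfolding g_def[abs_def] by (rule periodic_compose[OF G(1), of "\<lambda>y. y $ i - m $ i"])
  have Gsq: "sq_integrable cell_measure (\<lambda>x. G x $ i)" for i by (rule sq_integrable_component[OF G(2)])
  have gsq: "sq_integrable cell_measure (g i)" for i unfolding g_def[abs_def]
    by (rule sq_integrable_diff[OF Gsq]) (simp add: sq_integrable_def)
  have gmean: "(LINT z|cell_measure. g i z) = 0" for i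
    unfolding g_def using sq_integrable_cell_integrable[OF Gsq[of i]] m[of i] by simp
  have "\<exists>C\<ge>0. \<forall>s w. 0 < s \<longrightarrow> s \<le> 1 \<longrightarrow> w \<in> test_functions \<Omega> \<longrightarrow>
    \<bar>LINT x|lborel. (w x * b i x) * g i ((1 / s) *\<^sub>R x)\<bar> \<le> C * s * l2norm lborel (grad w)" for i
  proof -
    obtain C1 where C1: "C1 \<ge> 0" and *: "\<forall>s p. 0 < s \<longrightarrow> s \<le> 1 \<longrightarrow> p \<in> test_functions UNIV \<longrightarrow> (\<forall>x. norm x > r \<longrightarrow> p x = 0) \<longrightarrow>
      \<bar>LINT x|lborel. p x * g i ((1 / s) *\<^sub>R x)\<bar> \<le> C1 * s * l2norm lborel (grad p)"
      using negative_order_bound[OF gm[of i] gp[of i] gsq[of i] gmean[of i], where R = r] by (elim exE conjE) (rule that; assumption)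
    obtain C2 where C2: "C2 \<ge> 0" "\<forall>w\<in>test_functions \<Omega>. l2norm lborel (grad (\<lambda>x. w x * b i x)) \<le> C2 * l2norm lborel (grad w)"
      using product_gradient_bound[OF \<Omega> b[of i]] by (elim exE conjE) (rule that; assumption)
    show ?thesis
    proof (intro exI[of _ "C1 * C2"] conjI allI impI)
      show "0 \<le> C1 * C2" using C1 C2 by simp
      fix s :: real and w assume s: "0 < s" "s \<le> 1" and w: "w \<in> test_functions \<Omega>"
      have t: "(\<lambda>x. w x * b i x) \<in> test_functions \<Omega>" by (rule test_functions_mult[OF test_functions_smooth[OF w] b])
      have z: "w x * b i x = 0" if "norm x > r" for x
      proof -
        have "x \<notin> \<Omega>" using that \<Omega>(2) by auto
        then show ?thesis by (rule test_functions_zero_outside(1)[OF t])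
      qed
      have "\<bar>LINT x|lborel. (w x * b i x) * g i ((1 / s) *\<^sub>R x)\<bar> \<le> C1 * s * l2norm lborel (grad (\<lambda>x. w x * b i x))"
        using *[rule_format, OF s test_functions_mono[OF subset_UNIV t] z] by simp
      also have "\<dots> \<le> C1 * s * (C2 * l2norm lborel (grad w))"
        using C1 C2 s w by (intro mult_left_mono) auto
      finally show "\<bar>LINT x|lborel. (w x * b i x) * g i ((1 / s) *\<^sub>R x)\<bar> \<le> C1 * C2 * s * l2norm lborel (grad w)"
        by (simp add: mult_ac)
    qed
  qed
  then have "\<exists>C. \<forall>i. C i \<ge> 0 \<and> (\<forall>s w. 0 < s \<longrightarrow> s \<le> 1 \<longrightarrow> w \<in> test_functions \<Omega> \<longrightarrow>
    \<bar>LINT x|lborel. (w x * b i x) * g i ((1 / s) *\<^sub>R x)\<bar> \<le> C i * s * l2norm lborel (grad w))"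
    by (intro choice allI)
  then obtain C where C: "\<forall>i. C i \<ge> 0 \<and> (\<forall>s w. 0 < s \<longrightarrow> s \<le> 1 \<longrightarrow> w \<in> test_functions \<Omega> \<longrightarrow>
    \<bar>LINT x|lborel. (w x * b i x) * g i ((1 / s) *\<^sub>R x)\<bar> \<le> C i * s * l2norm lborel (grad w))"
    by (rule exE)
  show ?thesis
  proof (intro exI[of _ "\<Sum>i\<in>UNIV. C i"] conjI allI impI)
    show "0 \<le> (\<Sum>i\<in>UNIV. C i)" using C by (intro sum_nonneg) auto
    fix s :: real and w assume s: "0 < s" "s \<le> 1" and w: "w \<in> test_functions \<Omega>"
    have t: "(\<lambda>x. w x * b i x) \<in> test_functions \<Omega>" for i by (rule test_functions_mult[OF test_functions_smooth[OF w] b])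
    have ti: "integrable lborel (\<lambda>x. w x * b i x)" for i by (rule test_functions_integrable(5)[OF t sets.top])
    have tg: "integrable lborel (\<lambda>x. (w x * b i x) * g i ((1 / s) *\<^sub>R x))" for i
    proof -
      obtain B R where B: "\<And>x. \<bar>w x * b i x\<bar> \<le> B" "\<And>x. norm x > R \<Longrightarrow> w x * b i x = 0"
        using t[of i] by (elim test_functions_bound) blast
      show ?thesis
        by (rule product_integrable[OF smooth_measurable[OF test_functions_smooth[OF t]] gm gp
              sq_integrable_cell_integrable[OF gsq] s B])
    qed
    have e1: "w x * (G ((1 / s) *\<^sub>R x) \<bullet> grad \<psi> x)
      = (\<Sum>i\<in>UNIV. (w x * b i x) * g i ((1 / s) *\<^sub>R x)) + (\<Sum>i\<in>UNIV. m $ i * (w x * b i x))" for x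
      by (simp add: inner_vec_def b_def g_def sum.distrib[symmetric] sum_distrib_left algebra_simps)
    have e2: "w x * (grad \<psi> x \<bullet> m) = (\<Sum>i\<in>UNIV. m $ i * (w x * b i x))" for x
      by (simp add: inner_vec_def b_def sum_distrib_left algebra_simps)
    have "(LINT x|lborel. w x * (G ((1 / s) *\<^sub>R x) \<bullet> grad \<psi> x)) - (LINT x|lborel. w x * (grad \<psi> x \<bullet> m))
      = (\<Sum>i\<in>UNIV. LINT x|lborel. (w x * b i x) * g i ((1 / s) *\<^sub>R x))"
      unfolding e1 e2 using ti tg by simp
    also have "\<bar>\<dots>\<bar> \<le> (\<Sum>i\<in>UNIV. \<bar>LINT x|lborel. (w x * b i x) * g i ((1 / s) *\<^sub>R x)\<bar>)" by (rule sum_abs)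
    also have "\<dots> \<le> (\<Sum>i\<in>UNIV. C i * s * l2norm lborel (grad w))"
      using C s w by (intro sum_mono) auto
    finally show "\<bar>(LINT x|lborel. w x * (G ((1 / s) *\<^sub>R x) \<bullet> grad \<psi> x)) - (LINT x|lborel. w x * (grad \<psi> x \<bullet> m))\<bar>
      \<le> (\<Sum>i\<in>UNIV. C i) * s * l2norm lborel (grad w)" by (simp add: sum_distrib_right)
  qed
qed

lemma AE_generic_scaled: "c \<noteq> 0 \<Longrightarrow> AE x in lborel. generic (c *\<^sub>R (x :: real^'n))"
proof -
  assume c: "c \<noteq> 0"
  have "AE x in density (distr lborel borel (\<lambda>x. 0 + c *\<^sub>R x)) (\<lambda>_. ennreal (\<bar>c\<bar> ^ DIM(real^'n))). generic (x :: real^'n)"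
    unfolding lborel_affine[OF c, of "0::real^'n", symmetric] by (rule AE_generic)
  then have "AE x in distr lborel borel (\<lambda>x. 0 + c *\<^sub>R x). generic (x :: real^'n)"
    using c by (subst (asm) AE_density) auto
  from AE_distrD[OF _ this] show ?thesis by simp
qed

lemma inclusions_open:
  assumes "open \<omega>" "s > 0" shows "open (inclusions \<Omega> \<omega> s)"
proof -
  have "rescale s \<xi> \<omega> = (\<lambda>x. s *\<^sub>R \<xi> + s *\<^sub>R x) ` \<omega>" for \<xi> by (simp add: rescale_def scaleR_add_right)
  moreover have "open ((\<lambda>x. s *\<^sub>R \<xi> + s *\<^sub>R x) ` \<omega>)" for \<xi>
    using open_translation[OF open_scaling[of s \<omega>], of "s *\<^sub>R \<xi>"] assms by (simp add: image_image)
  ultimately show ?thesis unfolding inclusions_def by auto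
qed

lemma inclusions_subset:
  assumes "\<omega> \<subseteq> unit_cell" shows "inclusions \<Omega> \<omega> s \<subseteq> \<Omega>"
proof
  fix x assume "x \<in> inclusions \<Omega> \<omega> s"
  then obtain \<xi> where \<xi>: "rescale s \<xi> unit_cell \<Subset> \<Omega>" "x \<in> rescale s \<xi> \<omega>"
    by (auto simp: inclusions_def cell_indices_def)
  then have "x \<in> rescale s \<xi> unit_cell" using assms by (auto simp: rescale_def)
  then show "x \<in> \<Omega>" using \<xi>(1) closure_subset unfolding compactly_contained_def by blast
qed

lemma inclusions_periodic:
  fixes \<omega> :: "(real^'n) set"
  assumes \<omega>: "\<omega> \<subseteq> unit_cell" and s: "s > 0" and x: "ball x d \<subseteq> \<Omega>" "s * (2 * real CARD('n)) < d"
    and gen: "generic ((1 / s) *\<^sub>R x)"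
  shows "x \<in> inclusions \<Omega> \<omega> s \<longleftrightarrow> frac_vec ((1 / s) *\<^sub>R x) \<in> \<omega>"
proof
  assume "x \<in> inclusions \<Omega> \<omega> s"
  then obtain \<xi> y where \<xi>: "\<xi> \<in> lattice_points" "y \<in> \<omega>" "x = s *\<^sub>R (\<xi> + y)"
    by (auto simp: inclusions_def cell_indices_def rescale_def)
  have xs: "(1 / s) *\<^sub>R x - \<xi> = y" using s by (simp add: \<xi>(3))
  then have "\<xi> = floor_vec ((1 / s) *\<^sub>R x)" using generic_cell[OF gen \<xi>(1)] \<xi>(2) \<omega> by auto
  then show "frac_vec ((1 / s) *\<^sub>R x) \<in> \<omega>" using xs \<xi>(2) by (simp add: frac_vec_def)
next
  assume f: "frac_vec ((1 / s) *\<^sub>R x) \<in> \<omega>"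
  define \<xi> where "\<xi> = floor_vec ((1 / s) *\<^sub>R x)"
  define y where "y = frac_vec ((1 / s) *\<^sub>R x)"
  have xe: "x = s *\<^sub>R (\<xi> + y)" using s by (simp add: \<xi>_def y_def frac_vec_def)
  have y: "y \<in> unit_cell" using f \<omega> by (auto simp: y_def)
  have sub: "rescale s \<xi> unit_cell \<subseteq> cball x (s * (2 * real CARD('n)))"
  proof
    fix z assume "z \<in> rescale s \<xi> unit_cell"
    then obtain y' where y': "y' \<in> unit_cell" "z = s *\<^sub>R (\<xi> + y')" by (auto simp: rescale_def)
    have "dist x z = norm (s *\<^sub>R (y - y'))" unfolding xe y'(2) dist_norm by (simp add: algebra_simps)
    also have "\<dots> \<le> s * (norm y + norm y')" using s norm_triangle_ineq4[of y y'] by (simp add: mult_left_mono)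
    also have "\<dots> \<le> s * (2 * real CARD('n))" using s norm_unit_cell[OF y] norm_unit_cell[OF y'(1)]
      by (intro mult_left_mono) auto
    finally show "z \<in> cball x (s * (2 * real CARD('n)))" by simp
  qed
  then have "closure (rescale s \<xi> unit_cell) \<subseteq> cball x (s * (2 * real CARD('n)))" by (intro closure_minimal) auto
  also have "\<dots> \<subseteq> ball x d" using x(2) by auto
  finally have "closure (rescale s \<xi> unit_cell) \<subseteq> \<Omega>" using x(1) by blast
  moreover have "bounded (rescale s \<xi> unit_cell)" by (rule bounded_subset[OF bounded_cball sub])
  ultimately have "rescale s \<xi> unit_cell \<Subset> \<Omega>" by (simp add: compactly_contained_def compact_closure)
  then have "\<xi> \<in> cell_indices \<Omega> s" by (simp add: cell_indices_def \<xi>_def floor_vec_lattice)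
  moreover have "x \<in> rescale s \<xi> \<omega>" using xe f by (auto simp: rescale_def y_def)
  ultimately show "x \<in> inclusions \<Omega> \<omega> s" by (auto simp: inclusions_def)
qed

lemma eps_spectrum_near:
  fixes \<Omega> \<omega> :: "(real^'n) set"
  assumes n: "CARD('n) \<ge> 2" and \<Omega>: "open \<Omega>" "\<Omega> \<noteq> {}" "\<Omega> \<subseteq> cball 0 r" "r \<ge> 0"
    and \<omega>: "open \<omega>" "\<omega> \<subseteq> unit_cell" and \<mu>: "\<mu> \<in> cell_spectrum \<omega>" and \<delta>: "\<delta> > 0"
  shows "eventually (\<lambda>s. \<exists>\<nu>\<in>spectrum_eps \<Omega> \<omega> s. \<bar>\<nu> - \<mu>\<bar> \<le> 3 * \<delta>) (at_right 0)"
proof -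
  have \<omega>b [measurable]: "\<omega> \<in> sets borel" using \<omega>(1) by simp
  interpret E: gradient_space \<Omega> "test_functions \<Omega>" 0 "2 * r + 1" by (rule test_space[OF \<Omega>(1,3,4)])
  have EH: "E.H = H10_space \<Omega>"
    by (simp add: E.H_def E.eqv_def E.X_def H10_space_def H10_def)
  have ET: "E.T (inclusions \<Omega> \<omega> s) = T_eps \<Omega> \<omega> s" for s
    by (simp add: fun_eq_iff E.T_def T_eps_def EH)
  obtain \<phi> R where \<phi>: "\<phi> \<in> smooth_periodic" and Rm [measurable]: "R \<in> borel_measurable borel"
    and R: "periodic R" "sq_integrable cell_measure R" and L0: "l2norm cell_measure (grad \<phi>) > 0"
    and RL: "l2norm cell_measure R \<le> \<delta> * l2norm cell_measure (grad \<phi>)"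
    and orth: "\<forall>v\<in>smooth_periodic. (LINT y|cell_measure. (cell_field \<omega> \<mu> \<phi> y - R y) \<bullet> grad v y) = 0"
    using cell_quasimode[OF \<mu> \<omega>b \<omega>(2) \<delta>] by (elim exE conjE) (rule that; assumption)
  define L where "L = l2norm cell_measure (grad \<phi>)"
  have L: "L > 0" using L0 by (simp add: L_def)
  note \<phi>s = smooth_periodicD[OF \<phi>]
  note [measurable] = smooth_periodic_measurable[OF \<phi>]
  obtain B where B: "B \<ge> 0" "\<And>x. \<bar>\<phi> x\<bar> \<le> B" using \<phi> by (elim smooth_periodic_bounded) blast
  define F where "F = cell_field \<omega> \<mu> \<phi>"
  have Fm [measurable]: "F \<in> borel_measurable borel" and F: "periodic F" "sq_integrable cell_measure F"
    using cell_field[OF \<omega>b \<phi>, of \<mu>] by (auto simp: F_def)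
  define G where "G x = F x - R x" for x
  have Gm [measurable]: "G \<in> borel_measurable borel" unfolding G_def by measurable
  have Gp: "periodic G" using F(1) R(1) by (auto simp: periodic_def G_def)
  have Gsq: "sq_integrable cell_measure G" unfolding G_def by (rule sq_integrable_diff[OF F(2) R(2)])
  have Gorth: "(LINT y|cell_measure. G y \<bullet> grad v y) = 0" if "v \<in> smooth_periodic" for v
    using orth that by (simp add: G_def F_def)
  define m where "m = (\<chi> i. LINT z|cell_measure. G z $ i)"
  have m_comp: "m $ i = (LINT z|cell_measure. G z $ i)" for i by (simp add: m_def)
  obtain e :: "real^'n" where e: "norm e = 1" "e \<bullet> m = 0"
  proof -
    obtain y :: "real^'n" where y: "y \<noteq> 0" "orthogonal m y"
      using orthogonal_to_vector_exists[of m] n by auto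
    show ?thesis by (rule that[of "(1 / norm y) *\<^sub>R y"]) (use y in \<open>auto simp: orthogonal_def inner_commute\<close>)
  qed
  obtain \<psi> where \<psi>: "\<psi> \<in> test_functions \<Omega>" and \<psi>pos: "l2norm lborel \<psi> > 0"
    and \<psi>w: "\<forall>w\<in>test_functions \<Omega>. \<bar>LINT x|lborel. w x * (grad \<psi> x \<bullet> m)\<bar> \<le> (\<delta> * L) * l2norm lborel \<psi> * l2norm lborel (grad w)"
    using amplitude[OF \<Omega> e mult_pos_pos[OF \<delta> L]] by (elim bexE conjE) (rule that; assumption)
  have \<psi>s: "smooth \<psi>" by (rule test_functions_smooth[OF \<psi>])
  have \<psi>m [measurable]: "\<psi> \<in> borel_measurable borel" "grad \<psi> \<in> borel_measurable borel"
    using smooth_measurable[OF \<psi>s] smooth_grad_measurable[OF \<psi>s] by auto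
  define A where "A = l2norm lborel \<psi>"
  have A: "A > 0" using \<psi>pos by (simp add: A_def)
  define N\<psi> where "N\<psi> = l2norm lborel (grad \<psi>)"
  have g\<psi>sq: "sq_integrable lborel (grad \<psi>)" by (rule test_functions_integrable(4)[OF \<psi> sets.top])
  obtain K where K: "compact K" "K \<subseteq> \<Omega>" "\<And>x. x \<notin> K \<Longrightarrow> \<psi> x = 0"
    using \<psi> by (elim test_functionsE) blast
  obtain d where d: "d > 0" "(\<Union>x\<in>K. ball x d) \<subseteq> \<Omega>"
    using compact_subset_open_imp_ball_epsilon_subset[OF K(1) \<Omega>(1) K(2)] by blast
  obtain C1 where C1: "C1 \<ge> 0" "\<forall>s w. 0 < s \<longrightarrow> s \<le> 1 \<longrightarrow> w \<in> test_functions \<Omega> \<longrightarrow>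
    \<bar>(LINT x|lborel. w x * (G ((1 / s) *\<^sub>R x) \<bullet> grad \<psi> x)) - (LINT x|lborel. w x * (grad \<psi> x \<bullet> m))\<bar>
      \<le> C1 * s * l2norm lborel (grad w)"
    using vector_negative_order[OF \<Omega>(1,3,4) \<psi> Gm Gp Gsq m_comp] by (elim exE conjE) (rule that; assumption)
  obtain C2 where C2: "C2 \<ge> 0" "\<forall>s. 0 < s \<longrightarrow> s \<le> 1 \<longrightarrow>
      \<bar>(l2norm lborel (\<lambda>x. \<psi> x *\<^sub>R R ((1 / s) *\<^sub>R x)))\<^sup>2 - (l2norm lborel \<psi>)\<^sup>2 * (l2norm cell_measure R)\<^sup>2\<bar> \<le> C2 * s"
    using scaled_sq_integrable(2)[OF \<psi> Rm R] by (elim exE conjE) (rule that; assumption)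
  obtain C3 where C3: "C3 \<ge> 0" "\<forall>s. 0 < s \<longrightarrow> s \<le> 1 \<longrightarrow>
      \<bar>(l2norm lborel (\<lambda>x. \<psi> x *\<^sub>R grad \<phi> ((1 / s) *\<^sub>R x)))\<^sup>2 - (l2norm lborel \<psi>)\<^sup>2 * (l2norm cell_measure (grad \<phi>))\<^sup>2\<bar> \<le> C3 * s"
    using scaled_sq_integrable(2)[OF \<psi> smooth_periodic_measurable(2)[OF \<phi>] \<phi>s(3) smooth_periodic_sq_integrable(2)[OF \<phi>]]
    by (elim exE conjE) (rule that; assumption)
  define M where "M = 1 + \<bar>\<mu>\<bar>"
  define num where "num s = sqrt (A\<^sup>2 * (\<delta> * L)\<^sup>2 + C2 * s) + (\<delta> * L * A + C1 * s) + s * (M * B * N\<psi>)" for s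
  define den where "den s = sqrt (A\<^sup>2 * L\<^sup>2 - C3 * s) - s * (B * N\<psi>)" for s
  have key: "\<exists>\<nu>\<in>spectrum_eps \<Omega> \<omega> s. \<bar>\<nu> - \<mu>\<bar> \<le> 3 * \<delta>"
    if s: "0 < s" "s \<le> 1" "s * (2 * real CARD('n)) < d" and small: "num s \<le> 3 * \<delta> * den s" "den s > 0" for s
  proof -
    let ?I = "inclusions \<Omega> \<omega> s"
    have Io: "open ?I" by (rule inclusions_open[OF \<omega>(1) s(1)])
    have Isub: "?I \<subseteq> \<Omega>" by (rule inclusions_subset[OF \<omega>(2)])
    have Ib [measurable]: "?I \<in> sets borel" using Io by simp
    define u where "u x = \<phi> ((1 / s) *\<^sub>R x)" for x
    have us: "smooth u" unfolding u_def[abs_def] by (rule smooth_scale[OF \<phi>s(1)])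
    have um [measurable]: "u \<in> borel_measurable borel" by (rule smooth_measurable[OF us])
    have sus: "smooth (\<lambda>x. s * u x)" by (intro smooth_mult smooth_const us)
    define v where "v x = (s * u x) * \<psi> x" for x
    have v: "v \<in> test_functions \<Omega>" unfolding v_def[abs_def] by (rule test_functions_mult[OF sus \<psi>])
    have gsu: "grad (\<lambda>x. s * u x) x = grad \<phi> ((1 / s) *\<^sub>R x)" for x
      using grad_cmult[OF smooth_differentiable[OF us], of s x] grad_scale[OF \<phi>s(1), of "1 / s" x] s(1)
      by (simp add: u_def[abs_def])
    define \<Phi> where "\<Phi> x = \<psi> x *\<^sub>R grad \<phi> ((1 / s) *\<^sub>R x)" for x
    define Z where "Z x = u x *\<^sub>R grad \<psi> x" for x
    have gv: "grad v x = \<Phi> x + s *\<^sub>R Z x" for x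
      unfolding v_def[abs_def]
      using grad_mult[OF smooth_differentiable[OF sus] smooth_differentiable[OF \<psi>s], of x]
      by (simp add: gsu \<Phi>_def Z_def)
    have \<Phi>sq: "sq_integrable lborel \<Phi>" unfolding \<Phi>_def[abs_def]
      by (rule scaled_sq_integrable(1)[OF \<psi> smooth_periodic_measurable(2)[OF \<phi>] \<phi>s(3) smooth_periodic_sq_integrable(2)[OF \<phi>] s(1,2)])
    have Zbound: "sq_integrable lborel (\<lambda>x. k x *\<^sub>R Z x)" "l2norm lborel (\<lambda>x. k x *\<^sub>R Z x) \<le> c * B * N\<psi>"
      if [measurable]: "k \<in> borel_measurable borel" and k: "\<And>x. \<bar>k x\<bar> \<le> c" "c \<ge> 0" for k c
    proof -
      have km: "(\<lambda>x. k x *\<^sub>R Z x) \<in> borel_measurable lborel" unfolding Z_def by simp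
      have le: "AE x in lborel. norm (k x *\<^sub>R Z x) \<le> norm ((c * B) *\<^sub>R grad \<psi> x)"
      proof (intro AE_I2)
        fix x
        have "\<bar>k x\<bar> * \<bar>u x\<bar> \<le> c * B" using k B(2)[of "(1 / s) *\<^sub>R x"] by (intro mult_mono) (auto simp: u_def)
        then have "(\<bar>k x\<bar> * \<bar>u x\<bar>) * norm (grad \<psi> x) \<le> (c * B) * norm (grad \<psi> x)" by (intro mult_right_mono) auto
        then show "norm (k x *\<^sub>R Z x) \<le> norm ((c * B) *\<^sub>R grad \<psi> x)" using k(2) B(1) by (simp add: Z_def abs_mult mult_ac)
      qed
      show "sq_integrable lborel (\<lambda>x. k x *\<^sub>R Z x)"
        by (rule sq_integrable_bound[OF sq_integrable_scale[OF g\<psi>sq, of "c * B"] km, of 1]) (use le in auto)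
      have "l2norm lborel (\<lambda>x. k x *\<^sub>R Z x) \<le> l2norm lborel (\<lambda>x. (c * B) *\<^sub>R grad \<psi> x)"
        by (rule l2norm_mono[OF sq_integrable_scale[OF g\<psi>sq] km le])
      then show "l2norm lborel (\<lambda>x. k x *\<^sub>R Z x) \<le> c * B * N\<psi>"
        unfolding l2norm_scale using k(2) B(1) by (simp add: N\<psi>_def)
    qed
    have den_le: "den s \<le> l2norm lborel (grad v)"
    proof -
      have gvsq: "sq_integrable lborel (grad v)" by (rule test_functions_integrable(4)[OF v sets.top])
      have sZ: "sq_integrable lborel (\<lambda>x. (- s) *\<^sub>R Z x)" "l2norm lborel (\<lambda>x. (- s) *\<^sub>R Z x) \<le> s * B * N\<psi>"
        using Zbound[of "\<lambda>_. - s" s] s(1) by auto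
      have "l2norm lborel (\<lambda>x. grad v x + (- s) *\<^sub>R Z x) \<le> l2norm lborel (grad v) + s * B * N\<psi>"
        using l2norm_triangle[OF gvsq sZ(1)] sZ(2) by linarith
      then have "l2norm lborel \<Phi> \<le> l2norm lborel (grad v) + s * (B * N\<psi>)" by (simp add: gv mult.assoc)
      moreover have "A\<^sup>2 * L\<^sup>2 - C3 * s \<le> (l2norm lborel \<Phi>)\<^sup>2"
        using C3(2)[rule_format, OF s(1,2)] by (simp add: A_def L_def \<Phi>_def[abs_def] abs_le_iff)
      then have "sqrt (A\<^sup>2 * L\<^sup>2 - C3 * s) \<le> l2norm lborel \<Phi>"
        using real_sqrt_le_mono[of "A\<^sup>2 * L\<^sup>2 - C3 * s" "(l2norm lborel \<Phi>)\<^sup>2"] by simp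
      ultimately show ?thesis by (simp add: den_def)
    qed
    have est: "\<bar>(LINT x|lebesgue_on ?I. grad v x \<bullet> grad w x) - \<mu> * (LINT x|lebesgue_on \<Omega>. grad v x \<bullet> grad w x)\<bar>
      \<le> num s * l2norm lborel (grad w)" if w: "w \<in> test_functions \<Omega>" for w
    proof -
      have ws: "smooth w" by (rule test_functions_smooth[OF w])
      note [measurable] = smooth_measurable[OF ws] smooth_grad_measurable[OF ws]
        smooth_grad_measurable[OF test_functions_smooth[OF v]]
      note gwsq = test_functions_integrable(4)[OF w sets.top] and gvsq = test_functions_integrable(4)[OF v sets.top]
      define W where "W = l2norm lborel (grad w)"
      have W0: "W \<ge> 0" by (simp add: W_def)
      define k where "k x = indicator ?I x - \<mu>" for x
      have km [measurable]: "k \<in> borel_measurable borel" unfolding k_def by measurable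
      have kb: "\<bar>k x\<bar> \<le> M" for x by (auto simp: k_def M_def indicator_def)
      have vw: "integrable lborel (\<lambda>x. grad v x \<bullet> grad w x)" by (rule sq_integrable_inner[OF gvsq gwsq])
      have vwI: "integrable lborel (\<lambda>x. indicator ?I x *\<^sub>R (grad v x \<bullet> grad w x))"
        by (rule integrable_mult_indicator[OF _ vw]) simp
      have "(LINT x|lebesgue_on \<Omega>. grad v x \<bullet> grad w x) = (LINT x|lborel. grad v x \<bullet> grad w x)"
        by (rule integral_test_lborel[OF \<Omega>(1)]) (auto simp: test_functions_zero_outside[OF v])
      moreover have "(LINT x|lebesgue_on ?I. grad v x \<bullet> grad w x) = (LINT x|lborel. indicator ?I x *\<^sub>R (grad v x \<bullet> grad w x))"
        by (rule lebesgue_on_integral_lborel) auto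
      ultimately have q1: "(LINT x|lebesgue_on ?I. grad v x \<bullet> grad w x) - \<mu> * (LINT x|lebesgue_on \<Omega>. grad v x \<bullet> grad w x)
        = (LINT x|lborel. k x * (grad v x \<bullet> grad w x))"
        using vw vwI by (simp add: k_def left_diff_distrib)
      define \<rho> where "\<rho> x = \<psi> x *\<^sub>R R ((1 / s) *\<^sub>R x)" for x
      define \<gamma> where "\<gamma> x = \<psi> x *\<^sub>R G ((1 / s) *\<^sub>R x)" for x
      have \<rho>sq: "sq_integrable lborel \<rho>" unfolding \<rho>_def[abs_def] by (rule scaled_sq_integrable(1)[OF \<psi> Rm R s(1,2)])
      have \<gamma>sq: "sq_integrable lborel \<gamma>" unfolding \<gamma>_def[abs_def] by (rule scaled_sq_integrable(1)[OF \<psi> Gm Gp Gsq s(1,2)])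
      have Zk: "sq_integrable lborel (\<lambda>x. k x *\<^sub>R Z x)" "l2norm lborel (\<lambda>x. k x *\<^sub>R Z x) \<le> M * B * N\<psi>"
        using Zbound[OF km kb] by (auto simp: M_def)
      have [measurable]: "\<rho> \<in> borel_measurable borel" "\<gamma> \<in> borel_measurable borel" "(\<lambda>x. k x *\<^sub>R Z x) \<in> borel_measurable borel"
        using \<rho>sq \<gamma>sq Zk(1) by (auto simp: sq_integrable_def)
      have i: "integrable lborel (\<lambda>x. \<rho> x \<bullet> grad w x)" "integrable lborel (\<lambda>x. \<gamma> x \<bullet> grad w x)"
        "integrable lborel (\<lambda>x. (k x *\<^sub>R Z x) \<bullet> grad w x)"
        by (intro sq_integrable_inner \<rho>sq \<gamma>sq Zk gwsq)+
      have "(LINT x|lborel. k x * (grad v x \<bullet> grad w x))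
        = (LINT x|lborel. \<rho> x \<bullet> grad w x + \<gamma> x \<bullet> grad w x + s * ((k x *\<^sub>R Z x) \<bullet> grad w x))"
      proof (rule integral_cong_AE)
        have "1 / s \<noteq> 0" using s(1) by simp
        from AE_generic_scaled[OF this]
        show "AE x in lborel. k x * (grad v x \<bullet> grad w x) = \<rho> x \<bullet> grad w x + \<gamma> x \<bullet> grad w x + s * ((k x *\<^sub>R Z x) \<bullet> grad w x)"
        proof eventually_elim
          case (elim x)
          have "k x *\<^sub>R \<Phi> x = \<rho> x + \<gamma> x"
          proof (cases "x \<in> K")
            case True
            then have "ball x d \<subseteq> \<Omega>" using d(2) by blast
            from inclusions_periodic[OF \<omega>(2) s(1) this s(3) elim]
            have "k x = indicator \<omega> (frac_vec ((1 / s) *\<^sub>R x)) - \<mu>" by (simp add: k_def indicator_def)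
            then have "k x *\<^sub>R grad \<phi> ((1 / s) *\<^sub>R x) = F ((1 / s) *\<^sub>R x)" by (simp add: F_def cell_field_def)
            then have "\<psi> x *\<^sub>R (k x *\<^sub>R grad \<phi> ((1 / s) *\<^sub>R x)) = \<psi> x *\<^sub>R F ((1 / s) *\<^sub>R x)" by (rule arg_cong)
            then show ?thesis
              by (simp add: \<Phi>_def \<rho>_def \<gamma>_def G_def scaleR_diff_right mult.commute)
          qed (simp add: K(3) \<Phi>_def \<rho>_def \<gamma>_def)
          then have "k x *\<^sub>R grad v x = \<rho> x + \<gamma> x + s *\<^sub>R (k x *\<^sub>R Z x)"
            by (simp add: gv scaleR_add_right scaleR_left_commute[of s])
          then have "(k x *\<^sub>R grad v x) \<bullet> grad w x = (\<rho> x + \<gamma> x + s *\<^sub>R (k x *\<^sub>R Z x)) \<bullet> grad w x" by simp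
          then show ?case by (simp add: inner_add_left)
        qed
      qed measurable
      also have "\<dots> = (LINT x|lborel. \<rho> x \<bullet> grad w x) + (LINT x|lborel. \<gamma> x \<bullet> grad w x) + s * (LINT x|lborel. (k x *\<^sub>R Z x) \<bullet> grad w x)"
        using i by simp
      finally have q2: "(LINT x|lborel. k x * (grad v x \<bullet> grad w x))
        = (LINT x|lborel. \<rho> x \<bullet> grad w x) + (LINT x|lborel. \<gamma> x \<bullet> grad w x) + s * (LINT x|lborel. (k x *\<^sub>R Z x) \<bullet> grad w x)" .
      have t1: "\<bar>LINT x|lborel. \<rho> x \<bullet> grad w x\<bar> \<le> sqrt (A\<^sup>2 * (\<delta> * L)\<^sup>2 + C2 * s) * W"
      proof -
        have "(l2norm lborel \<rho>)\<^sup>2 \<le> A\<^sup>2 * (l2norm cell_measure R)\<^sup>2 + C2 * s"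
          using C2(2)[rule_format, OF s(1,2)] by (simp add: A_def \<rho>_def[abs_def] abs_le_iff)
        also have "\<dots> \<le> A\<^sup>2 * (\<delta> * L)\<^sup>2 + C2 * s"
          using RL by (intro add_right_mono mult_left_mono power_mono) (auto simp: L_def)
        finally have "l2norm lborel \<rho> \<le> sqrt (A\<^sup>2 * (\<delta> * L)\<^sup>2 + C2 * s)" by (rule real_le_rsqrt)
        then show ?thesis
          using inner_integral_le[OF \<rho>sq gwsq] mult_right_mono[OF _ W0] unfolding W_def by fastforce
      qed
      have t3: "\<bar>LINT x|lborel. (k x *\<^sub>R Z x) \<bullet> grad w x\<bar> \<le> (M * B * N\<psi>) * W"
        using inner_integral_le[OF Zk(1) gwsq] mult_right_mono[OF Zk(2) W0] unfolding W_def by linarith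
      have t2: "\<bar>LINT x|lborel. \<gamma> x \<bullet> grad w x\<bar> \<le> (\<delta> * L * A + C1 * s) * W"
      proof -
        have p: "(\<lambda>x. w x * \<psi> x) \<in> test_functions \<Omega>" by (rule test_functions_mult[OF ws \<psi>])
        have gp: "grad (\<lambda>x. w x * \<psi> x) x = w x *\<^sub>R grad \<psi> x + \<psi> x *\<^sub>R grad w x" for x
          by (rule grad_mult[OF smooth_differentiable[OF ws] smooth_differentiable[OF \<psi>s]])
        have ge: "G ((1 / s) *\<^sub>R x) \<bullet> grad (\<lambda>x. w x * \<psi> x) x = w x * (G ((1 / s) *\<^sub>R x) \<bullet> grad \<psi> x) + \<gamma> x \<bullet> grad w x" for x
          by (simp add: gp inner_add_right \<gamma>_def)
        have iw: "integrable lborel (\<lambda>x. w x * (G ((1 / s) *\<^sub>R x) \<bullet> grad \<psi> x))"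
        proof -
          have "integrable lborel (\<lambda>x. (w x *\<^sub>R G ((1 / s) *\<^sub>R x)) \<bullet> grad \<psi> x)"
            by (rule sq_integrable_inner[OF scaled_sq_integrable(1)[OF w Gm Gp Gsq s(1,2)] g\<psi>sq])
          then show ?thesis by simp
        qed
        have "0 = (LINT x|lborel. G ((1 / s) *\<^sub>R x) \<bullet> grad (\<lambda>x. w x * \<psi> x) x)"
          by (rule divergence_free_scaled[OF Gm Gp Gsq Gorth test_functions_mono[OF subset_UNIV p] s(1), symmetric])
        also have "\<dots> = (LINT x|lborel. w x * (G ((1 / s) *\<^sub>R x) \<bullet> grad \<psi> x)) + (LINT x|lborel. \<gamma> x \<bullet> grad w x)"
          unfolding ge using iw i(2) by simp
        finally have "(LINT x|lborel. \<gamma> x \<bullet> grad w x) = - (LINT x|lborel. w x * (G ((1 / s) *\<^sub>R x) \<bullet> grad \<psi> x))" by simp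
        moreover have "\<bar>(LINT x|lborel. w x * (G ((1 / s) *\<^sub>R x) \<bullet> grad \<psi> x)) - (LINT x|lborel. w x * (grad \<psi> x \<bullet> m))\<bar> \<le> C1 * s * W"
          using C1(2)[rule_format, OF s(1,2) w] by (simp add: W_def)
        moreover have "\<bar>LINT x|lborel. w x * (grad \<psi> x \<bullet> m)\<bar> \<le> \<delta> * L * A * W"
          using \<psi>w w by (simp add: W_def A_def)
        ultimately show ?thesis unfolding distrib_right by linarith
      qed
      have "\<bar>s * (LINT x|lborel. (k x *\<^sub>R Z x) \<bullet> grad w x)\<bar> \<le> s * ((M * B * N\<psi>) * W)"
        unfolding abs_mult using t3 s(1) by (simp add: mult_left_mono)
      then have "\<bar>LINT x|lborel. k x * (grad v x \<bullet> grad w x)\<bar>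
        \<le> sqrt (A\<^sup>2 * (\<delta> * L)\<^sup>2 + C2 * s) * W + (\<delta> * L * A + C1 * s) * W + s * ((M * B * N\<psi>) * W)"
        unfolding q2 using t1 t2 by linarith
      also have "\<dots> = num s * W" by (simp add: num_def distrib_right mult.assoc)
      finally show ?thesis unfolding q1 W_def .
    qed
    have vX: "v \<in> E.X" using v E.S_sub_X by blast
    have lv: "l2norm (lebesgue_on \<Omega>) (grad f) = l2norm lborel (grad f)" if f: "f \<in> test_functions \<Omega>" for f
      by (rule l2norm_test_lborel[OF \<Omega>(1) smooth_grad_measurable[OF test_functions_smooth[OF f]]
            test_functions_zero_outside(2)[OF f]])
    have "\<exists>\<nu>\<in>spectrum E.H (grad_norm \<Omega>) (E.T ?I). \<bar>\<nu> - \<mu>\<bar> \<le> 3 * \<delta>"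
    proof (rule E.quasimode_spectrum[OF _ Isub vX test_functions_weak_gradient[OF \<Omega>(1) v]])
      show "?I \<in> sets lebesgue" using Io by auto
      show "l2norm (lebesgue_on \<Omega>) (grad v) > 0" using lv[OF v] den_le small(2) by linarith
      show "3 * \<delta> \<ge> 0" using \<delta> by simp
      fix w assume w: "w \<in> test_functions \<Omega>"
      have "num s \<le> 3 * \<delta> * l2norm lborel (grad v)"
        using small(1) mult_left_mono[OF den_le, of "3 * \<delta>"] \<delta> by linarith
      then have "num s * l2norm lborel (grad w) \<le> 3 * \<delta> * l2norm lborel (grad v) * l2norm lborel (grad w)"
        by (intro mult_right_mono) auto
      then show "\<exists>H. weak_gradient \<Omega> w H \<and> \<bar>(LINT x|lebesgue_on ?I. grad v x \<bullet> H x) - \<mu> * (LINT x|lebesgue_on \<Omega>. grad v x \<bullet> H x)\<bar>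
        \<le> 3 * \<delta> * l2norm (lebesgue_on \<Omega>) (grad v) * l2norm (lebesgue_on \<Omega>) H"
        using est[OF w] lv[OF v] lv[OF w] by (intro exI[of _ "grad w"] conjI test_functions_weak_gradient[OF \<Omega>(1) w]) simp
    qed
    then show ?thesis unfolding spectrum_eps_def EH ET .
  qed
  have id: "((\<lambda>s. s) \<longlongrightarrow> (0::real)) (at_right 0)" by (rule tendsto_ident_at)
  have nl: "(num \<longlongrightarrow> sqrt (A\<^sup>2 * (\<delta> * L)\<^sup>2 + C2 * 0) + (\<delta> * L * A + C1 * 0) + 0 * (M * B * N\<psi>)) (at_right 0)"
    unfolding num_def[abs_def] by (intro tendsto_intros id)
  have dl: "(den \<longlongrightarrow> sqrt (A\<^sup>2 * L\<^sup>2 - C3 * 0) - 0 * (B * N\<psi>)) (at_right 0)"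
    unfolding den_def[abs_def] by (intro tendsto_intros id)
  have n0: "sqrt (A\<^sup>2 * (\<delta> * L)\<^sup>2 + C2 * 0) + (\<delta> * L * A + C1 * 0) + 0 * (M * B * N\<psi>) = 2 * (\<delta> * (A * L))"
    using A L \<delta> by (simp add: real_sqrt_mult)
  have d0: "sqrt (A\<^sup>2 * L\<^sup>2 - C3 * 0) - 0 * (B * N\<psi>) = A * L"
    using A L by (simp add: real_sqrt_mult)
  have AL: "\<delta> * (A * L) > 0" "A * L > 0" using A L \<delta> by auto
  have "((\<lambda>s. 3 * \<delta> * den s - num s) \<longlongrightarrow> 3 * \<delta> * (A * L) - 2 * (\<delta> * (A * L))) (at_right 0)"
    using nl dl unfolding n0 d0 by (intro tendsto_intros)
  then have ev1: "eventually (\<lambda>s. 3 * \<delta> * den s - num s > 0) (at_right 0)"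
    using AL by (intro order_tendstoD(1)) (auto simp: algebra_simps)
  have ev2: "eventually (\<lambda>s. den s > 0) (at_right 0)"
    by (rule order_tendstoD(1)[OF dl[unfolded d0] AL(2)])
  have ev3: "eventually (\<lambda>s::real. s * (2 * real CARD('n)) < d) (at_right 0)"
  proof (rule order_tendstoD(2))
    show "((\<lambda>s. s * (2 * real CARD('n))) \<longlongrightarrow> 0 * (2 * real CARD('n))) (at_right 0)" by (intro tendsto_intros id)
  qed (use d in simp)
  have ev4: "eventually (\<lambda>s::real. s < 1) (at_right 0)" by (rule order_tendstoD(2)[OF id]) simp
  have ev5: "eventually (\<lambda>s::real. s > 0) (at_right 0)" by (simp add: eventually_at_right_less)
  from ev1 ev2 ev3 ev4 ev5 show ?thesis
    by eventually_elim (rule key, auto)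
qed

theorem theorem4p2:
  fixes \<Omega> \<omega> :: "(real^'n) set"
  assumes "CARD('n) \<ge> 2"
    and "bounded \<Omega>" and "lipschitz_domain \<Omega>"
    and "\<omega> \<Subset> unit_cell" and "open_of_class_C2 \<omega>"
    and "connected \<omega>" and "connected (unit_cell - closure \<omega>)"
  shows "cell_spectrum \<omega> \<subseteq> limit_spectrum \<Omega> \<omega>"
proof
  fix \<mu> assume \<mu>: "\<mu> \<in> cell_spectrum \<omega>"
  have \<Omega>: "open \<Omega>" "\<Omega> \<noteq> {}" using assms(3) by (auto simp: lipschitz_domain_def)
  have \<omega>: "open \<omega>" "\<omega> \<subseteq> unit_cell"
    using assms(4,5) closure_subset[of \<omega>] by (auto simp: open_of_class_C2_def compactly_contained_def)
  obtain r where "\<forall>x\<in>\<Omega>. norm x \<le> r" using assms(2) by (auto simp: bounded_iff)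
  then have r: "\<Omega> \<subseteq> cball 0 \<bar>r\<bar>" by force
  have \<omega>b: "\<omega> \<in> sets borel" using \<omega>(1) by simp
  have range: "- \<delta> \<le> \<mu> \<and> \<mu> \<le> 1 + \<delta>" if "\<delta> > 0" for \<delta>
    using cell_quasimode[OF \<mu> \<omega>b \<omega>(2) that] by (elim exE conjE) (rule conjI; assumption)
  have \<mu>01: "\<mu> \<in> {0..1}"
  proof -
    have "0 \<le> \<mu>" by (rule field_le_epsilon) (use range in force)
    moreover have "\<mu> \<le> 1" by (rule field_le_epsilon) (use range in force)
    ultimately show ?thesis by simp
  qed
  define P where "P k s \<longleftrightarrow> (\<exists>\<nu>\<in>spectrum_eps \<Omega> \<omega> s. \<bar>\<nu> - \<mu>\<bar> \<le> 3 * (1 / real (Suc k)))" for k s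
  have "\<exists>b>0. \<forall>s>0. s < b \<longrightarrow> P k s" for k
    using eps_spectrum_near[OF assms(1) \<Omega> r abs_ge_zero \<omega> \<mu>, of "1 / real (Suc k)"]
    unfolding P_def eventually_at_right_field by simp
  then have "\<exists>b. \<forall>k. b k > 0 \<and> (\<forall>s>0. s < b k \<longrightarrow> P k s)" by (intro choice allI)
  then obtain b where b: "\<And>k. b k > 0" "\<And>k s. s > 0 \<Longrightarrow> s < b k \<Longrightarrow> P k s" by blast
  define c where "c k = min (b k) (1 / real (Suc k))" for k
  define e where "e j = Min (c ` {..j}) / 2" for j
  have cpos: "c k > 0" for k using b(1) by (simp add: c_def)
  have minpos: "Min (c ` {..j}) > 0" for j using cpos by (subst Min_gr_iff) auto
  have e_le: "e j \<le> c j / 2" for j unfolding e_def by (intro divide_right_mono Min_le) auto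
  have epos: "e j > 0" for j using minpos by (simp add: e_def)
  have elt: "e j < b j" and ek: "e j \<le> 1 / real (Suc j)" for j
  proof -
    have "c j \<le> b j" "c j \<le> 1 / real (Suc j)" by (auto simp: c_def)
    then show "e j < b j" "e j \<le> 1 / real (Suc j)" using e_le[of j] cpos[of j] by linarith+
  qed
  have dec: "decseq e" unfolding decseq_def e_def by (intro allI impI divide_right_mono Min_antimono) auto
  have e0: "e \<longlonglongrightarrow> 0"
  proof (rule tendsto_sandwich[OF _ _ tendsto_const])
    show "(\<lambda>j. 1 / real (Suc j)) \<longlonglongrightarrow> 0" by (intro lim_1_over_n LIMSEQ_Suc)
  qed (use epos ek in \<open>simp_all add: less_imp_le\<close>)
  have "\<exists>\<nu>. \<nu> \<in> spectrum_eps \<Omega> \<omega> (e j) \<and> \<bar>\<nu> - \<mu>\<bar> \<le> 3 * (1 / real (Suc j))" for j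
    using b(2)[OF epos elt, of j] unfolding P_def by blast
  then have "\<exists>l. \<forall>j. l j \<in> spectrum_eps \<Omega> \<omega> (e j) \<and> \<bar>l j - \<mu>\<bar> \<le> 3 * (1 / real (Suc j))" by (intro choice allI)
  then obtain l where l: "\<And>j. l j \<in> spectrum_eps \<Omega> \<omega> (e j)" "\<And>j. \<bar>l j - \<mu>\<bar> \<le> 3 * (1 / real (Suc j))" by blast
  have "(\<lambda>j. 3 * (1 / real (Suc j))) \<longlonglongrightarrow> 3 * 0" by (intro tendsto_mult tendsto_const lim_1_over_n LIMSEQ_Suc)
  then have "(\<lambda>j. l j - \<mu>) \<longlonglongrightarrow> 0"
    by (intro Lim_null_comparison[of "\<lambda>j. l j - \<mu>" "\<lambda>j. 3 * (1 / real (Suc j))"]) (use l(2) in auto)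
  then have "l \<longlonglongrightarrow> \<mu>" using LIM_zero_iff by blast
  then show "\<mu> \<in> limit_spectrum \<Omega> \<omega>"
    unfolding limit_spectrum_def using \<mu>01 epos dec e0 l(1) by blast
qed

end
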